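(* Let $n,d$ be positive integers with $n\geq 29d$. Then $f(n,d)=\left\lceil\frac{n+d-2}{2}\right\rceil$.
   Context: All graphs are finite and simple. A $d$-dimensional framework $(G,p)$ is a graph $G=(V,E)$ with a map $p:V\to\mathbb{R}^d$; it is rigid if every continuous motion of the vertices starting at $p$ that keeps all edge lengths constant also keeps all pairwise distances constant. It is generic if the coordinates of $p$ are algebraically independent over $\mathbb{Q}$. A graph $G$ is $d$-rigid if some (equivalently every) generic $d$-dimensional framework $(G,p)$ is rigid. $\delta(G)$ is the minimum degree. For $n,d\in\mathbb{N}$, $f(n,d)$ is the smallest integer such that every $n$-vertex graph $G$ with $\delta(G)\geq f(n,d)$ is $d$-rigid. *)

theory Defs
  imports Complex_Main
begin

text \<open>Graphs on n vertices have vertex set {0..<n}; edges are 2-element sets.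
 Points of R^d are functions nat => real, only coordinates i < d matter.\<close>

definition is_graph :: "nat \<Rightarrow> nat set set \<Rightarrow> bool" where
  "is_graph n E \<longleftrightarrow> (\<forall>e\<in>E. \<exists>u v. e = {u, v} \<and> u \<noteq> v \<and> u < n \<and> v < n)"

definition degree :: "nat \<Rightarrow> nat set set \<Rightarrow> nat \<Rightarrow> nat" where
  "degree n E v = card {u. u < n \<and> {u, v} \<in> E}"

definition min_degree_ge :: "nat \<Rightarrow> nat set set \<Rightarrow> nat \<Rightarrow> bool" where
  "min_degree_ge n E k \<longleftrightarrow> (\<forall>v<n. k \<le> degree n E v)"

definition dist2 :: "nat \<Rightarrow> (nat \<Rightarrow> real) \<Rightarrow> (nat \<Rightarrow> real) \<Rightarrow> real" where
  "dist2 d a b = (\<Sum>i<d. (a i - b i) ^ 2)"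

definition alg_indep_rat :: "'j set \<Rightarrow> ('j \<Rightarrow> real) \<Rightarrow> bool" where
  "alg_indep_rat J x \<longleftrightarrow>
     (\<forall>(M :: ('j \<Rightarrow> nat) set) (c :: ('j \<Rightarrow> nat) \<Rightarrow> rat).
        finite M \<and> (\<forall>\<alpha>\<in>M. \<forall>j. j \<notin> J \<longrightarrow> \<alpha> j = 0) \<and>
        (\<Sum>\<alpha>\<in>M. of_rat (c \<alpha>) * (\<Prod>j\<in>J. x j ^ \<alpha> j)) = 0
        \<longrightarrow> (\<forall>\<alpha>\<in>M. c \<alpha> = 0))"

definition generic :: "nat \<Rightarrow> nat \<Rightarrow> (nat \<Rightarrow> nat \<Rightarrow> real) \<Rightarrow> bool" where
  "generic n d p \<longleftrightarrow> alg_indep_rat ({0..<n} \<times> {0..<d}) (\<lambda>(v, i). p v i)"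

definition rigid_framework :: "nat \<Rightarrow> nat \<Rightarrow> nat set set \<Rightarrow> (nat \<Rightarrow> nat \<Rightarrow> real) \<Rightarrow> bool" where
  "rigid_framework n d E p \<longleftrightarrow>
     (\<forall>m :: real \<Rightarrow> nat \<Rightarrow> nat \<Rightarrow> real.
        (\<forall>v<n. \<forall>i<d. continuous_on {0..1} (\<lambda>t. m t v i)) \<and>
        (\<forall>v<n. \<forall>i<d. m 0 v i = p v i) \<and>
        (\<forall>t\<in>{0..1}. \<forall>u<n. \<forall>v<n. {u, v} \<in> E \<longrightarrow>
            dist2 d (m t u) (m t v) = dist2 d (p u) (p v))
        \<longrightarrow> (\<forall>t\<in>{0..1}. \<forall>u<n. \<forall>v<n. dist2 d (m t u) (m t v) = dist2 d (p u) (p v)))"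

definition d_rigid :: "nat \<Rightarrow> nat \<Rightarrow> nat set set \<Rightarrow> bool" where
  "d_rigid n d E \<longleftrightarrow> (\<exists>p. generic n d p \<and> rigid_framework n d E p)"

definition f :: "nat \<Rightarrow> nat \<Rightarrow> nat" where
  "f n d = (LEAST k. \<forall>E. is_graph n E \<and> min_degree_ge n E k \<longrightarrow> d_rigid n d E)"

end

theory Submission
  imports Defs "HOL-Analysis.Analysis" "HOL-Computational_Algebra.Polynomial" "HOL-Library.Function_Algebras"
begin

text \<open>
  Lower bound: two cliques that share \<open>d - 1\<close> vertices can be rotated against each other about the
  affine hull of the shared vertices.

  Upper bound: let \<open>m\<close> be a non-trivial infinitesimal motion of a generic framework. Modulo trivial
  motions write it as a sum of \<open>k\<close> fields with constant directions \<open>b i\<close> and coefficients \<open>g i v\<close>,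
  with \<open>k\<close> minimal. With \<open>y i v\<close> the inner product of \<open>b i\<close> and \<open>p v\<close>, each edge \<open>uv\<close> says that
  \<open>z u - z v\<close> is isotropic for the hyperbolic form, where \<open>z v = (y v, g v)\<close>. The coordinates of
  \<open>p\<close> being algebraically independent, the derivations of the real field take arbitrary values on
  them. Ordering the vertices, and bounding the number of equations that force a derivation vanishing
  on the \<open>b i\<close> and on all earlier vertices to vanish at the next vertex, gives a total of at least
  \<open>n * d\<close>; an edge to an earlier vertex saves an equation unless its vector \<open>z\<close> is dependent on
  those of other earlier neighbours. Adding this inequality for an order and its reverse and using
  submodularity of the rank of the vectors \<open>z\<close> contradicts the minimum degree when \<open>29 * d \<le> n\<close>.

  Passage to continuous motions: the difference of two configurations with equal edge lengths is an
  infinitesimal motion of their midpoint, so by compactness the configurations congruent to \<open>p\<close> form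
  an open subset of every motion.
\<close>

section \<open>Extension of derivations\<close>

text \<open>Derivations replace transcendence degree: if every derivation vanishing on a finite set
  of reals kills all coordinates of \<open>p\<close>, that set has at least \<open>n * d\<close>
  elements, so counting reduces to ranks of linear systems. Minimality of \<open>k\<close> is what
  makes those ranks usable: an isotropic vector orthogonal to all differences of the
  \<open>z v\<close> would eliminate a field, so the form has no radical on their span. The obstacle
  is one unit per vertex. Edges to earlier vertices constrain a new point by the rank of
  differences, which is one less than the rank of the vectors once \<open>z v\<close> depends on its
  earlier neighbours. If the \<open>z v\<close> span and the neighbourhood has the least rank
  \<open>k + 1\<close>, the unit is regained, since otherwise the star of the vertex would be
  totally isotropic and hence a rigid cluster. In the other cases the excess rank of neighbourhoods,
  forced on average by their large overlaps, or the codimension of the span compensates. The bound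
  \<open>29 * d \<le> n\<close> enters only in the last inequality, which has two regimes,
  \<open>k \<le> 9\<close> and \<open>k \<ge> 10\<close>.\<close>

definition derivation_on :: "real set \<Rightarrow> (real \<Rightarrow> real) \<Rightarrow> bool" where
  "derivation_on A D \<longleftrightarrow> 1 \<in> A \<and> (\<forall>x\<in>A. - x \<in> A) \<and>
     (\<forall>x\<in>A. \<forall>y\<in>A. x + y \<in> A \<and> x * y \<in> A \<and> D (x + y) = D x + D y \<and> D (x * y) = x * D y + y * D x)"

abbreviation derivation :: "(real \<Rightarrow> real) \<Rightarrow> bool" where
  "derivation \<equiv> derivation_on UNIV"

context
  fixes A :: "real set" and D :: "real \<Rightarrow> real"
  assumes der: "derivation_on A D"
begin

lemma derivation_on_closed:
  "1 \<in> A" "x \<in> A \<Longrightarrow> - x \<in> A" "x \<in> A \<Longrightarrow> y \<in> A \<Longrightarrow> x + y \<in> A" "x \<in> A \<Longrightarrow> y \<in> A \<Longrightarrow> x * y \<in> A"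
  "0 \<in> A" "x \<in> A \<Longrightarrow> y \<in> A \<Longrightarrow> x - y \<in> A"
proof -
  show 1: "1 \<in> A" "x \<in> A \<Longrightarrow> - x \<in> A" "x \<in> A \<Longrightarrow> y \<in> A \<Longrightarrow> x + y \<in> A" "x \<in> A \<Longrightarrow> y \<in> A \<Longrightarrow> x * y \<in> A" for x y
    using der by (auto simp: derivation_on_def)
  show "0 \<in> A" using 1(1) 1(2)[OF 1(1)] 1(3)[of 1 "-1"] by simp
  show "x \<in> A \<Longrightarrow> y \<in> A \<Longrightarrow> x - y \<in> A" using 1(3)[of x "- y"] 1(2)[of y] by simp
qed

lemma derivation_on_add: "x \<in> A \<Longrightarrow> y \<in> A \<Longrightarrow> D (x + y) = D x + D y"
  using der by (auto simp: derivation_on_def)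

lemma derivation_on_mult: "x \<in> A \<Longrightarrow> y \<in> A \<Longrightarrow> D (x * y) = x * D y + y * D x"
  using der by (auto simp: derivation_on_def)

lemma derivation_on_0: "D 0 = 0"
  using derivation_on_add[of 0 0] derivation_on_closed(5) by simp

lemma derivation_on_1: "D 1 = 0"
  using derivation_on_mult[of 1 1] derivation_on_closed(1) by simp

lemma derivation_on_uminus: "x \<in> A \<Longrightarrow> D (- x) = - D x"
  using derivation_on_add[of x "- x"] derivation_on_closed(2)[of x] derivation_on_0 by simp

lemma derivation_on_diff: "x \<in> A \<Longrightarrow> y \<in> A \<Longrightarrow> D (x - y) = D x - D y"
  using derivation_on_add[of x "- y"] derivation_on_closed(2)[of y] derivation_on_uminus[of y] by simp

lemma derivation_on_sum:
  "(\<And>i. i \<in> I \<Longrightarrow> h i \<in> A) \<Longrightarrow> (\<Sum>i\<in>I. h i) \<in> A \<and> D (\<Sum>i\<in>I. h i) = (\<Sum>i\<in>I. D (h i))"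
  by (induction I rule: infinite_finite_induct)
    (auto simp: derivation_on_0 derivation_on_closed derivation_on_add)

lemma derivation_on_of_nat: "of_nat n \<in> A"
  by (induction n) (auto simp: derivation_on_closed)

section \<open>Polynomials over the subring and their formal derivatives\<close>

definition polys :: "real poly set" where
  "polys = {Q. \<forall>i. coeff Q i \<in> A}"

lemma polys_closed:
  "P \<in> polys \<Longrightarrow> Q \<in> polys \<Longrightarrow> P + Q \<in> polys"
  "P \<in> polys \<Longrightarrow> Q \<in> polys \<Longrightarrow> P - Q \<in> polys"
  "P \<in> polys \<Longrightarrow> Q \<in> polys \<Longrightarrow> P * Q \<in> polys"
  "P \<in> polys \<Longrightarrow> - P \<in> polys"
  "P \<in> polys \<Longrightarrow> pderiv P \<in> polys"
  "a \<in> A \<Longrightarrow> monom a n \<in> polys"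
  "a \<in> A \<Longrightarrow> [:a:] \<in> polys"
  by (auto simp: polys_def derivation_on_closed coeff_mult coeff_pderiv coeff_monom coeff_pCons
      intro!: derivation_on_sum[THEN conjunct1] derivation_on_closed(4)[OF derivation_on_of_nat] split: nat.split
      simp del: of_nat_Suc)

definition dpoly :: "real poly \<Rightarrow> real poly" where
  "dpoly Q = map_poly D Q"

lemma coeff_dpoly: "coeff (dpoly Q) i = D (coeff Q i)"
  by (simp add: dpoly_def coeff_map_poly derivation_on_0)

lemma dpoly_add: "P \<in> polys \<Longrightarrow> Q \<in> polys \<Longrightarrow> dpoly (P + Q) = dpoly P + dpoly Q"
  by (rule poly_eqI) (simp add: coeff_dpoly polys_def derivation_on_add)

lemma dpoly_mult:
  assumes "P \<in> polys" "Q \<in> polys"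
  shows "dpoly (P * Q) = P * dpoly Q + Q * dpoly P"
proof (rule poly_eqI)
  fix n
  have in_A: "coeff P i \<in> A" "coeff Q i \<in> A" for i using assms by (auto simp: polys_def)
  have "coeff (dpoly (P * Q)) n = D (\<Sum>i\<le>n. coeff P i * coeff Q (n - i))"
    by (simp add: coeff_dpoly coeff_mult)
  also have "\<dots> = (\<Sum>i\<le>n. D (coeff P i * coeff Q (n - i)))"
    by (rule derivation_on_sum[THEN conjunct2]) (intro derivation_on_closed(4) in_A)
  also have "\<dots> = (\<Sum>i\<le>n. coeff P i * D (coeff Q (n - i))) + (\<Sum>i\<le>n. coeff Q (n - i) * D (coeff P i))"
    using in_A by (simp add: derivation_on_mult sum.distrib)
  also have "(\<Sum>i\<le>n. coeff Q (n - i) * D (coeff P i)) = (\<Sum>i\<le>n. coeff Q i * D (coeff P (n - i)))"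
    by (rule sum.reindex_bij_witness[of _ "\<lambda>i. n - i" "\<lambda>i. n - i"]) auto
  finally show "coeff (dpoly (P * Q)) n = coeff (P * dpoly Q + Q * dpoly P) n"
    by (simp add: coeff_mult coeff_dpoly)
qed

text \<open>The value that \<open>D (poly Q x)\<close> is forced to take once
  \<open>D x = t\<close>: the first summand differentiates the coefficients, the second the
  variable.\<close>

definition evd :: "real \<Rightarrow> real \<Rightarrow> real poly \<Rightarrow> real" where
  "evd x t Q = poly (dpoly Q) x + t * poly (pderiv Q) x"

lemma evd_add: "P \<in> polys \<Longrightarrow> Q \<in> polys \<Longrightarrow> evd x t (P + Q) = evd x t P + evd x t Q"
  by (simp add: evd_def dpoly_add pderiv_add algebra_simps)

lemma evd_mult: "P \<in> polys \<Longrightarrow> Q \<in> polys \<Longrightarrow> evd x t (P * Q) = poly P x * evd x t Q + poly Q x * evd x t P"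
  by (simp add: evd_def dpoly_mult pderiv_mult algebra_simps)

lemma evd_const: "evd x t [:a:] = D a"
  by (simp add: evd_def dpoly_def map_poly_pCons derivation_on_0)

lemma evd_uminus: "P \<in> polys \<Longrightarrow> evd x t (- P) = - evd x t P"
proof -
  assume P: "P \<in> polys"
  have "dpoly (- P) = - dpoly P"
    using P by (intro poly_eqI) (simp add: coeff_dpoly polys_def derivation_on_uminus)
  then show ?thesis by (simp add: evd_def pderiv_minus)
qed

lemma evd_diff: "P \<in> polys \<Longrightarrow> Q \<in> polys \<Longrightarrow> evd x t (P - Q) = evd x t P - evd x t Q"
  using evd_add[of P "- Q"] evd_uminus[of Q] polys_closed(4)[of Q] by simp

text \<open>The assumption makes the forced value \<open>evd x t Q\<close> depend on
  \<open>poly Q x\<close> only, since the difference of two representatives vanishes at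
  \<open>x\<close>. It therefore defines a derivation on the ring of all values
  \<open>poly Q x\<close>.\<close>

lemma derivation_on_adjoin:
  assumes H: "\<And>Q. Q \<in> polys \<Longrightarrow> poly Q x = 0 \<Longrightarrow> evd x t Q = 0"
  shows "\<exists>A' D'. derivation_on A' D' \<and> A \<subseteq> A' \<and> x \<in> A' \<and> (\<forall>a\<in>A. D' a = D a) \<and> D' x = t"
proof -
  define A' where "A' = {poly Q x | Q. Q \<in> polys}"
  define D' where "D' y = evd x t (SOME Q. Q \<in> polys \<and> poly Q x = y)" for y
  have D': "D' (poly Q x) = evd x t Q" if "Q \<in> polys" for Q
  proof -
    define P where "P = (SOME P. P \<in> polys \<and> poly P x = poly Q x)"
    have P: "P \<in> polys \<and> poly P x = poly Q x"
      unfolding P_def using that by (rule_tac someI[of _ Q]) auto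
    have "evd x t (P - Q) = 0" using P that by (intro H) (auto simp: polys_closed)
    then show ?thesis using P that by (simp add: D'_def P_def[symmetric] evd_diff)
  qed
  have in_A': "poly Q x \<in> A'" if "Q \<in> polys" for Q using that by (auto simp: A'_def)
  have "derivation_on A' D'" unfolding derivation_on_def
  proof (intro conjI ballI)
    show "1 \<in> A'" using in_A'[OF polys_closed(7)[OF derivation_on_closed(1)]] by simp
  next
    fix u assume "u \<in> A'"
    then show "- u \<in> A'" using in_A'[OF polys_closed(4)] by (auto simp: A'_def)
  next
    fix u v assume "u \<in> A'" "v \<in> A'"
    then obtain P Q where PQ: "P \<in> polys" "Q \<in> polys" "u = poly P x" "v = poly Q x"
      by (auto simp: A'_def)
    show "u + v \<in> A'" using in_A'[OF polys_closed(1)[OF PQ(1,2)]] PQ by simp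
    show "u * v \<in> A'" using in_A'[OF polys_closed(3)[OF PQ(1,2)]] PQ by simp
    show "D' (u + v) = D' u + D' v"
      using D'[OF polys_closed(1)[OF PQ(1,2)]] PQ by (simp add: D' evd_add)
    show "D' (u * v) = u * D' v + v * D' u"
      using D'[OF polys_closed(3)[OF PQ(1,2)]] PQ by (simp add: D' evd_mult)
  qed
  moreover have "a \<in> A' \<and> D' a = D a" if "a \<in> A" for a
    using in_A'[OF polys_closed(7)[OF that]] D'[OF polys_closed(7)[OF that]] by (simp add: evd_const)
  moreover have "x \<in> A' \<and> D' x = t"
    using in_A'[OF polys_closed(6)[OF derivation_on_closed(1), of 1]]
      D'[OF polys_closed(6)[OF derivation_on_closed(1), of 1]]
    by (simp add: poly_monom evd_def dpoly_def map_poly_monom derivation_on_0 derivation_on_1 pderiv_monom)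
  ultimately show ?thesis by blast
qed

text \<open>For transcendental \<open>x\<close> the value at \<open>x\<close> is free, and 0 is
  taken. For algebraic \<open>x\<close> it is forced by an annihilating polynomial of least degree,
  whose derivative does not vanish at \<open>x\<close> in characteristic 0.\<close>

lemma derivation_on_extend_one:
  "\<exists>A' D'. derivation_on A' D' \<and> A \<subseteq> A' \<and> x \<in> A' \<and> (\<forall>a\<in>A. D' a = D a)"
proof (cases "\<exists>P\<in>polys. P \<noteq> 0 \<and> poly P x = 0")
  case False
  have "evd x 0 Q = 0" if "Q \<in> polys" "poly Q x = 0" for Q
  proof -
    have "Q = 0" using that False by blast
    then show ?thesis by (simp add: evd_def dpoly_def)
  qed
  then show ?thesis using derivation_on_adjoin[of x 0] by blast
next
  case True
  define isP where "isP P \<longleftrightarrow> P \<in> polys \<and> P \<noteq> 0 \<and> poly P x = 0" for P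
  define P where "P = arg_min Polynomial.degree isP"
  have "isP P" and min: "\<And>Q. isP Q \<Longrightarrow> Polynomial.degree P \<le> Polynomial.degree Q"
    using True arg_min_nat_lemma[of isP _ Polynomial.degree] unfolding P_def isP_def by blast+
  then have P: "P \<in> polys" "P \<noteq> 0" "poly P x = 0" by (auto simp: isP_def)
  have dP: "Polynomial.degree P \<noteq> 0"
  proof
    assume "Polynomial.degree P = 0"
    then obtain a where "P = [:a:]" by (rule degree_eq_zeroE)
    then show False using P by simp
  qed
  have "poly (pderiv P) x \<noteq> 0"
  proof
    assume "poly (pderiv P) x = 0"
    then have "isP (pderiv P)" using P dP by (auto simp: isP_def polys_closed pderiv_eq_0_iff)
    then have "Polynomial.degree P \<le> Polynomial.degree P - 1" using min by (metis degree_pderiv)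
    then show False using dP by simp
  qed
  define t where "t = - poly (dpoly P) x / poly (pderiv P) x"
  have EP: "evd x t P = 0" using \<open>poly (pderiv P) x \<noteq> 0\<close> by (simp add: evd_def t_def)
  have "evd x t Q = 0" if "Q \<in> polys" "poly Q x = 0" for Q
    using that
  proof (induction "Polynomial.degree Q" arbitrary: Q rule: less_induct)
    case less
    show ?case
    proof (cases "Q = 0")
      case True
      then show ?thesis by (simp add: evd_def dpoly_def)
    next
      case False
      then have dQ: "Polynomial.degree P \<le> Polynomial.degree Q" using less.prems min by (auto simp: isP_def)
      define a where "a = lead_coeff P"
      define b where "b = lead_coeff Q"
      define e where "e = Polynomial.degree Q - Polynomial.degree P"
      have ab: "a \<in> A" "b \<in> A" "a \<noteq> 0" using P less.prems(1) by (auto simp: a_def b_def polys_def)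
      \<comment> \<open>\<open>A\<close> is only a ring, so division by \<open>P\<close> is replaced
        by cancelling leading terms after multiplying \<open>Q\<close> with the leading coefficient
        of \<open>P\<close>. This changes \<open>evd\<close> only by the factor \<open>a\<close>,
        because \<open>P\<close> and \<open>Q\<close> vanish at \<open>x\<close> and
        \<open>evd x t P = 0\<close>.\<close>
      define S where "S = [:a:] * Q - (monom b e * P)"
      have mem: "[:a:] * Q \<in> polys" "monom b e * P \<in> polys" "monom b e \<in> polys"
        using ab P less.prems by (auto simp only: intro!: polys_closed)
      then have S: "S \<in> polys" unfolding S_def by (simp add: polys_closed)
      have S0: "poly S x = 0" using P less.prems by (simp add: S_def)
      have ES: "evd x t S = a * evd x t Q"
        using mem ab P less.prems EP
        by (simp only: S_def evd_diff evd_mult[OF polys_closed(7)[OF ab(1)] less.prems(1)] evd_mult[OF mem(3) P(1)])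
           (simp add: evd_const)
      have "evd x t S = 0"
      proof (cases "S = 0")
        case True
        then show ?thesis by (simp add: evd_def dpoly_def)
      next
        case nz: False
        have "coeff S (Polynomial.degree Q) = 0"
          using dQ by (simp add: S_def a_def b_def e_def coeff_monom_mult)
        moreover have "Polynomial.degree S \<le> Polynomial.degree Q"
          unfolding S_def
        proof (rule degree_diff_le)
          show "Polynomial.degree ([:a:] * Q) \<le> Polynomial.degree Q" by (simp add: degree_smult_le)
          show "Polynomial.degree (monom b e * P) \<le> Polynomial.degree Q"
            using degree_mult_le[of "monom b e" P] degree_monom_le[of b e] dQ by (simp add: e_def)
        qed
        ultimately have "Polynomial.degree S < Polynomial.degree Q"
          using nz by (metis le_neq_implies_less leading_coeff_0_iff)
        then show ?thesis using less.hyps S S0 by blast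
      qed
      then show ?thesis using ES ab by simp
    qed
  qed
  then show ?thesis using derivation_on_adjoin[of x t] by blast
qed

end

text \<open>Zorn's lemma on graphs of partial derivations: unions of chains are again such graphs,
  and a maximal one is total because one more element could always be added.\<close>

theorem derivation_extend:
  assumes "derivation_on A0 D0"
  shows "\<exists>D. derivation D \<and> (\<forall>a\<in>A0. D a = D0 a)"
proof -
  define gr where "gr A D = {(a, D a) | a. a \<in> A}" for A and D :: "real \<Rightarrow> real"
  define F where "F = {gr A D | A D. derivation_on A D \<and> gr A0 D0 \<subseteq> gr A D}"
  have "gr A0 D0 \<in> F" using assms by (auto simp: F_def)
  have "\<exists>M\<in>F. \<forall>X\<in>F. M \<subseteq> X \<longrightarrow> X = M"
  proof (rule subset_Zorn_nonempty)
    show "F \<noteq> {}" using \<open>gr A0 D0 \<in> F\<close> by blast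
  next
    fix C assume C: "C \<noteq> {}" "subset.chain F C"
    \<comment> \<open>Any two elements of the union lie in the graph of a single member of the
      chain, so the derivation laws have to be checked only there.\<close>
    have two: "\<exists>A D. derivation_on A D \<and> gr A D \<in> C \<and> u \<in> gr A D \<and> v \<in> gr A D"
      if uv: "u \<in> \<Union>C" "v \<in> \<Union>C" for u v
    proof -
      obtain X Y where XY: "X \<in> C" "Y \<in> C" "u \<in> X" "v \<in> Y" using uv by blast
      have "X \<subseteq> Y \<or> Y \<subseteq> X" using C(2) XY by (auto simp: subset_chain_def)
      then obtain Z where Z: "Z \<in> C" "u \<in> Z" "v \<in> Z" using XY by blast
      moreover have "Z \<in> F" using C(2) Z by (auto simp: subset_chain_def)
      ultimately show ?thesis unfolding F_def by blast
    qed
    have grU: "(x, D1 x) \<in> \<Union>C" if "gr A1 D1 \<in> C" "x \<in> A1" for x A1 D1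
      by (rule UnionI[OF that(1)]) (use that(2) in \<open>auto simp: gr_def\<close>)
    define A where "A = fst ` \<Union>C"
    define D where "D a = (SOME b. (a, b) \<in> \<Union>C)" for a
    have D: "D a = b" if "(a, b) \<in> \<Union>C" for a b
    proof -
      have "(a, D a) \<in> \<Union>C" unfolding D_def using that by (rule someI)
      from two[OF this that] show ?thesis by (auto simp: gr_def)
    qed
    have AD: "(a, D a) \<in> \<Union>C \<longleftrightarrow> a \<in> A" for a
      using D by (force simp: A_def image_iff)
    have UC: "\<Union>C = gr A D" using AD D by (auto simp: gr_def A_def image_iff) (metis D Union_iff)+
    have "derivation_on A D" unfolding derivation_on_def
    proof (intro conjI ballI)
      obtain X where "X \<in> C" using C by blast
      moreover then have "X \<in> F" using C(2) by (auto simp: subset_chain_def)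
      ultimately obtain A1 D1 where "derivation_on A1 D1" "gr A1 D1 \<in> C" unfolding F_def by blast
      then have "(1, D1 1) \<in> \<Union>C" by (intro grU) (auto simp: derivation_on_closed(1))
      then show "1 \<in> A" by (force simp: A_def)
    next
      fix x assume "x \<in> A"
      then have "(x, D x) \<in> \<Union>C" using AD by blast
      from two[OF this this] obtain A1 D1 where *: "derivation_on A1 D1" "gr A1 D1 \<in> C" "x \<in> A1"
        by (auto simp: gr_def)
      then have "(- x, D1 (- x)) \<in> \<Union>C" using derivation_on_closed(2)[OF *(1)] by (intro grU) auto
      then show "- x \<in> A" by (force simp: A_def)
    next
      fix x y assume "x \<in> A" "y \<in> A"
      then have xy: "(x, D x) \<in> \<Union>C" "(y, D y) \<in> \<Union>C" using AD by blast+
      from two[OF this] obtain A1 D1 where *: "derivation_on A1 D1" "gr A1 D1 \<in> C" "x \<in> A1" "y \<in> A1"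
        "D x = D1 x" "D y = D1 y" by (auto simp: gr_def)
      have 1: "(x + y, D1 (x + y)) \<in> \<Union>C" "(x * y, D1 (x * y)) \<in> \<Union>C"
        using derivation_on_closed[OF *(1)] * by (auto intro!: grU simp del: Union_iff)
      then show "x + y \<in> A" "x * y \<in> A" by (force simp: A_def)+
      show "D (x + y) = D x + D y" "D (x * y) = x * D y + y * D x"
        using D[OF 1(1)] D[OF 1(2)] * derivation_on_add[OF *(1)] derivation_on_mult[OF *(1)] by auto
    qed
    moreover have "gr A0 D0 \<subseteq> \<Union>C"
    proof -
      obtain X where "X \<in> C" using C by blast
      moreover from this have "X \<in> F" using C(2) by (auto simp: subset_chain_def)
      then have "gr A0 D0 \<subseteq> X" by (auto simp: F_def)
      ultimately show ?thesis by blast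
    qed
    ultimately show "\<Union>C \<in> F" using UC by (auto simp: F_def)
  qed
  then obtain M where M: "M \<in> F" "\<forall>X\<in>F. M \<subseteq> X \<longrightarrow> X = M" by blast
  from M(1) obtain A D where AD: "derivation_on A D" "gr A0 D0 \<subseteq> gr A D" and MA: "M = gr A D"
    unfolding F_def by blast
  have max: "\<And>X. X \<in> F \<Longrightarrow> gr A D \<subseteq> X \<Longrightarrow> X = gr A D" using M(2) MA by simp
  have "x \<in> A" for x
  proof -
    obtain A' D' where *: "derivation_on A' D'" "A \<subseteq> A'" "x \<in> A'" "\<forall>a\<in>A. D' a = D a"
      using derivation_on_extend_one[OF AD(1), of x] by blast
    have "gr A D \<subseteq> gr A' D'" using * by (auto simp: gr_def)
    moreover from this have "gr A' D' \<in> F" using *(1) subset_trans[OF AD(2)] unfolding F_def by blast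
    ultimately have "gr A' D' = gr A D" using max by blast
    moreover have "(x, D' x) \<in> gr A' D'" using * by (auto simp: gr_def)
    ultimately show ?thesis by (auto simp: gr_def)
  qed
  then have "A = UNIV" by blast
  moreover have "\<forall>a\<in>A0. D a = D0 a" using AD(2) by (auto simp: gr_def)
  ultimately show ?thesis using AD by blast
qed

section \<open>Polynomial rings over the rationals and algebraic independence\<close>

definition mon :: "'j set \<Rightarrow> ('j \<Rightarrow> real) \<Rightarrow> ('j \<Rightarrow> nat) \<Rightarrow> real" where
  "mon J x \<alpha> = (\<Prod>j\<in>J. x j ^ \<alpha> j)"

text \<open>For finite \<open>J\<close>, the subring generated over the rationals by the
  \<open>x j\<close>. Lists of terms with repetitions make closure under sum and product easy;
  \<open>poly_ring_as_sum\<close> later merges equal exponents to match the format of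
  \<open>alg_indep_rat\<close>.\<close>

definition poly_ring :: "'j set \<Rightarrow> ('j \<Rightarrow> real) \<Rightarrow> real set" where
  "poly_ring J x = {\<Sum>(q, \<alpha>)\<leftarrow>qs. of_rat q * mon J x \<alpha> | qs. \<forall>(q, \<alpha>)\<in>set qs. \<forall>j. j \<notin> J \<longrightarrow> \<alpha> j = 0}"

lemma poly_ring_term: "(\<And>j. j \<notin> J \<Longrightarrow> \<alpha> j = 0) \<Longrightarrow> of_rat q * mon J x \<alpha> \<in> poly_ring J x"
  unfolding poly_ring_def by (rule CollectI, rule exI[of _ "[(q, \<alpha>)]"]) auto

lemma mon_add: "mon J x (\<lambda>j. \<alpha> j + \<beta> j) = mon J x \<alpha> * mon J x \<beta>"
  by (simp add: mon_def power_add prod.distrib)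

text \<open>The zero map is the derivation from which all extensions start; in this form the lemma
  also records that \<open>poly_ring J x\<close> is a subring.\<close>

lemma derivation_on_poly_ring: "derivation_on (poly_ring J x) (\<lambda>_. 0)"
proof -
  let ?ev = "\<lambda>qs. \<Sum>(q, \<alpha>)\<leftarrow>qs. of_rat q * mon J x \<alpha>"
  let ?ok = "\<lambda>qs. \<forall>(q, \<alpha>)\<in>set qs. \<forall>j. j \<notin> J \<longrightarrow> \<alpha> j = 0"
  have one: "1 \<in> poly_ring J x" using poly_ring_term[of J "\<lambda>_. 0" 1 x] by (simp add: mon_def)
  have add: "u + v \<in> poly_ring J x" if uv: "u \<in> poly_ring J x" "v \<in> poly_ring J x" for u v
  proof -
    obtain qs rs where "?ok qs" "?ok rs" "u = ?ev qs" "v = ?ev rs"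
      using uv unfolding poly_ring_def by blast
    then have "?ok (qs @ rs) \<and> u + v = ?ev (qs @ rs)" by auto
    then show ?thesis unfolding poly_ring_def by blast
  qed
  have mult1: "of_rat q * mon J x \<alpha> * v \<in> poly_ring J x"
    if v: "v \<in> poly_ring J x" and \<alpha>: "\<And>j. j \<notin> J \<Longrightarrow> \<alpha> j = 0" for q \<alpha> v
  proof -
    obtain rs where rs: "?ok rs" "v = ?ev rs" using v unfolding poly_ring_def by blast
    have "of_rat q * mon J x \<alpha> * ?ev rs \<in> poly_ring J x" using rs(1)
    proof (induction rs)
      case Nil
      have "0 \<in> poly_ring J x" using poly_ring_term[of J "\<lambda>_. 0" 0 x] by simp
      then show ?case by simp
    next
      case (Cons r rs)
      obtain q' \<beta> where r: "r = (q', \<beta>)" by (cases r)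
      have "of_rat (q * q') * mon J x (\<lambda>j. \<alpha> j + \<beta> j) \<in> poly_ring J x"
        using Cons.prems \<alpha> r by (intro poly_ring_term) auto
      moreover have "of_rat q * mon J x \<alpha> * ?ev rs \<in> poly_ring J x" using Cons by auto
      ultimately have "of_rat (q * q') * mon J x (\<lambda>j. \<alpha> j + \<beta> j) + of_rat q * mon J x \<alpha> * ?ev rs \<in> poly_ring J x"
        by (rule add)
      then show ?case by (simp add: r mon_add of_rat_mult algebra_simps)
    qed
    then show ?thesis using rs by simp
  qed
  have mult: "u * v \<in> poly_ring J x" if uv: "u \<in> poly_ring J x" "v \<in> poly_ring J x" for u v
  proof -
    obtain qs where qs: "?ok qs" "u = ?ev qs" using uv(1) unfolding poly_ring_def by blast
    have "?ev qs * v \<in> poly_ring J x" using qs(1)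
    proof (induction qs)
      case Nil
      have "0 \<in> poly_ring J x" using poly_ring_term[of J "\<lambda>_. 0" 0 x] by simp
      then show ?case by simp
    next
      case (Cons r rs)
      obtain q' \<beta> where r: "r = (q', \<beta>)" by (cases r)
      have "of_rat q' * mon J x \<beta> * v \<in> poly_ring J x"
        using Cons.prems uv(2) r by (intro mult1) auto
      moreover have "?ev rs * v \<in> poly_ring J x" using Cons by auto
      ultimately have "of_rat q' * mon J x \<beta> * v + ?ev rs * v \<in> poly_ring J x" by (rule add)
      then show ?case by (simp add: r algebra_simps)
    qed
    then show ?thesis using qs by simp
  qed
  have "- 1 \<in> poly_ring J x" using poly_ring_term[of J "\<lambda>_. 0" "-1" x] by (simp add: mon_def of_rat_minus)
  then have "- u \<in> poly_ring J x" if "u \<in> poly_ring J x" for u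
    using mult[of "-1" u] that by simp
  then show ?thesis using one add mult by (simp add: derivation_on_def)
qed

lemma poly_ring_gen:
  assumes "finite J" "j \<in> J"
  shows "x j \<in> poly_ring J x"
proof -
  have "mon J x (\<lambda>i. if i = j then 1 else 0) = (\<Prod>i\<in>J. if i = j then x i else 1)"
    unfolding mon_def by (rule prod.cong) auto
  also have "\<dots> = x j" using assms by simp
  finally have eq: "mon J x (\<lambda>i. if i = j then 1 else 0) = x j" .
  have "of_rat 1 * mon J x (\<lambda>i. if i = j then 1 else 0) \<in> poly_ring J x"
    by (rule poly_ring_term) (use assms in auto)
  then show ?thesis by (simp add: eq)
qed

lemma poly_ring_as_sum:
  assumes "y \<in> poly_ring J x"
  shows "\<exists>M c. finite M \<and> (\<forall>\<alpha>\<in>M. \<forall>j. j \<notin> J \<longrightarrow> \<alpha> j = 0) \<and> y = (\<Sum>\<alpha>\<in>M. of_rat (c \<alpha>) * mon J x \<alpha>)"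
proof -
  obtain qs where qs: "\<forall>(q, \<alpha>)\<in>set qs. \<forall>j. j \<notin> J \<longrightarrow> \<alpha> j = 0" "y = (\<Sum>(q, \<alpha>)\<leftarrow>qs. of_rat q * mon J x \<alpha>)"
    using assms unfolding poly_ring_def by blast
  have "\<exists>M c. finite M \<and> (\<forall>\<alpha>\<in>M. \<forall>j. j \<notin> J \<longrightarrow> \<alpha> j = 0) \<and> (\<forall>\<alpha>. \<alpha> \<notin> M \<longrightarrow> c \<alpha> = 0) \<and>
      (\<Sum>(q, \<alpha>)\<leftarrow>qs. of_rat q * mon J x \<alpha>) = (\<Sum>\<alpha>\<in>M. of_rat (c \<alpha>) * mon J x \<alpha>)"
    using qs(1)
  proof (induction qs)
    case Nil
    show ?case by (intro exI[of _ "{}"] exI[of _ "\<lambda>_. 0"]) auto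
  next
    case (Cons r rs)
    obtain q \<beta> where r: "r = (q, \<beta>)" by (cases r)
    obtain M c where Mc: "finite M" "\<forall>\<alpha>\<in>M. \<forall>j. j \<notin> J \<longrightarrow> \<alpha> j = 0" "\<forall>\<alpha>. \<alpha> \<notin> M \<longrightarrow> c \<alpha> = 0"
      "(\<Sum>(q, \<alpha>)\<leftarrow>rs. of_rat q * mon J x \<alpha>) = (\<Sum>\<alpha>\<in>M. of_rat (c \<alpha>) * mon J x \<alpha>)"
      using Cons by auto
    have "(\<Sum>\<alpha>\<in>M. of_rat (c \<alpha>) * mon J x \<alpha>) = (\<Sum>\<alpha>\<in>insert \<beta> M. of_rat (c \<alpha>) * mon J x \<alpha>)"
      using Mc by (intro sum.mono_neutral_left) auto
    moreover have "of_rat q * mon J x \<beta> = (\<Sum>\<alpha>\<in>insert \<beta> M. if \<alpha> = \<beta> then of_rat q * mon J x \<beta> else 0)"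
      using Mc(1) by simp
    ultimately have "of_rat q * mon J x \<beta> + (\<Sum>\<alpha>\<in>M. of_rat (c \<alpha>) * mon J x \<alpha>)
        = (\<Sum>\<alpha>\<in>insert \<beta> M. (if \<alpha> = \<beta> then of_rat q * mon J x \<beta> else 0) + of_rat (c \<alpha>) * mon J x \<alpha>)"
      by (simp only: sum.distrib)
    also have "\<dots> = (\<Sum>\<alpha>\<in>insert \<beta> M. of_rat ((c(\<beta> := c \<beta> + q)) \<alpha>) * mon J x \<alpha>)"
      by (rule sum.cong) (auto simp: of_rat_add algebra_simps)
    finally show ?case
      using Mc Cons.prems r
      by (intro exI[of _ "insert \<beta> M"] exI[of _ "c(\<beta> := c \<beta> + q)"]) auto
  qed
  then show ?thesis using qs(2) by auto
qed

lemma alg_indep_cong: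
  assumes "\<And>j. j \<in> J \<Longrightarrow> x j = y j" "alg_indep_rat J x"
  shows "alg_indep_rat J y"
proof -
  have "(\<Prod>j\<in>J. y j ^ \<alpha> j) = (\<Prod>j\<in>J. x j ^ \<alpha> j)" for \<alpha> :: "'a \<Rightarrow> nat"
    using assms(1) by simp
  then show ?thesis using assms(2) by (simp add: alg_indep_rat_def)
qed

text \<open>A polynomial in \<open>x j\<close> over the ring of the other generators is a polynomial
  in all of them: the power \<open>i\<close> of \<open>x j\<close> is stored in slot
  \<open>j\<close> of the exponent vector, which is 0 in the coefficients.\<close>

lemma alg_indep_transcendental:
  assumes ai: "alg_indep_rat (insert j J) x" and J: "finite J" "j \<notin> J"
    and Q: "\<And>i. coeff Q i \<in> poly_ring J x" "poly Q (x j) = 0"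
  shows "Q = 0"
proof -
  have "\<exists>M c. finite M \<and> (\<forall>\<alpha>\<in>M. \<forall>j. j \<notin> J \<longrightarrow> \<alpha> j = 0) \<and>
      coeff Q i = (\<Sum>\<alpha>\<in>M. of_rat (c \<alpha>) * mon J x \<alpha>)" for i
    using poly_ring_as_sum[OF Q(1)] .
  then obtain M c where M: "\<And>i. finite (M i)" "\<And>i \<alpha> l. \<alpha> \<in> M i \<Longrightarrow> l \<notin> J \<Longrightarrow> \<alpha> l = 0"
    and c: "\<And>i. coeff Q i = (\<Sum>\<alpha>\<in>M i. of_rat (c i \<alpha>) * mon J x \<alpha>)" by metis
  define S where "S = Sigma {..Polynomial.degree Q} M"
  define h where "h = (\<lambda>(i, \<alpha>). \<alpha>(j := i :: nat))"
  define c' where "c' \<beta> = c (\<beta> j) (\<beta>(j := 0))" for \<beta>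
  have hS: "(h s)(j := 0) = snd s" "h s j = fst s" if "s \<in> S" for s
    using that M(2)[of "snd s" "fst s" j] J by (auto simp: S_def h_def fun_eq_iff)
  have inj: "inj_on h S" by (rule inj_onI) (metis hS prod_eqI)
  have "(\<Sum>\<beta>\<in>h ` S. of_rat (c' \<beta>) * (\<Prod>l\<in>insert j J. x l ^ \<beta> l))
      = (\<Sum>s\<in>S. of_rat (c (fst s) (snd s)) * mon J x (snd s) * x j ^ fst s)"
    unfolding sum.reindex[OF inj] comp_def
  proof (rule sum.cong[OF refl])
    fix s assume s: "s \<in> S"
    have "(\<Prod>l\<in>J. x l ^ h s l) = mon J x (snd s)"
      unfolding mon_def using J(2) by (intro prod.cong) (auto simp: h_def split: prod.splits)
    then show "of_rat (c' (h s)) * (\<Prod>l\<in>insert j J. x l ^ h s l)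
        = of_rat (c (fst s) (snd s)) * mon J x (snd s) * x j ^ fst s"
      using J hS[OF s] by (simp add: c'_def)
  qed
  also have "\<dots> = (\<Sum>i\<le>Polynomial.degree Q. \<Sum>\<alpha>\<in>M i. of_rat (c i \<alpha>) * mon J x \<alpha> * x j ^ i)"
    unfolding S_def by (subst sum.Sigma) (auto simp: M(1) intro!: sum.cong)
  also have "\<dots> = poly Q (x j)"
    by (simp add: poly_altdef c sum_distrib_right)
  finally have "(\<Sum>\<beta>\<in>h ` S. of_rat (c' \<beta>) * (\<Prod>l\<in>insert j J. x l ^ \<beta> l)) = 0" using Q(2) by simp
  moreover have "finite (h ` S)" by (simp add: S_def M(1))
  moreover have "\<forall>\<beta>\<in>h ` S. \<forall>l. l \<notin> insert j J \<longrightarrow> \<beta> l = 0"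
    using M(2) by (auto simp: S_def h_def)
  ultimately have 0: "\<forall>\<beta>\<in>h ` S. c' \<beta> = 0" using ai unfolding alg_indep_rat_def by blast
  have "coeff Q i = 0" for i
  proof (cases "i \<le> Polynomial.degree Q")
    case True
    have "c i \<alpha> = 0" if "\<alpha> \<in> M i" for \<alpha>
    proof -
      have s: "(i, \<alpha>) \<in> S" using that True by (simp add: S_def)
      then have "c' (h (i, \<alpha>)) = 0" using 0 by blast
      then show ?thesis using hS[OF s] by (simp add: c'_def)
    qed
    then show ?thesis by (simp add: c)
  qed (simp add: coeff_eq_0)
  then show ?thesis by (simp add: poly_eq_iff)
qed

text \<open>Since \<open>x j\<close> is transcendental over the ring of the other generators, the
  zero derivation of that ring extends with the value 1 at \<open>x j\<close>, and from there to all
  reals.\<close>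

theorem alg_indep_derivation:
  assumes "finite I" "alg_indep_rat I x" "j \<in> I"
  shows "\<exists>D. derivation D \<and> D (x j) = 1 \<and> (\<forall>i\<in>I - {j}. D (x i) = 0)"
proof -
  define J where "J = I - {j}"
  have J: "finite J" "j \<notin> J" "insert j J = I" using assms by (auto simp: J_def)
  have der: "derivation_on (poly_ring J x) (\<lambda>_. 0)" by (rule derivation_on_poly_ring)
  have "evd (\<lambda>_. 0) (x j) 1 Q = 0" if "Q \<in> polys (poly_ring J x)" "poly Q (x j) = 0" for Q
  proof -
    have "Q = 0" using alg_indep_transcendental[of j J x Q] that assms(2) J by (auto simp: polys_def[OF der])
    then show ?thesis by (simp add: evd_def[OF der] dpoly_def[OF der])
  qed
  from derivation_on_adjoin[OF der this]
  obtain A D where AD: "derivation_on A D" "poly_ring J x \<subseteq> A" "x j \<in> A"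
      "\<forall>a\<in>poly_ring J x. D a = 0" "D (x j) = 1" by blast
  obtain D' where "derivation D'" "\<forall>a\<in>A. D' a = D a" using derivation_extend[OF AD(1)] by blast
  moreover have "D (x i) = 0 \<and> x i \<in> A" if "i \<in> I - {j}" for i
    using poly_ring_gen[OF J(1), of i x] AD that unfolding J_def by blast
  ultimately have "derivation D'" "D' (x j) = 1" "\<forall>i\<in>I - {j}. D' (x i) = 0"
    using AD by simp_all
  then show ?thesis by blast
qed

section \<open>Existence of generic configurations\<close>

lemma countable_poly_ring:
  assumes "finite J"
  shows "countable (poly_ring J x)"
proof -
  define E where "E = {\<alpha> :: 'a \<Rightarrow> nat. \<forall>j. j \<notin> J \<longrightarrow> \<alpha> j = 0}"
  have "E \<subseteq> (\<lambda>\<beta> j. if j \<in> J then \<beta> j else 0) ` (PiE J (\<lambda>_. UNIV))"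
  proof
    fix \<alpha> assume "\<alpha> \<in> E"
    then have "\<alpha> = (\<lambda>j. if j \<in> J then restrict \<alpha> J j else 0)" by (auto simp: E_def fun_eq_iff)
    then show "\<alpha> \<in> (\<lambda>\<beta> j. if j \<in> J then \<beta> j else 0) ` (PiE J (\<lambda>_. UNIV))"
      by (rule image_eqI[of _ _ "restrict \<alpha> J"]) auto
  qed
  moreover have "countable (PiE J (\<lambda>_. UNIV :: nat set))" using assms by (intro countable_PiE) auto
  ultimately have "countable E" by (rule countable_subset[OF _ countable_image])
  then have "countable (lists ((UNIV :: rat set) \<times> E))" by (intro countable_lists countable_SIGMA) auto
  moreover have "poly_ring J x \<subseteq> (\<lambda>qs. \<Sum>(q, \<alpha>)\<leftarrow>qs. of_rat q * mon J x \<alpha>) ` lists (UNIV \<times> E)"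
  proof
    fix y assume "y \<in> poly_ring J x"
    then obtain qs where qs: "\<forall>(q, \<alpha>)\<in>set qs. \<forall>j. j \<notin> J \<longrightarrow> \<alpha> j = 0"
        "y = (\<Sum>(q, \<alpha>)\<leftarrow>qs. of_rat q * mon J x \<alpha>)"
      unfolding poly_ring_def by blast
    then have "qs \<in> lists (UNIV \<times> E)" by (auto simp: E_def lists_eq_set)
    then show "y \<in> (\<lambda>qs. \<Sum>(q, \<alpha>)\<leftarrow>qs. of_rat q * mon J x \<alpha>) ` lists (UNIV \<times> E)"
      using qs(2) by (rule rev_image_eqI)
  qed
  ultimately show ?thesis using countable_subset[OF _ countable_image] by metis
qed

text \<open>There are only countably many polynomials over the countable ring generated by
  \<open>x\<close>, and each nonzero one has finitely many roots; as the reals are uncountable, some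
  \<open>t\<close> is a root of none of them.\<close>

lemma alg_indep_extend:
  assumes ai: "alg_indep_rat J x" and J: "finite J" "j \<notin> J"
  shows "\<exists>t. alg_indep_rat (insert j J) (x(j := t))"
proof -
  define A where "A = poly_ring J x"
  have der: "derivation_on A (\<lambda>_. 0)" unfolding A_def by (rule derivation_on_poly_ring)
  define PA where "PA = {Q :: real poly. \<forall>i. coeff Q i \<in> A}"
  have "PA \<subseteq> Poly ` lists A"
  proof
    fix Q assume "Q \<in> PA"
    then have "set (coeffs Q) \<subseteq> A" by (auto simp: PA_def coeffs_def)
    then show "Q \<in> Poly ` lists A" by (metis Poly_coeffs imageI in_listsI subsetD)
  qed
  then have cPA: "countable PA"
    using countable_subset[OF _ countable_image[OF countable_lists[OF countable_poly_ring[OF J(1), of x]]]]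
    unfolding A_def by metis
  have "countable (\<Union>Q\<in>PA - {0}. {t. poly Q t = 0})"
    using cPA by (intro countable_UN) (auto intro!: countable_finite poly_roots_finite)
  then have "(\<Union>Q\<in>PA - {0}. {t. poly Q t = 0}) \<noteq> UNIV" using uncountable_UNIV_real by metis
  then obtain t where t: "\<And>Q. Q \<in> PA \<Longrightarrow> poly Q t = 0 \<Longrightarrow> Q = 0" by blast
  have "alg_indep_rat (insert j J) (x(j := t))" unfolding alg_indep_rat_def
  proof (intro allI impI, elim conjE)
    fix M :: "('a \<Rightarrow> nat) set" and c :: "('a \<Rightarrow> nat) \<Rightarrow> rat"
    assume M: "finite M" "\<forall>\<alpha>\<in>M. \<forall>l. l \<notin> insert j J \<longrightarrow> \<alpha> l = 0"
      and 0: "(\<Sum>\<alpha>\<in>M. of_rat (c \<alpha>) * (\<Prod>l\<in>insert j J. (x(j := t)) l ^ \<alpha> l)) = 0"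
    define Q where "Q = (\<Sum>\<alpha>\<in>M. monom (of_rat (c \<alpha>) * mon J x (\<alpha>(j := 0))) (\<alpha> j))"
    have mon: "mon J x (\<alpha>(j := 0)) = (\<Prod>l\<in>J. (x(j := t)) l ^ \<alpha> l)" for \<alpha>
      unfolding mon_def using J(2) by (intro prod.cong) auto
    have "poly Q t = 0"
      using 0 J by (simp add: Q_def poly_sum poly_monom mon algebra_simps)
    moreover have coef: "coeff Q i = (\<Sum>\<alpha>\<in>{\<alpha>\<in>M. \<alpha> j = i}. of_rat (c \<alpha>) * mon J x (\<alpha>(j := 0)))" for i
      unfolding Q_def coeff_sum by (simp add: sum.If_cases[OF M(1)] coeff_monom Int_def)
    moreover have "coeff Q i \<in> A" for i
      unfolding coef A_def
      by (rule derivation_on_sum[OF derivation_on_poly_ring, THEN conjunct1])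
         (use M(2) in \<open>auto intro!: poly_ring_term\<close>)
    ultimately have Q0: "Q = 0" using t by (auto simp: PA_def)
    show "\<forall>\<alpha>\<in>M. c \<alpha> = 0"
    proof
      fix \<alpha> assume \<alpha>: "\<alpha> \<in> M"
      define i where "i = \<alpha> j"
      define N where "N = (\<lambda>\<beta>. \<beta>(j := 0)) ` {\<beta>\<in>M. \<beta> j = i}"
      define c' where "c' \<beta> = c (\<beta>(j := i))" for \<beta>
      have inj: "inj_on (\<lambda>\<beta>. \<beta>(j := 0)) {\<beta>\<in>M. \<beta> j = i}"
        by (rule inj_onI) (metis (mono_tags, lifting) fun_upd_triv fun_upd_upd mem_Collect_eq)
      have "(\<Sum>\<beta>\<in>N. of_rat (c' \<beta>) * (\<Prod>l\<in>J. x l ^ \<beta> l)) = coeff Q i"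
        unfolding N_def sum.reindex[OF inj] coef comp_def c'_def mon_def by (rule sum.cong) auto
      moreover have "finite N" using M(1) by (simp add: N_def)
      moreover have "\<forall>\<beta>\<in>N. \<forall>l. l \<notin> J \<longrightarrow> \<beta> l = 0" using M(2) by (auto simp: N_def)
      ultimately have "\<forall>\<beta>\<in>N. c' \<beta> = 0"
        using ai[unfolded alg_indep_rat_def, THEN spec, of N, THEN spec, of c', THEN mp] Q0 by simp
      moreover have "\<alpha>(j := 0) \<in> N" using \<alpha> by (auto simp: N_def i_def)
      ultimately have "c' (\<alpha>(j := 0)) = 0" by blast
      then show "c \<alpha> = 0" by (simp add: c'_def i_def)
    qed
  qed
  then show ?thesis by blast
qed

lemma alg_indep_exists: "finite J \<Longrightarrow> \<exists>x. alg_indep_rat J x"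
proof (induction J rule: finite_induct)
  case empty
  have "alg_indep_rat ({} :: 'a set) (\<lambda>_. 0 :: real)" unfolding alg_indep_rat_def
  proof (intro allI impI, elim conjE)
    fix M :: "('a \<Rightarrow> nat) set" and c :: "('a \<Rightarrow> nat) \<Rightarrow> rat"
    assume "\<forall>\<alpha>\<in>M. \<forall>j. j \<notin> {} \<longrightarrow> \<alpha> j = 0" "(\<Sum>\<alpha>\<in>M. of_rat (c \<alpha>) * (\<Prod>j\<in>{}. (0::real) ^ \<alpha> j)) = 0"
    moreover from this(1) have "M \<subseteq> {\<lambda>_. 0}" by (auto simp: fun_eq_iff)
    then have "M = {} \<or> M = {\<lambda>_. 0}" by blast
    ultimately show "\<forall>\<alpha>\<in>M. c \<alpha> = 0" by auto
  qed
  then show ?case by blast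
next
  case (insert j J)
  then obtain x where "alg_indep_rat J x" by blast
  from alg_indep_extend[OF this insert.hyps(1,2)] show ?case by blast
qed

lemma generic_exists: "\<exists>p. generic n d p"
proof -
  obtain x where x: "alg_indep_rat ({0..<n} \<times> {0..<d}) (x :: nat \<times> nat \<Rightarrow> real)"
    using alg_indep_exists[of "{0..<n} \<times> {0..<d}"] by auto
  have "generic n d (\<lambda>v i. x (v, i))" unfolding generic_def
    by (rule alg_indep_cong[OF _ x]) auto
  then show ?thesis by blast
qed

lemma generic_derivation:
  assumes "generic n d p" "v < n" "i < d"
  shows "\<exists>D. derivation D \<and> (\<forall>w<n. \<forall>j<d. D (p w j) = (if w = v \<and> j = i then 1 else 0))"
proof -
  have "\<exists>D. derivation D \<and> D (case (v, i) of (v, i) \<Rightarrow> p v i) = 1 \<and>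
      (\<forall>s\<in>{0..<n} \<times> {0..<d} - {(v, i)}. D (case s of (v, i) \<Rightarrow> p v i) = 0)"
    using assms by (intro alg_indep_derivation) (auto simp: generic_def)
  then obtain D where D: "derivation D" "D (p v i) = 1"
      "\<forall>s\<in>{0..<n} \<times> {0..<d} - {(v, i)}. D (case s of (v, i) \<Rightarrow> p v i) = 0" by auto
  have "D (p w j) = 0" if "w < n" "j < d" "(w, j) \<noteq> (v, i)" for w j
    using D(3)[rule_format, of "(w, j)"] that by auto
  then show ?thesis using D(1,2) by (intro exI[of _ D]) auto
qed

section \<open>Linear algebra of finitely indexed real vectors\<close>

instantiation "fun" :: (type, real_vector) real_vector
begin

definition scaleR_fun_def: "r *\<^sub>R h = (\<lambda>x. r *\<^sub>R h x)"

instance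
  by standard (simp_all add: scaleR_fun_def fun_eq_iff algebra_simps)

end

lemma scaleR_fun_apply [simp]: "(r *\<^sub>R h) x = r *\<^sub>R h x"
  by (simp add: scaleR_fun_def)

lemma sum_fun_apply [simp]: "(\<Sum>i\<in>I. F i) x = (\<Sum>i\<in>I. F i x)"
  by (induction I rule: infinite_finite_induct) auto

section \<open>Functions supported on a set and their inner product\<close>

definition unitf :: "'a \<Rightarrow> 'a \<Rightarrow> real" where
  "unitf a = (\<lambda>x. if x = a then 1 else 0)"

definition supp_in :: "'a set \<Rightarrow> ('a \<Rightarrow> real) set" where
  "supp_in A = {h. \<forall>x. x \<notin> A \<longrightarrow> h x = 0}"

definition ip :: "'a set \<Rightarrow> ('a \<Rightarrow> real) \<Rightarrow> ('a \<Rightarrow> real) \<Rightarrow> real" where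
  "ip A u w = (\<Sum>a\<in>A. u a * w a)"

lemma ip_commute: "ip A u w = ip A w u"
  by (simp add: ip_def mult.commute)

lemma ip_add_right: "ip A u (w + w') = ip A u w + ip A u w'"
  by (simp add: ip_def algebra_simps sum.distrib)

lemma ip_diff_right: "ip A u (w - w') = ip A u w - ip A u w'"
  by (simp add: ip_def algebra_simps sum_subtractf)

lemma ip_scale_right: "ip A u (r *\<^sub>R w) = r * ip A u w"
  by (simp add: ip_def algebra_simps sum_distrib_left)

lemma ip_add_left: "ip A (w + w') u = ip A w u + ip A w' u"
  by (simp add: ip_def algebra_simps sum.distrib)

lemma ip_diff_left: "ip A (w - w') u = ip A w u - ip A w' u"
  by (simp add: ip_def algebra_simps sum_subtractf)

lemma ip_scale_left: "ip A (r *\<^sub>R w) u = r * ip A w u"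
  by (simp add: ip_def algebra_simps sum_distrib_left)

lemma ip_zero [simp]: "ip A 0 u = 0" "ip A u 0 = 0"
  by (simp_all add: ip_def)

lemma ip_zero_fun [simp]: "ip A (\<lambda>a. 0) u = 0" "ip A u (\<lambda>a. 0) = 0"
  by (simp_all add: ip_def)

lemma ip_self_eq_0: "finite A \<Longrightarrow> ip A u u = 0 \<longleftrightarrow> (\<forall>a\<in>A. u a = 0)"
  by (simp add: ip_def sum_nonneg_eq_0_iff)

lemma ip_self_zero_left: "finite A \<Longrightarrow> ip A u u = 0 \<Longrightarrow> ip A u w = 0"
  by (simp add: ip_self_eq_0) (simp add: ip_def)

lemma ip_self_nonneg: "0 \<le> ip A u u"
  by (simp add: ip_def sum_nonneg)

lemma subspace_ip_zero: "subspace {w. ip A u w = 0}"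
  by (simp add: subspace_def ip_add_right ip_scale_right)

lemma ip_zero_span: "(\<And>s. s \<in> S \<Longrightarrow> ip A u s = 0) \<Longrightarrow> s \<in> span S \<Longrightarrow> ip A u s = 0"
  using span_minimal[OF _ subspace_ip_zero, of S A u] by blast

lemma ip_zero_span_left: "(\<And>s. s \<in> S \<Longrightarrow> ip A s u = 0) \<Longrightarrow> s \<in> span S \<Longrightarrow> ip A s u = 0"
  using ip_zero_span[of S A u s] by (simp add: ip_commute)

lemma subspace_supp_in: "subspace (supp_in A)"
  by (simp add: subspace_def supp_in_def)

lemma unitf_supp_in: "a \<in> A \<Longrightarrow> unitf a \<in> supp_in A"
  by (auto simp: unitf_def supp_in_def)

lemma sum_unitf:
  assumes "finite A" "h \<in> supp_in A"
  shows "h = (\<Sum>a\<in>A. h a *\<^sub>R unitf a)"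
proof
  fix x
  have "(\<Sum>a\<in>A. h a *\<^sub>R unitf a) x = (\<Sum>a\<in>A. if a = x then h a else 0)"
    by (simp add: unitf_def) (rule sum.cong, auto)
  then show "h x = (\<Sum>a\<in>A. h a *\<^sub>R unitf a) x"
    using assms by (auto simp: supp_in_def)
qed

lemma ip_unitf: "finite A \<Longrightarrow> a \<in> A \<Longrightarrow> ip A (unitf a) w = w a"
proof -
  assume A: "finite A" "a \<in> A"
  have "ip A (unitf a) w = (\<Sum>x\<in>A. if x = a then w x else 0)"
    unfolding ip_def unitf_def by (rule sum.cong) auto
  then show ?thesis using A by simp
qed

lemma span_unitf: "finite A \<Longrightarrow> span (unitf ` A) = supp_in A"
proof
  assume A: "finite A"
  show "span (unitf ` A) \<subseteq> supp_in A"
    by (rule span_minimal[OF _ subspace_supp_in]) (auto intro: unitf_supp_in)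
  show "supp_in A \<subseteq> span (unitf ` A)"
  proof
    fix h assume "h \<in> supp_in A"
    then have "h = (\<Sum>a\<in>A. h a *\<^sub>R unitf a)" using A sum_unitf by blast
    also have "\<dots> \<in> span (unitf ` A)"
      by (intro span_sum span_scale span_base) auto
    finally show "h \<in> span (unitf ` A)" .
  qed
qed

lemma inj_unitf: "inj unitf"
  by (rule injI) (auto simp: unitf_def fun_eq_iff split: if_splits)

lemma ip_unitf_zero: "b \<notin> S \<Longrightarrow> u \<in> span (unitf ` S) \<Longrightarrow> u b = 0"
proof -
  assume b: "b \<notin> S" and u: "u \<in> span (unitf ` S)"
  have "subspace {u. (u::'a \<Rightarrow> real) b = 0}" by (simp add: subspace_def)
  moreover have "unitf ` S \<subseteq> {u. u b = 0}" using b by (auto simp: unitf_def)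
  ultimately have "span (unitf ` S) \<subseteq> {u. u b = 0}" by (rule span_minimal[rotated])
  then show ?thesis using u by blast
qed

lemma independent_unitf: "independent (unitf ` A)"
  unfolding dependent_def
proof clarify
  fix a assume "a \<in> A" and s: "unitf a \<in> span (unitf ` A - {unitf a})"
  have "unitf ` A - {unitf a} = unitf ` (A - {a})" using inj_unitf by (auto simp: inj_def)
  then have "unitf a a = 0" using s ip_unitf_zero[of a "A - {a}"] by auto
  then show False by (simp add: unitf_def)
qed

lemma dim_supp_in: "finite A \<Longrightarrow> dim (supp_in A) = card A"
  using dim_span_eq_card_independent[OF independent_unitf, of A] inj_unitf
  by (simp add: span_unitf card_image inj_on_subset[OF inj_unitf])

text \<open>The function spaces used here are infinite-dimensional, so the dimension lemmas carry a
  finite set \<open>B\<close> spanning the part in question; this is what lets \<open>dim\<close>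
  control cardinalities.\<close>

lemma independent_card_le_dim:
  fixes C :: "'b::real_vector set"
  assumes "independent C" "C \<subseteq> span V" "V \<subseteq> span B" "finite B"
  shows "finite C" "card C \<le> dim V"
proof -
  obtain W where W: "W \<subseteq> V" "independent W" "V \<subseteq> span W" "card W = dim V"
    using basis_exists[of V] by metis
  have "W \<subseteq> span B" using W assms by blast
  then have fW: "finite W" using independent_span_bound[OF assms(4) W(2)] by auto
  have "span V \<subseteq> span W" using W(3) by (simp add: span_minimal)
  then have "finite C \<and> card C \<le> card W"
    using independent_span_bound[OF fW assms(1)] assms(2) by auto
  then show "finite C" "card C \<le> dim V" using W(4) by auto
qed

lemma dim_mono_fin:
  fixes V W :: "'b::real_vector set"
  assumes "V \<subseteq> span W" "W \<subseteq> span B" "finite B"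
  shows "dim V \<le> dim W"
proof -
  obtain C where C: "C \<subseteq> V" "independent C" "V \<subseteq> span C" "card C = dim V"
    using basis_exists[of V] by metis
  show ?thesis using independent_card_le_dim(2)[OF C(2) _ assms(2,3)] C assms(1) by auto
qed

lemma dim_eq_imp_span:
  fixes V W :: "'b::real_vector set"
  assumes "V \<subseteq> span W" "W \<subseteq> span B" "finite B" "dim W \<le> dim V"
  shows "W \<subseteq> span V"
proof (rule ccontr)
  assume "\<not> W \<subseteq> span V"
  then obtain w where w: "w \<in> W" "w \<notin> span V" by blast
  obtain C where C: "C \<subseteq> V" "independent C" "V \<subseteq> span C" "card C = dim V"
    using basis_exists[of V] by metis
  have wC: "w \<notin> span C" using w C(1) span_mono by blast
  have ind: "independent (insert w C)" using wC C(2) by (rule independent_insertI)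
  have "insert w C \<subseteq> span W" using w C(1) assms(1) by (auto intro: span_base)
  then have *: "finite (insert w C)" "card (insert w C) \<le> dim W"
    using independent_card_le_dim[OF ind _ assms(2,3)] by auto
  have "w \<notin> C" using wC span_base by blast
  then have "card (insert w C) = Suc (card C)" using * by simp
  then show False using * C(4) assms(4) by simp
qed

text \<open>A basis of \<open>C\<close> is extended separately to bases of \<open>A\<close> and of
  \<open>B\<close>; together these span \<open>A \<union> B\<close>, and they share at least the
  basis of \<open>C\<close>.\<close>

lemma dim_submodular:
  fixes A B :: "'b::real_vector set"
  assumes "finite A" "finite B" "C \<subseteq> A" "C \<subseteq> B"
  shows "dim (A \<union> B) + dim C \<le> dim A + dim B"
proof -
  obtain K where K: "K \<subseteq> C" "independent K" "C \<subseteq> span K" "card K = dim C"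
    using basis_exists[of C] by metis
  obtain KA where KA: "K \<subseteq> KA" "KA \<subseteq> A" "independent KA" "A \<subseteq> span KA"
    using maximal_independent_subset_extend[of K A] K assms by (metis subset_trans)
  obtain KB where KB: "K \<subseteq> KB" "KB \<subseteq> B" "independent KB" "B \<subseteq> span KB"
    using maximal_independent_subset_extend[of K B] K assms by (metis subset_trans)
  have fin: "finite KA" "finite KB" using KA KB assms finite_subset by blast+
  have "A \<union> B \<subseteq> span (KA \<union> KB)"
    using KA(4) KB(4) span_mono[of KA "KA \<union> KB"] span_mono[of KB "KA \<union> KB"] by blast
  then have "dim (A \<union> B) \<le> card (KA \<union> KB)" using fin by (simp add: dim_le_card)
  moreover have "card (KA \<union> KB) + card (KA \<inter> KB) = card KA + card KB"
    using card_Un_Int[OF fin] by simp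
  moreover have "card K \<le> card (KA \<inter> KB)" using KA KB fin by (intro card_mono) auto
  moreover have "card KA = dim A" "card KB = dim B"
    using dim_unique[OF KA(2,4,3) refl] dim_unique[OF KB(2,4,3) refl] by simp_all
  ultimately show ?thesis using K(4) by simp
qed

text \<open>Gram-Schmidt by induction on \<open>T\<close>. The form is only semidefinite on
  functions not supported in \<open>A\<close>, so the new direction may have norm 0; the quotient
  \<open>r\<close> is then 0, which is correct since such a vector is orthogonal to
  everything.\<close>

lemma orthogonal_projection:
  assumes "finite A" "finite T"
  shows "\<exists>t \<in> span T. \<forall>s\<in>span T. ip A s (h - t) = 0"
  using assms(2)
proof (induction T arbitrary: h rule: finite_induct)
  case empty
  show ?case by (intro bexI[of _ 0]) auto
next
  case (insert s T)
  obtain t0 where t0: "t0 \<in> span T" "\<And>u. u \<in> span T \<Longrightarrow> ip A u (s - t0) = 0"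
    using insert.IH by blast
  obtain t1 where t1: "t1 \<in> span T" "\<And>u. u \<in> span T \<Longrightarrow> ip A u (h - t1) = 0"
    using insert.IH by blast
  define s' where "s' = s - t0"
  define r where "r = ip A s' (h - t1) / ip A s' s'"
  define t where "t = t1 + r *\<^sub>R s'"
  have sp: "span T \<subseteq> span (insert s T)" by (rule span_mono) auto
  have s'in: "s' \<in> span (insert s T)" unfolding s'_def
    using t0(1) sp by (intro span_diff) (auto intro: span_base)
  have "t \<in> span (insert s T)" unfolding t_def
    using t1(1) sp s'in by (intro span_add span_scale) auto
  moreover have orth: "ip A u (h - t) = 0" if "u \<in> span T" for u
  proof -
    have "h - t = (h - t1) - r *\<^sub>R s'" by (simp add: t_def)
    then have "ip A u (h - t) = ip A u (h - t1) - r * ip A u s'"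
      by (simp only: ip_diff_right[of A u "h - t1"] ip_scale_right)
    then show ?thesis using that t0(2) t1(2) s'_def by simp
  qed
  moreover have orth': "ip A s' (h - t) = 0"
  proof -
    have "h - t = (h - t1) - r *\<^sub>R s'" by (simp add: t_def)
    then have "ip A s' (h - t) = ip A s' (h - t1) - r * ip A s' s'"
      by (simp only: ip_diff_right[of A s' "h - t1"] ip_scale_right)
    then show ?thesis
      using ip_self_zero_left[OF assms(1), of s' "h - t1"] by (cases "ip A s' s' = 0") (auto simp: r_def)
  qed
  moreover have "ip A s (h - t) = 0"
  proof -
    have "s = s' + t0" by (simp add: s'_def)
    then have "ip A s (h - t) = ip A s' (h - t) + ip A t0 (h - t)"
      by (simp only: ip_add_left)
    then show ?thesis using orth' orth[OF t0(1)] by simp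
  qed
  ultimately show ?case
    using ip_zero_span_left[of "insert s T" A "h - t"] span_base[of _ T] by blast
qed

definition annih :: "'a set \<Rightarrow> ('a \<Rightarrow> real) set \<Rightarrow> ('a \<Rightarrow> real) set" where
  "annih A T = {c \<in> supp_in A. \<forall>t\<in>T. ip A t c = 0}"

text \<open>Orthogonal projection splits each vector supported on \<open>A\<close> into one in the
  span of \<open>T\<close> and one in the annihilator, so bases of the two together span.\<close>

lemma annih_dim_ge:
  assumes "finite A" "T \<subseteq> supp_in A"
  shows "card A \<le> dim (annih A T) + dim T"
proof -
  obtain K where K: "K \<subseteq> T" "independent K" "T \<subseteq> span K" "card K = dim T"
    using basis_exists[of T] by metis
  have "K \<subseteq> span (unitf ` A)" using K assms span_unitf by blast
  then have fK: "finite K" using independent_span_bound[OF _ K(2), of "unitf ` A"] assms(1) by auto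
  obtain L where L: "L \<subseteq> annih A T" "independent L" "annih A T \<subseteq> span L" "card L = dim (annih A T)"
    using basis_exists[of "annih A T"] by metis
  have "L \<subseteq> span (unitf ` A)" using L(1) by (auto simp: annih_def span_unitf[OF assms(1)])
  then have fL: "finite L" using independent_span_bound[OF _ L(2), of "unitf ` A"] assms(1) by auto
  have "supp_in A \<subseteq> span (K \<union> L)"
  proof
    fix h assume h: "h \<in> supp_in A"
    obtain t where t: "t \<in> span K" "\<And>s. s \<in> span K \<Longrightarrow> ip A s (h - t) = 0"
      using orthogonal_projection[OF assms(1) fK, of h] by blast
    have "t \<in> supp_in A" using t(1) span_minimal[OF _ subspace_supp_in] K(1) assms(2) by blast
    then have "h - t \<in> annih A T"
      using h t(2) K(3) subspace_diff[OF subspace_supp_in] by (auto simp: annih_def)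
    then have "h - t \<in> span (K \<union> L)" using L(3) span_mono[of L "K \<union> L"] by blast
    moreover have "t \<in> span (K \<union> L)" using t(1) span_mono[of K "K \<union> L"] by blast
    ultimately have "(h - t) + t \<in> span (K \<union> L)" by (rule span_add)
    then show "h \<in> span (K \<union> L)" by simp
  qed
  then have "dim (supp_in A) \<le> card (K \<union> L)" using fK fL by (simp add: dim_le_card)
  also have "\<dots> \<le> card K + card L" by (rule card_Un_le)
  finally show ?thesis using K L assms by (simp add: dim_supp_in)
qed

lemma annih_nonzero:
  assumes "finite A" "finite T" "card T < card A"
  obtains c where "c \<in> supp_in A" "c \<noteq> 0" "\<And>t. t \<in> T \<Longrightarrow> ip A t c = 0"
proof -
  define T' where "T' = (\<lambda>t x. if x \<in> A then t x else 0) ` T"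
  have sub: "T' \<subseteq> supp_in A" by (auto simp: T'_def supp_in_def)
  have "dim T' \<le> card T'" using assms by (simp add: T'_def dim_le_card span_superset)
  also have "\<dots> \<le> card T" unfolding T'_def using assms by (simp add: card_image_le)
  finally have "dim (annih A T') \<noteq> 0" using annih_dim_ge[OF assms(1) sub] assms(3) by simp
  then have "\<not> annih A T' \<subseteq> {0}"
    using dim_le_card[of "annih A T'" "{}"] by auto
  then obtain c where c: "c \<in> annih A T'" "c \<noteq> 0" by blast
  have "ip A t c = 0" if "t \<in> T" for t
  proof -
    have "ip A t c = ip A (\<lambda>x. if x \<in> A then t x else 0) c" unfolding ip_def by (rule sum.cong) auto
    also have "\<dots> = 0" using c(1) that unfolding annih_def T'_def by blast
    finally show ?thesis .
  qed
  then show ?thesis using that c unfolding annih_def by blast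
qed

text \<open>Steinitz exchange: \<open>W\<close> is completed to a basis by unit vectors, whose
  indices form \<open>J\<close>. Read as equations, the rows in \<open>W\<close> leave
  \<open>card A - card W\<close> free variables, and these can be chosen among the coordinates.
  Later they become the reals that a derivation must still kill.\<close>

lemma complete_by_coordinates:
  assumes "finite A" "independent W" "W \<subseteq> supp_in A"
  shows "\<exists>J\<subseteq>A. card J + card W = card A \<and>
           (\<forall>c. (\<forall>w\<in>W. ip A w c = 0) \<longrightarrow> (\<forall>j\<in>J. c j = 0) \<longrightarrow> (\<forall>a\<in>A. c a = 0))"
proof -
  obtain K where K: "W \<subseteq> K" "K \<subseteq> W \<union> unitf ` A" "independent K" "W \<union> unitf ` A \<subseteq> span K"
    by (rule maximal_independent_subset_extend[OF Un_upper1 assms(2), of "unitf ` A"])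
  have "unitf ` A \<subseteq> supp_in A" by (auto intro: unitf_supp_in)
  then have "K \<subseteq> span (unitf ` A)"
    using subset_trans[OF K(2) Un_least[OF assms(3)]] by (simp add: span_unitf[OF assms(1)])
  then have fK: "finite K" using independent_span_bound[OF _ K(3), of "unitf ` A"] assms(1) by auto
  have "supp_in A \<subseteq> span K" using K(4) span_unitf[OF assms(1)] by (metis Un_subset_iff span_minimal subspace_span)
  moreover have "K \<subseteq> supp_in A" using \<open>K \<subseteq> span (unitf ` A)\<close> by (simp add: span_unitf[OF assms(1)])
  ultimately have cK: "card K = card A"
    using dim_unique[OF _ _ K(3)] dim_supp_in[OF assms(1)] by metis
  define J where "J = {a\<in>A. unitf a \<in> K - W}"
  have "K - W = unitf ` J" using K(2) by (auto simp: J_def)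
  then have "card (K - W) = card J" by (simp add: card_image inj_on_subset[OF inj_unitf])
  moreover have "card K = card (K - W) + card W"
    using card_Diff_subset[OF finite_subset[OF K(1) fK] K(1)] card_mono[OF fK K(1)] by simp
  ultimately have "card J + card W = card A" using cK by simp
  moreover have "c a = 0" if c: "\<forall>w\<in>W. ip A w c = 0" "\<forall>j\<in>J. c j = 0" and a: "a \<in> A" for c a
  proof -
    have JA: "J \<subseteq> A" by (auto simp: J_def)
    have "ip A s c = 0" if sK: "s \<in> K" for s
    proof (cases "s \<in> W")
      case False
      then obtain j where "j \<in> J" "s = unitf j"
        using sK \<open>K - W = unitf ` J\<close> by (metis DiffI imageE)
      then show ?thesis using c(2) ip_unitf[OF assms(1)] JA by auto
    qed (use c in auto)
    then have "ip A (unitf a) c = 0" using ip_zero_span_left[of K A c "unitf a"] K(4) a by blast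
    then show ?thesis using ip_unitf[OF assms(1) a] by simp
  qed
  ultimately show ?thesis by (intro exI[of _ J]) (auto simp: J_def)
qed

section \<open>Points in generic position\<close>

lemma derivation_combination:
  assumes "\<And>a. a \<in> A \<Longrightarrow> derivation (D a)"
  shows "derivation (\<lambda>x. \<Sum>a\<in>A. c a * D a x)"
  using assms
  by (auto simp: derivation_on_def sum.distrib sum_distrib_left algebra_simps intro!: sum.cong)

text \<open>The second part is the source of all lower bounds: the derivations dual to the
  \<open>n * d\<close> coordinates are independent, and fewer than \<open>n * d\<close> linear
  conditions \<open>D y = 0\<close> would leave a nonzero combination of them, which moves some
  coordinate.\<close>

lemma generic_derivation_vector:
  assumes "generic n d p"
  shows "\<exists>D. derivation D \<and> (\<forall>v<n. \<forall>i<d. D (p v i) = c (v, i))"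
    and "\<lbrakk>finite Y; \<And>D. derivation D \<Longrightarrow> \<forall>y\<in>Y. D y = 0 \<Longrightarrow> \<forall>v<n. \<forall>i<d. D (p v i) = 0\<rbrakk> \<Longrightarrow> n * d \<le> card Y"
proof -
  define A where "A = {0..<n} \<times> {0..<d}"
  have "\<forall>a\<in>A. \<exists>D. derivation D \<and> (\<forall>w<n. \<forall>j<d. D (p w j) = (if (w, j) = a then 1 else 0))"
    using generic_derivation[OF assms] by (force simp: A_def)
  then obtain D where D: "\<And>a. a \<in> A \<Longrightarrow> derivation (D a)"
    and Dp: "\<And>a w j. a \<in> A \<Longrightarrow> w < n \<Longrightarrow> j < d \<Longrightarrow> D a (p w j) = (if (w, j) = a then 1 else 0)"
    by metis
  have comb: "(\<Sum>a\<in>A. c a * D a (p v i)) = c (v, i)" if "v < n" "i < d" for c v i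
  proof -
    have "(\<Sum>a\<in>A. c a * D a (p v i)) = (\<Sum>a\<in>A. if a = (v, i) then c a else 0)"
      using Dp that by (intro sum.cong) auto
    also have "\<dots> = c (v, i)" using that by (simp add: A_def)
    finally show ?thesis .
  qed
  show "\<exists>D. derivation D \<and> (\<forall>v<n. \<forall>i<d. D (p v i) = c (v, i))"
    using derivation_combination[of A D c] D comb by blast
  assume Y: "finite Y" "\<And>D. derivation D \<Longrightarrow> \<forall>y\<in>Y. D y = 0 \<Longrightarrow> \<forall>v<n. \<forall>i<d. D (p v i) = 0"
  show "n * d \<le> card Y"
  proof (rule ccontr)
    assume "\<not> n * d \<le> card Y"
    then have "card ((\<lambda>y a. D a y) ` Y) < card A"
      using card_image_le[OF Y(1), of "\<lambda>y a. D a y"] by (simp add: A_def)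
    then obtain c where c: "c \<in> supp_in A" "c \<noteq> 0" "\<And>t. t \<in> (\<lambda>y a. D a y) ` Y \<Longrightarrow> ip A t c = 0"
      using annih_nonzero[of A "(\<lambda>y a. D a y) ` Y"] Y(1) by (auto simp: A_def)
    have "\<forall>y\<in>Y. (\<Sum>a\<in>A. c a * D a y) = 0"
    proof
      fix y assume "y \<in> Y"
      then have "ip A (\<lambda>a. D a y) c = 0" by (intro c(3) imageI)
      then show "(\<Sum>a\<in>A. c a * D a y) = 0" by (simp add: ip_def mult.commute)
    qed
    with Y(2)[OF derivation_combination[of A D c]] D
    have "\<forall>v<n. \<forall>i<d. (\<Sum>a\<in>A. c a * D a (p v i)) = 0" by blast
    then have "c (v, i) = 0" if "v < n" "i < d" for v i using comb[OF that, of c] that by simp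
    then have "c a = 0" for a
      using c(1) by (cases a, cases "a \<in> A") (auto simp: A_def supp_in_def)
    then show False using c(2) by auto
  qed
qed

text \<open>Homogeneous coordinates: affine dependence of points becomes linear dependence of their
  lifts.\<close>

definition lift :: "nat \<Rightarrow> (nat \<Rightarrow> real) \<Rightarrow> nat \<Rightarrow> real" where
  "lift d x = (\<lambda>i. if i < d then x i else if i = d then 1 else 0)"

lemma lift_supp_in: "lift d x \<in> supp_in {..<Suc d}"
  by (auto simp: lift_def supp_in_def)

lemma ip_lift: "ip {..<Suc d} (lift d x) w = (\<Sum>i<d. x i * w i) + w d"
  by (simp add: ip_def lift_def)

lemma span_image_sum:
  fixes h :: "'b \<Rightarrow> 'a \<Rightarrow> real"
  assumes "finite S" "u \<in> span (h ` S)"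
  shows "\<exists>l. u = (\<Sum>s\<in>S. l s *\<^sub>R h s)"
proof -
  let ?R = "{u. \<exists>l. u = (\<Sum>s\<in>S. l s *\<^sub>R h s)}"
  have "subspace ?R" unfolding subspace_def
  proof (intro conjI allI ballI)
    have "0 = (\<Sum>s\<in>S. 0 *\<^sub>R h s)" by simp
    then show "0 \<in> ?R" by (intro CollectI exI[of _ "\<lambda>_. 0"])
  next
    fix x y assume "x \<in> ?R" "y \<in> ?R"
    then obtain l l' where "x = (\<Sum>s\<in>S. l s *\<^sub>R h s)" "y = (\<Sum>s\<in>S. l' s *\<^sub>R h s)" by auto
    then have "x + y = (\<Sum>s\<in>S. (l s + l' s) *\<^sub>R h s)" by (simp add: scaleR_add_left sum.distrib)
    then show "x + y \<in> ?R" by (intro CollectI exI[of _ "\<lambda>s. l s + l' s"])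
  next
    fix c x assume "x \<in> ?R"
    then obtain l where "x = (\<Sum>s\<in>S. l s *\<^sub>R h s)" by auto
    then have "c *\<^sub>R x = (\<Sum>s\<in>S. (c * l s) *\<^sub>R h s)" by (simp add: scaleR_sum_right)
    then show "c *\<^sub>R x \<in> ?R" by (intro CollectI exI[of _ "\<lambda>s. c * l s"])
  qed
  moreover have "h ` S \<subseteq> ?R"
  proof clarify
    fix s assume s: "s \<in> S"
    have "h s = (\<Sum>r\<in>S. (if r = s then 1 else 0) *\<^sub>R h r)"
      using assms(1) s by (simp add: if_distrib[of "\<lambda>c. c *\<^sub>R _"] cong: if_cong)
    then show "\<exists>l. h s = (\<Sum>s\<in>S. l s *\<^sub>R h s)" by (intro exI[of _ "\<lambda>r. if r = s then 1 else 0"])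
  qed
  ultimately have "span (h ` S) \<subseteq> ?R" by (rule span_minimal[rotated])
  then show ?thesis using assms(2) by blast
qed

text \<open>If a point were an affine combination of at most d others, a derivation that moves only
  this point could move it only inside the affine hull of the others.\<close>
lemma generic_lift_notin_span:
  assumes gen: "generic n d p" and S: "S \<subseteq> {0..<n}" "card S \<le> d" "v < n" "v \<notin> S"
  shows "lift d (p v) \<notin> span ((\<lambda>s. lift d (p s)) ` S)"
proof
  have fS: "finite S" using S(1) finite_subset by blast
  assume "lift d (p v) \<in> span ((\<lambda>s. lift d (p s)) ` S)"
  then obtain l where l: "lift d (p v) = (\<Sum>s\<in>S. l s *\<^sub>R lift d (p s))"
    using span_image_sum[OF fS] by blast
  have pv: "p v i = (\<Sum>s\<in>S. l s * p s i)" if "i < d" for i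
    using fun_cong[OF l, of i] that by (simp add: lift_def)
  have one: "(\<Sum>s\<in>S. l s) = 1" using fun_cong[OF l, of d] by (simp add: lift_def)
  then obtain s0 where s0: "s0 \<in> S" by fastforce
  \<comment> \<open>There are at most \<open>d - 1\<close> of these differences, so some nonzero
    \<open>e\<close> is orthogonal to all of them; it serves as the direction in which the
    derivation moves \<open>p v\<close>.\<close>
  have "card ((\<lambda>s. p s - p s0) ` (S - {s0})) < card {..<d}"
    using card_image_le[of "S - {s0}" "\<lambda>s. p s - p s0"] fS s0 S(2) card_gt_0_iff[of S]
    by (auto simp: card_Diff_singleton)
  then obtain e where e: "e \<in> supp_in {..<d}" "e \<noteq> 0"
      "\<And>t. t \<in> (\<lambda>s. p s - p s0) ` (S - {s0}) \<Longrightarrow> ip {..<d} t e = 0"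
    using annih_nonzero[of "{..<d}" "(\<lambda>s. p s - p s0) ` (S - {s0})"] fS by auto
  have e0: "ip {..<d} (p s) e = ip {..<d} (p s0) e" if "s \<in> S" for s
    using e(3)[of "p s - p s0"] that by (cases "s = s0") (auto simp: ip_diff_left)
  obtain D where D: "derivation D" and Dp: "\<And>w i. w < n \<Longrightarrow> i < d \<Longrightarrow> D (p w i) = (if w = v then e i else 0)"
    using generic_derivation_vector(1)[OF gen, of "\<lambda>(w, i). if w = v then e i else 0"] by auto
  have "(\<Sum>s\<in>S. D (l s)) = D 1"
    using derivation_on_sum[OF D, of S l] one by simp
  then have D1: "(\<Sum>s\<in>S. D (l s)) = 0" using derivation_on_1[OF D] by simp
  have De: "e i = (\<Sum>s\<in>S. D (l s) * p s i)" if i: "i < d" for i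
  proof -
    have "e i = D (p v i)" using Dp[OF S(3) i] by simp
    also have "\<dots> = (\<Sum>s\<in>S. D (l s * p s i))"
      using derivation_on_sum[OF D, of S "\<lambda>s. l s * p s i"] pv[OF i] by simp
    also have "\<dots> = (\<Sum>s\<in>S. D (l s) * p s i)"
    proof (rule sum.cong[OF refl])
      fix s assume "s \<in> S"
      then have "D (p s i) = 0" using Dp[of s i] S i by auto
      then show "D (l s * p s i) = D (l s) * p s i" by (simp add: derivation_on_mult[OF D] mult.commute)
    qed
    finally show ?thesis .
  qed
  have "ip {..<d} e e = ip {..<d} (\<lambda>i. \<Sum>s\<in>S. D (l s) * p s i) e"
    unfolding ip_def using De by (intro sum.cong) auto
  also have "\<dots> = (\<Sum>s\<in>S. D (l s) * ip {..<d} (p s) e)"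
    unfolding ip_def by (simp add: sum_distrib_right sum_distrib_left mult.assoc) (rule sum.swap)
  also have "\<dots> = (\<Sum>s\<in>S. D (l s) * ip {..<d} (p s0) e)" using e0 by (intro sum.cong) auto
  also have "\<dots> = 0" using D1 by (simp add: sum_distrib_right[symmetric])
  finally have "\<forall>i\<in>{..<d}. e i = 0" by (simp add: ip_self_eq_0)
  then show False using e(1,2) by (auto simp: supp_in_def fun_eq_iff)
qed

lemma generic_lift_independent:
  assumes gen: "generic n d p" and S: "S \<subseteq> {0..<n}" "card S \<le> Suc d"
  shows "inj_on (\<lambda>s. lift d (p s)) S \<and> independent ((\<lambda>s. lift d (p s)) ` S)"
proof -
  have "finite S" using S(1) finite_subset by blast
  then show ?thesis using S
  proof (induction S rule: finite_induct)
    case empty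
    then show ?case by (simp add: dependent_def)
  next
    case (insert v S)
    have n: "lift d (p v) \<notin> span ((\<lambda>s. lift d (p s)) ` S)"
      using insert by (intro generic_lift_notin_span[OF gen]) auto
    moreover have "lift d (p v) \<notin> (\<lambda>s. lift d (p s)) ` S" by (rule contra_subsetD[OF span_superset n])
    moreover have "independent (insert (lift d (p v)) ((\<lambda>s. lift d (p s)) ` S))"
      by (rule independent_insertI[OF n]) (use insert in auto)
    ultimately show ?case using insert by simp
  qed
qed

text \<open>The \<open>Suc d\<close> lifts are independent and fill all coordinates, so
  \<open>complete_by_coordinates\<close> leaves nothing free for an affine function vanishing on
  \<open>B\<close>.\<close>

lemma generic_affine_zero:
  assumes gen: "generic n d p" and B: "B \<subseteq> {0..<n}" "card B = Suc d"
    and w: "\<And>s. s \<in> B \<Longrightarrow> (\<Sum>i<d. p s i * w i) + c = 0"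
  shows "c = 0" "i < d \<Longrightarrow> w i = 0"
proof -
  define w' where "w' = (\<lambda>i. if i < d then w i else c)"
  let ?L = "(\<lambda>s. lift d (p s)) ` B"
  have ind: "inj_on (\<lambda>s. lift d (p s)) B" "independent ?L"
    using generic_lift_independent[OF gen B(1)] B(2) by auto
  have "card ?L = Suc d" using card_image[OF ind(1)] B(2) by simp
  moreover have "?L \<subseteq> supp_in {..<Suc d}" by (auto intro: lift_supp_in)
  ultimately obtain J where J: "J \<subseteq> {..<Suc d}" "card J + Suc d = Suc d"
      "\<And>c. (\<forall>w\<in>?L. ip {..<Suc d} w c = 0) \<Longrightarrow> (\<forall>j\<in>J. c j = 0) \<Longrightarrow> (\<forall>a\<in>{..<Suc d}. c a = 0)"
    using complete_by_coordinates[OF _ ind(2), of "{..<Suc d}"] by auto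
  have "J = {}" using J(1,2) finite_subset by fastforce
  moreover have "\<forall>u\<in>?L. ip {..<Suc d} u w' = 0"
  proof clarify
    fix s assume "s \<in> B"
    then show "ip {..<Suc d} (lift d (p s)) w' = 0" using w[of s] by (simp add: ip_lift w'_def)
  qed
  ultimately have 0: "\<forall>a\<in>{..<Suc d}. w' a = 0" using J(3) by blast
  show "c = 0" using 0[rule_format, of d] by (simp add: w'_def)
  show "i < d \<Longrightarrow> w i = 0" using 0[rule_format, of i] by (simp add: w'_def)
qed

lemma generic_orthogonal_zero:
  assumes gen: "generic n d p" and Q: "Q \<subseteq> {0..<n}" "d \<le> card Q" "x < n" "x \<notin> Q"
    and w: "\<And>s. s \<in> Q \<Longrightarrow> (\<Sum>i<d. (p x i - p s i) * w i) = 0" and i: "i < d"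
  shows "w i = 0"
proof -
  obtain Q' where Q': "Q' \<subseteq> Q" "card Q' = d" "finite Q'" using Q(2) by (metis obtain_subset_with_card_n)
  show ?thesis
  proof (rule generic_affine_zero(2)[OF gen, of "insert x Q'" w "- (\<Sum>i<d. p x i * w i)"])
    show "insert x Q' \<subseteq> {0..<n}" using Q Q' by auto
    have "x \<notin> Q'" using Q(4) Q'(1) by blast
    then show "card (insert x Q') = Suc d" using Q'(2,3) by simp
    fix s assume "s \<in> insert x Q'"
    then show "(\<Sum>i<d. p s i * w i) + - (\<Sum>i<d. p x i * w i) = 0"
      using w[of s] Q' by (auto simp: algebra_simps sum_subtractf)
  qed (rule i)
qed

text \<open>Lagrange interpolation: an affine function vanishing at the other \<open>d\<close>
  points exists by counting, and it cannot vanish at the remaining point as well, by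
  \<open>generic_affine_zero\<close>.\<close>

lemma generic_affine_interpolation:
  assumes gen: "generic n d p" and B: "B \<subseteq> {0..<n}" "card B = Suc d"
  shows "\<exists>w c. \<forall>s\<in>B. (\<Sum>i<d. w i * p s i) + c = t s"
proof -
  have fB: "finite B" using B(1) finite_subset by blast
  have "\<exists>w. \<forall>r\<in>B. ip {..<Suc d} (lift d (p r)) w = (if r = s then 1 else 0)" if s: "s \<in> B" for s
  proof -
    have "card ((\<lambda>s. lift d (p s)) ` (B - {s})) < card {..<Suc d}"
      using card_image_le[of "B - {s}" "\<lambda>s. lift d (p s)"] fB B(2) s by (simp add: card_Diff_singleton)
    then obtain w where w: "w \<in> supp_in {..<Suc d}" "w \<noteq> 0"
        "\<And>t. t \<in> (\<lambda>s. lift d (p s)) ` (B - {s}) \<Longrightarrow> ip {..<Suc d} t w = 0"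
      using annih_nonzero[OF finite_lessThan finite_imageI[OF finite_Diff[OF fB]]] by metis
    have "ip {..<Suc d} (lift d (p s)) w \<noteq> 0"
    proof
      assume "ip {..<Suc d} (lift d (p s)) w = 0"
      then have "ip {..<Suc d} (lift d (p r)) w = 0" if "r \<in> B" for r using w(3) that by (cases "r = s") auto
      then have 0: "(\<Sum>i<d. p r i * w i) + w d = 0" if "r \<in> B" for r using that by (simp add: ip_lift)
      have "w i = 0" for i
        using generic_affine_zero[OF gen B 0] w(1) by (cases "i < d"; cases "i = d") (auto simp: supp_in_def)
      then show False using w(2) by auto
    qed
    then show ?thesis
      using w(3) by (intro exI[of _ "(1 / ip {..<Suc d} (lift d (p s)) w) *\<^sub>R w"]) (auto simp: ip_scale_right)
  qed
  then obtain W where W: "\<And>s r. s \<in> B \<Longrightarrow> r \<in> B \<Longrightarrow> ip {..<Suc d} (lift d (p r)) (W s) = (if r = s then 1 else 0)"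
    by metis
  define w where "w = (\<lambda>i. \<Sum>s\<in>B. t s * W s i)"
  have "(\<Sum>i<d. w i * p r i) + w d = t r" if r: "r \<in> B" for r
  proof -
    have "(\<Sum>i<d. w i * p r i) + w d = (\<Sum>s\<in>B. t s * ((\<Sum>i<d. p r i * W s i) + W s d))"
      by (simp add: w_def sum_distrib_left sum_distrib_right distrib_left sum.distrib)
         (subst sum.swap, simp add: mult.commute mult.left_commute)
    also have "\<dots> = (\<Sum>s\<in>B. if s = r then t s else 0)"
      using W r by (intro sum.cong) (auto simp: ip_lift)
    also have "\<dots> = t r" using r fB by simp
    finally show ?thesis .
  qed
  then show ?thesis by blast
qed

section \<open>Infinitesimal motions; strain as half the derivative of a squared length\<close>

definition strain :: "nat \<Rightarrow> (nat \<Rightarrow> nat \<Rightarrow> real) \<Rightarrow> (nat \<Rightarrow> nat \<Rightarrow> real) \<Rightarrow> nat \<Rightarrow> nat \<Rightarrow> real" where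
  "strain d p m u v = (\<Sum>i<d. (p u i - p v i) * (m u i - m v i))"

definition trivial_motion :: "nat \<Rightarrow> nat \<Rightarrow> (nat \<Rightarrow> nat \<Rightarrow> real) \<Rightarrow> (nat \<Rightarrow> nat \<Rightarrow> real) \<Rightarrow> bool" where
  "trivial_motion n d p m \<longleftrightarrow> (\<exists>A b. (\<forall>i<d. \<forall>j<d. A i j = - A j i) \<and>
      (\<forall>v<n. \<forall>i<d. m v i = (\<Sum>j<d. A i j * p v j) + b i))"

lemma strain_commute: "strain d p m u v = strain d p m v u"
  unfolding strain_def by (rule sum.cong) (auto simp: algebra_simps)

lemma skew_quadratic_zero:
  assumes "\<And>i j. i < d \<Longrightarrow> j < d \<Longrightarrow> (A i j :: real) = - A j i"
  shows "(\<Sum>i<d. x i * (\<Sum>j<d. A i j * x j)) = 0"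
proof -
  have "(\<Sum>i<d. x i * (\<Sum>j<d. A i j * x j)) = (\<Sum>i<d. \<Sum>j<d. x i * A i j * x j)"
    by (simp add: sum_distrib_left mult.assoc)
  also have "\<dots> = (\<Sum>j<d. \<Sum>i<d. x i * A i j * x j)" by (rule sum.swap)
  also have "\<dots> = (\<Sum>j<d. \<Sum>i<d. - (x j * A j i * x i))"
  proof (intro sum.cong refl)
    fix j i assume "j \<in> {..<d}" "i \<in> {..<d}"
    then have e: "A i j = - A j i" using assms by blast
    show "x i * A i j * x j = - (x j * A j i * x i)" unfolding e by simp
  qed
  also have "\<dots> = - (\<Sum>i<d. \<Sum>j<d. x i * A i j * x j)" by (simp add: sum_negf)
  also have "\<dots> = - (\<Sum>i<d. x i * (\<Sum>j<d. A i j * x j))"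
    by (simp add: sum_distrib_left mult.assoc)
  finally show ?thesis by simp
qed

lemma strain_affine_skew:
  assumes "\<And>i j. i < d \<Longrightarrow> j < d \<Longrightarrow> A i j = - A j i"
    and "\<And>i. i < d \<Longrightarrow> m u i - m v i = (\<Sum>j<d. A i j * (p u j - p v j))"
  shows "strain d p m u v = 0"
proof -
  have "strain d p m u v = (\<Sum>i<d. (p u i - p v i) * (\<Sum>j<d. A i j * (p u j - p v j)))"
    unfolding strain_def by (intro sum.cong refl) (simp only: assms(2) lessThan_iff)
  then show ?thesis using skew_quadratic_zero[of d A "\<lambda>j. p u j - p v j", OF assms(1)] by simp
qed

lemma trivial_motion_strain:
  assumes "trivial_motion n d p m" "u < n" "v < n"
  shows "strain d p m u v = 0"
proof -
  obtain A b where A: "\<And>i j. i < d \<Longrightarrow> j < d \<Longrightarrow> A i j = - A j i"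
    and m: "\<And>v i. v < n \<Longrightarrow> i < d \<Longrightarrow> m v i = (\<Sum>j<d. A i j * p v j) + b i"
    using assms(1) unfolding trivial_motion_def by blast
  show ?thesis
    using m assms(2,3) by (intro strain_affine_skew[of d A, OF A]) (auto simp: algebra_simps sum_subtractf)
qed

text \<open>Interpolation makes the motion affine on \<open>B\<close>, with matrix \<open>A\<close>.
  Vanishing strain says that the quadratic form of \<open>A\<close> is zero on every edge vector;
  polarisation kills its symmetric part on pairs of edge vectors at \<open>r\<close>, and as these
  form a basis, \<open>A\<close> is skew.\<close>

lemma simplex_rigid:
  assumes gen: "generic n d p" and B: "B \<subseteq> {0..<n}" "card B = Suc d"
    and st: "\<And>s t. s \<in> B \<Longrightarrow> t \<in> B \<Longrightarrow> strain d p m s t = 0"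
  shows "\<exists>A b. (\<forall>i<d. \<forall>j<d. A i j = - A j i) \<and> (\<forall>s\<in>B. \<forall>i<d. m s i = (\<Sum>j<d. A i j * p s j) + b i)"
proof -
  have "\<exists>w c. \<forall>s\<in>B. (\<Sum>j<d. w j * p s j) + c = m s i" for i
    using generic_affine_interpolation[OF gen B, of "\<lambda>s. m s i"] .
  then obtain A b where A: "\<And>i s. s \<in> B \<Longrightarrow> (\<Sum>j<d. A i j * p s j) + b i = m s i" by metis
  have "B \<noteq> {}" using B(2) by auto
  then obtain r where r: "r \<in> B" by blast
  define x where "x s = (\<lambda>i. p r i - p s i)" for s
  have mr: "m s i - m t i = (\<Sum>j<d. A i j * (p s j - p t j))" if "s \<in> B" "t \<in> B" for s t i
    using A[OF that(1), of i] A[OF that(2), of i] by (simp add: algebra_simps sum_subtractf)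
  define bil where "bil u v = (\<Sum>i<d. u i * (\<Sum>j<d. A i j * v j))" for u v :: "nat \<Rightarrow> real"
  have bil_diff: "bil (\<lambda>i. u i - v i) (\<lambda>i. u i - v i) = bil u u - bil u v - bil v u + bil v v" for u v
    by (simp add: bil_def algebra_simps sum_subtractf sum.distrib)
  have q0: "bil (\<lambda>i. p s i - p t i) (\<lambda>i. p s i - p t i) = 0" if "s \<in> B" "t \<in> B" for s t
    using st[OF that] mr[OF that] by (simp add: strain_def bil_def)
  have pol: "bil (x s) (x t) + bil (x t) (x s) = 0" if "s \<in> B" "t \<in> B" for s t
  proof -
    have "bil (x s) (x s) = 0" "bil (x t) (x t) = 0" using q0[OF r] that by (auto simp: x_def)
    moreover have "bil (\<lambda>i. x s i - x t i) (\<lambda>i. x s i - x t i) = 0"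
      using q0[OF that(2,1)] by (simp add: x_def)
    ultimately show ?thesis using bil_diff[of "x s" "x t"] by simp
  qed
  have bil_swap: "bil u v = (\<Sum>j<d. v j * (\<Sum>i<d. A i j * u i))" for u v
    unfolding bil_def by (simp add: sum_distrib_left) (subst sum.swap, simp add: algebra_simps)
  have Q: "B - {r} \<subseteq> {0..<n}" "d \<le> card (B - {r})" "r < n" "r \<notin> B - {r}"
    using B r by (auto simp: card_Diff_singleton)
  have rows: "(\<Sum>j<d. (A i j + A j i) * x s j) = 0" if s: "s \<in> B" and i: "i < d" for s i
  proof (rule generic_orthogonal_zero[OF gen Q _ i, of "\<lambda>i. \<Sum>j<d. (A i j + A j i) * x s j"])
    fix t assume "t \<in> B - {r}"
    then have "bil (x s) (x t) + bil (x t) (x s) = 0" using pol s by blast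
    then have "(\<Sum>j<d. x t j * (\<Sum>i<d. A i j * x s i)) + (\<Sum>j<d. x t j * (\<Sum>i<d. A j i * x s i)) = 0"
      by (simp add: bil_swap[of "x s" "x t"]) (simp add: bil_def)
    then show "(\<Sum>i<d. (p r i - p t i) * (\<Sum>j<d. (A i j + A j i) * x s j)) = 0"
      by (simp add: x_def sum.distrib[symmetric] distrib_left[symmetric] distrib_right[symmetric] add.commute)
  qed
  have "A i j + A j i = 0" if ij: "i < d" "j < d" for i j
  proof (rule generic_orthogonal_zero[OF gen Q _ ij(2), of "\<lambda>j. A i j + A j i"])
    fix t assume "t \<in> B - {r}"
    then show "(\<Sum>j<d. (p r j - p t j) * (A i j + A j i)) = 0"
      using rows[of t i] ij(1) by (simp add: x_def mult.commute)
  qed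
  then have "\<forall>i<d. \<forall>j<d. A i j = - A j i"
    by (intro allI impI) (simp only: eq_neg_iff_add_eq_0)
  moreover have "\<forall>s\<in>B. \<forall>i<d. m s i = (\<Sum>j<d. A i j * p s j) + b i" using A by simp
  ultimately show ?thesis by blast
qed

text \<open>Subtract the trivial motion agreeing with \<open>m\<close> on a simplex in
  \<open>K\<close>. A vertex joined without strain to \<open>d\<close> vertices at rest has a
  velocity orthogonal to \<open>d\<close> independent directions, so it rests too; this spreads from
  the simplex to \<open>K\<close> and then to all vertices.\<close>

lemma rigid_cluster:
  assumes gen: "generic n d p" and K: "K \<subseteq> {0..<n}" "Suc d \<le> card K"
    and st: "\<And>s t. s \<in> K \<Longrightarrow> t \<in> K \<Longrightarrow> strain d p m s t = 0"
    and nb: "\<And>x. x < n \<Longrightarrow> x \<notin> K \<Longrightarrow> d \<le> card {s\<in>K. strain d p m x s = 0}"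
  shows "trivial_motion n d p m"
proof -
  obtain B where B: "B \<subseteq> K" "card B = Suc d" using K(2) by (metis obtain_subset_with_card_n)
  obtain A b where A: "\<And>i j. i < d \<Longrightarrow> j < d \<Longrightarrow> A i j = - A j i"
    and m: "\<And>s i. s \<in> B \<Longrightarrow> i < d \<Longrightarrow> m s i = (\<Sum>j<d. A i j * p s j) + b i"
    using simplex_rigid[OF gen subset_trans[OF B(1) K(1)] B(2), of m] st B(1)
    by (metis subsetD)
  define w where "w v i = m v i - ((\<Sum>j<d. A i j * p v j) + b i)" for v i
  have step: "w x i = 0"
    if x: "x < n" "x \<notin> Q" and Q: "Q \<subseteq> {0..<n}" "d \<le> card Q" and i: "i < d"
      and Q0: "\<And>s. s \<in> Q \<Longrightarrow> strain d p m x s = 0 \<and> (\<forall>i<d. w s i = 0)" for x Q i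
  proof (rule generic_orthogonal_zero[OF gen Q x _ i])
    fix s assume s: "s \<in> Q"
    have "w x i - w s i = (m x i - m s i) - (\<Sum>j<d. A i j * (p x j - p s j))" for i
      by (simp add: w_def right_diff_distrib sum_subtractf)
    note diff = this
    have "(\<Sum>i<d. (p x i - p s i) * w x i) = (\<Sum>i<d. (p x i - p s i) * (w x i - w s i))"
      using Q0[OF s] by simp
    also have "\<dots> = strain d p m x s - (\<Sum>i<d. (p x i - p s i) * (\<Sum>j<d. A i j * (p x j - p s j)))"
      unfolding diff by (simp only: strain_def right_diff_distrib[of "p x _ - p s _"] sum_subtractf)
    also have "\<dots> = 0" using Q0[OF s] skew_quadratic_zero[of d A "\<lambda>j. p x j - p s j", OF A] by simp
    finally show "(\<Sum>i<d. (p x i - p s i) * w x i) = 0" .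
  qed
  have wB: "w s i = 0" if "s \<in> B" "i < d" for s i using m[OF that] by (simp add: w_def)
  have wK: "w x i = 0" if x: "x \<in> K" and i: "i < d" for x i
  proof (cases "x \<in> B")
    case False
    then show ?thesis using x K B i wB st by (intro step[of x B]) auto
  qed (use wB i in auto)
  have "w x i = 0" if x: "x < n" and i: "i < d" for x i
  proof (cases "x \<in> K")
    case False
    then show ?thesis using K wK nb[OF x False] i x by (intro step[of x "{s\<in>K. strain d p m x s = 0}"]) auto
  qed (use wK i in auto)
  then have "\<forall>v<n. \<forall>i<d. m v i = (\<Sum>j<d. A i j * p v j) + b i" by (simp add: w_def)
  moreover have "\<forall>i<d. \<forall>j<d. A i j = - A j i" by (intro allI impI A)
  ultimately show ?thesis unfolding trivial_motion_def by blast
qed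

section \<open>Reduced representations of a motion\<close>

lemma trivial_motion_add:
  assumes "trivial_motion n d p m" "trivial_motion n d p m'"
  shows "trivial_motion n d p (\<lambda>v j. m v j + m' v j)"
proof -
  obtain A c where
    A: "\<forall>i<d. \<forall>j<d. A i j = - A j i" "\<forall>v<n. \<forall>i<d. m v i = (\<Sum>j<d. A i j * p v j) + c i"
    using assms(1) unfolding trivial_motion_def by blast
  obtain A' c' where
    A': "\<forall>i<d. \<forall>j<d. A' i j = - A' j i" "\<forall>v<n. \<forall>i<d. m' v i = (\<Sum>j<d. A' i j * p v j) + c' i"
    using assms(2) unfolding trivial_motion_def by blast
  have "A i j + A' i j = - (A j i + A' j i)" if "i < d" "j < d" for i j
  proof -
    have "A i j = - A j i" "A' i j = - A' j i" using A(1) A'(1) that by blast+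
    then show ?thesis by linarith
  qed
  then have "\<forall>i<d. \<forall>j<d. A i j + A' i j = - (A j i + A' j i)" by blast
  moreover have "\<forall>v<n. \<forall>i<d. m v i + m' v i = (\<Sum>j<d. (A i j + A' i j) * p v j) + (c i + c' i)"
    using A(2) A'(2) by (simp add: distrib_right sum.distrib)
  ultimately show ?thesis unfolding trivial_motion_def
    by (intro exI[of _ "\<lambda>i j. A i j + A' i j"] exI[of _ "\<lambda>i. c i + c' i"] conjI)
qed

lemma trivial_motion_cong:
  assumes "\<And>v i. v < n \<Longrightarrow> i < d \<Longrightarrow> m v i = m' v i" "trivial_motion n d p m"
  shows "trivial_motion n d p m'"
  using assms unfolding trivial_motion_def by metis

text \<open>A motion is represented, up to a trivial motion, as the sum of the fields \<open>b i * g i v\<close> with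
  constant directions \<open>b i\<close>; the directions are normalised on the coordinates in \<open>I\<close>.\<close>
definition representation_of ::
  "nat \<Rightarrow> nat \<Rightarrow> (nat \<Rightarrow> nat \<Rightarrow> real) \<Rightarrow> (nat \<Rightarrow> nat \<Rightarrow> real) \<Rightarrow> nat set \<Rightarrow> (nat \<Rightarrow> nat \<Rightarrow> real) \<Rightarrow> (nat \<Rightarrow> nat \<Rightarrow> real) \<Rightarrow> bool"
  where "representation_of n d p m I b g \<longleftrightarrow> I \<subseteq> {..<d} \<and>
     (\<forall>i\<in>I. \<forall>j\<in>I. b i j = (if i = j then 1 else 0)) \<and>
     trivial_motion n d p (\<lambda>v j. m v j - (\<Sum>i\<in>I. b i j * g i v))"

section \<open>The hyperbolic space attached to a representation\<close>

definition ybar :: "nat \<Rightarrow> (nat \<Rightarrow> nat \<Rightarrow> real) \<Rightarrow> (nat \<Rightarrow> nat \<Rightarrow> real) \<Rightarrow> nat \<Rightarrow> nat \<Rightarrow> real" where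
  "ybar d p b v i = (\<Sum>j<d. b i j * p v j)"

definition pairidx :: "nat set \<Rightarrow> (nat \<times> nat) set" where
  "pairidx I = {0, 1} \<times> I"

text \<open>The coordinates \<open>(0, i)\<close> and \<open>(1, i)\<close> span a hyperbolic plane
  for each \<open>i\<close>. The constant 1 at \<open>(2, 0)\<close> homogenises, so that linear
  dependence of the \<open>z v\<close> is affine dependence of the points
  \<open>(y v, g v)\<close>.\<close>

definition zlift ::
  "nat \<Rightarrow> (nat \<Rightarrow> nat \<Rightarrow> real) \<Rightarrow> nat set \<Rightarrow> (nat \<Rightarrow> nat \<Rightarrow> real) \<Rightarrow> (nat \<Rightarrow> nat \<Rightarrow> real) \<Rightarrow> nat \<Rightarrow> nat \<times> nat \<Rightarrow> real" where
  "zlift d p I b g v = (\<lambda>(a, i). if a = 0 \<and> i \<in> I then ybar d p b v i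
     else if a = 1 \<and> i \<in> I then g i v else if (a, i) = (2, 0) then 1 else 0)"

definition hyp :: "nat set \<Rightarrow> (nat \<times> nat \<Rightarrow> real) \<Rightarrow> (nat \<times> nat \<Rightarrow> real) \<Rightarrow> real" where
  "hyp I w w' = (\<Sum>i\<in>I. w (0, i) * w' (1, i) + w (1, i) * w' (0, i))"

lemma hyp_commute: "hyp I w w' = hyp I w' w"
  by (simp add: hyp_def algebra_simps)

lemma hyp_add_left: "hyp I (u + w) w' = hyp I u w' + hyp I w w'"
  by (simp add: hyp_def algebra_simps sum.distrib)

lemma hyp_scale_left: "hyp I (r *\<^sub>R w) w' = r * hyp I w w'"
  by (simp add: hyp_def algebra_simps sum_distrib_left)

lemma hyp_zero_left: "hyp I 0 w' = 0"
  by (simp add: hyp_def)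

lemma hyp_sum_left: "hyp I (\<Sum>s\<in>S. w s) w' = (\<Sum>s\<in>S. hyp I (w s) w')"
  by (induction S rule: infinite_finite_induct)
    (simp_all only: sum.infinite sum.empty sum.insert hyp_zero_left hyp_add_left not_False_eq_True)

lemma subspace_hyp_zero: "subspace {w. hyp I w u = 0}"
  by (simp add: subspace_def hyp_zero_left hyp_add_left hyp_scale_left)

lemma hyp_zero_span: "(\<And>s. s \<in> S \<Longrightarrow> hyp I s u = 0) \<Longrightarrow> w \<in> span S \<Longrightarrow> hyp I w u = 0"
  using span_minimal[OF _ subspace_hyp_zero, of S I u] by blast

lemma trivial_representation: "representation_of n d p m {..<d} (\<lambda>i j. if i = j then 1 else 0) (\<lambda>i v. m v i)"
proof -
  have "m v j - (\<Sum>i<d. (if i = j then 1 else 0) * m v i) = 0" if "j < d" for v j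
  proof -
    have "(\<Sum>i<d. (if i = j then 1 else 0) * m v i) = (\<Sum>i<d. if i = j then m v i else 0)"
      by (rule sum.cong) auto
    then show ?thesis using that by simp
  qed
  then have "trivial_motion n d p (\<lambda>v j. m v j - (\<Sum>i<d. (if i = j then 1 else 0) * m v i))"
    unfolding trivial_motion_def by (intro exI[of _ "\<lambda>_ _. 0"]) auto
  then show ?thesis by (simp add: representation_of_def)
qed

text \<open>A vector that is isotropic and orthogonal to all differences of the points \<open>z\<close> either
  contradicts general position or allows to eliminate one of the fields \<open>g\<close>; the leftover
  terms linear in \<open>p\<close> are made skew by changing the remaining fields.\<close>
lemma representation_reduce:
  assumes gen: "generic n d p" and dn: "d < n" and rep: "representation_of n d p m I b g"
    and w: "w \<in> supp_in (pairidx I)" "w \<noteq> 0"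
    and orth: "\<And>v. v < n \<Longrightarrow> hyp I w (zlift d p I b g v - zlift d p I b g 0) = 0"
    and iso: "hyp I w w = 0"
  shows "\<exists>I' b' g'. representation_of n d p m I' b' g' \<and> card I' < card I"
proof -
  have I: "I \<subseteq> {..<d}" and bu: "\<And>i j. i \<in> I \<Longrightarrow> j \<in> I \<Longrightarrow> b i j = (if i = j then 1 else 0)"
    and tr: "trivial_motion n d p (\<lambda>v j. m v j - (\<Sum>i\<in>I. b i j * g i v))"
    using rep by (auto simp: representation_of_def)
  have fI: "finite I" using I finite_subset by blast
  have orth': "(\<Sum>i\<in>I. w (0, i) * (g i v - g i 0) + w (1, i) * (ybar d p b v i - ybar d p b 0 i)) = 0"
    if "v < n" for v
    using orth[OF that] by (simp add: hyp_def zlift_def)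
  have iso': "(\<Sum>i\<in>I. w (1, i) * w (0, i)) = 0"
    using iso by (simp add: hyp_def mult.commute sum.distrib sum_distrib_left[symmetric])
  \<comment> \<open>If all \<open>w (0, a)\<close> vanished, orthogonality would make the affine
    function with linear part \<open>\<Sum>i\<in>I. w (1, i) * b i j\<close> constant on all points.
    General position makes that linear part zero, and the normalisation of \<open>b\<close> then
    gives \<open>w = 0\<close>.\<close>
  have "\<exists>a\<in>I. w (0, a) \<noteq> 0"
  proof (rule ccontr)
    assume "\<not> (\<exists>a\<in>I. w (0, a) \<noteq> 0)"
    then have w0: "\<And>a. a \<in> I \<Longrightarrow> w (0, a) = 0" by blast
    have eq: "(\<Sum>j<d. (p 0 j - p v j) * (\<Sum>i\<in>I. w (1, i) * b i j)) = 0" if "v < n" for v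
    proof -
      have "(\<Sum>j<d. (p 0 j - p v j) * (\<Sum>i\<in>I. w (1, i) * b i j))
          = (\<Sum>j<d. \<Sum>i\<in>I. w (1, i) * (b i j * p 0 j) - w (1, i) * (b i j * p v j))"
        by (simp add: sum_distrib_left algebra_simps)
      also have "\<dots> = (\<Sum>i\<in>I. \<Sum>j<d. w (1, i) * (b i j * p 0 j) - w (1, i) * (b i j * p v j))"
        by (rule sum.swap)
      also have "\<dots> = - (\<Sum>i\<in>I. w (1, i) * (ybar d p b v i - ybar d p b 0 i))"
        by (simp add: ybar_def sum_subtractf sum_distrib_left right_diff_distrib)
      also have "\<dots> = 0" using orth'[OF that] w0 by simp
      finally show ?thesis .
    qed
    have zero: "(\<Sum>i\<in>I. w (1, i) * b i j) = 0" if "j < d" for j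
    proof (rule generic_orthogonal_zero[OF gen _ _ _ _ _ that, of "{1..<n}" 0])
      show "{1..<n} \<subseteq> {0..<n}" by auto
      show "d \<le> card {1..<n}" using dn by simp
    qed (use dn eq in auto)
    have "w (1, a) = 0" if a: "a \<in> I" for a
    proof -
      have "(\<Sum>i\<in>I. w (1, i) * b i a) = (\<Sum>i\<in>I. if i = a then w (1, i) else 0)"
        using bu a by (intro sum.cong) auto
      then show ?thesis using zero[of a] a I fI by auto
    qed
    then have "w x = 0" for x
      using w0[of "snd x"] w(1) \<open>snd x \<in> I \<Longrightarrow> w (1, snd x) = 0\<close>
      by (cases x; cases "fst x = 0"; cases "fst x = 1"; cases "snd x \<in> I") (auto simp: supp_in_def pairidx_def)
    then show False using w(2) by auto
  qed
  then obtain a where a: "a \<in> I" "w (0, a) \<noteq> 0" by blast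
  define J where "J = I - {a}"
  have fJ: "finite J" and aJ: "a \<notin> J" and IJ: "I = insert a J" using fI a by (auto simp: J_def)
  define r where "r l = w (0, l) / w (0, a)" for l
  define s where "s l = w (1, l) / w (0, a)" for l
  define b' where "b' l j = b l j - r l * b a j" for l j
  define Y where "Y v = ybar d p b v a" for v
  define g' where "g' l v = g l v - s l * Y v" for l v
  define c where "c = g a 0 + (\<Sum>l\<in>J. r l * g l 0) + (\<Sum>i\<in>I. s i * ybar d p b 0 i)"
  \<comment> \<open>Orthogonality divided by \<open>w (0, a)\<close>, solved for the field
    \<open>g a\<close> that is to be eliminated.\<close>
  have ga: "g a v = c - (\<Sum>l\<in>J. r l * g l v) - (\<Sum>i\<in>I. s i * ybar d p b v i)" if "v < n" for v
  proof -
    have "0 = (\<Sum>i\<in>I. w (0, i) * (g i v - g i 0) + w (1, i) * (ybar d p b v i - ybar d p b 0 i)) / w (0, a)"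
      using orth'[OF that] by simp
    also have "\<dots> = (\<Sum>i\<in>I. r i * (g i v - g i 0) + s i * (ybar d p b v i - ybar d p b 0 i))"
      by (simp add: r_def s_def sum_divide_distrib add_divide_distrib)
    also have "\<dots> = (\<Sum>i\<in>I. r i * (g i v - g i 0)) + (\<Sum>i\<in>I. s i * (ybar d p b v i - ybar d p b 0 i))"
      by (rule sum.distrib)
    also have "(\<Sum>i\<in>I. r i * (g i v - g i 0)) = (g a v - g a 0) + (\<Sum>l\<in>J. r l * (g l v - g l 0))"
      using a by (simp add: IJ fJ aJ r_def)
    finally show ?thesis by (simp add: c_def right_diff_distrib sum_subtractf)
  qed
  \<comment> \<open>This is isotropy of \<open>w\<close>, divided by the square of
    \<open>w (0, a)\<close>. In \<open>sy\<close> it removes the multiple of \<open>Y v\<close>,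
    which would contribute a symmetric term \<open>b a i * Y v\<close> that no skew matrix can
    absorb.\<close>
  have rs: "s a + (\<Sum>l\<in>J. s l * r l) = 0"
  proof -
    have "0 = (\<Sum>i\<in>I. w (1, i) * w (0, i)) / (w (0, a) * w (0, a))" using iso' by simp
    also have "\<dots> = (\<Sum>i\<in>I. s i * r i)" by (simp add: s_def r_def sum_divide_distrib)
    also have "\<dots> = s a + (\<Sum>l\<in>J. s l * r l)" using a by (simp add: IJ fJ aJ r_def)
    finally show ?thesis by simp
  qed
  define T where "T v l = (\<Sum>j<d. b' l j * p v j)" for v l
  have yl: "ybar d p b v l = T v l + r l * Y v" for v l
    by (simp add: ybar_def T_def Y_def b'_def left_diff_distrib sum_subtractf sum_distrib_left mult.assoc)
  have sy: "(\<Sum>i\<in>I. s i * ybar d p b v i) = (\<Sum>l\<in>J. s l * T v l)" for v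
  proof -
    have "(\<Sum>i\<in>I. s i * ybar d p b v i) = s a * Y v + (\<Sum>l\<in>J. s l * (T v l + r l * Y v))"
    proof -
      have "(\<Sum>i\<in>J. s i * ybar d p b v i) = (\<Sum>l\<in>J. s l * (T v l + r l * Y v))"
        by (rule sum.cong) (simp_all only: yl)
      moreover have "(\<Sum>i\<in>I. s i * ybar d p b v i) = s a * Y v + (\<Sum>i\<in>J. s i * ybar d p b v i)"
        using fJ aJ by (simp add: IJ Y_def)
      ultimately show ?thesis by simp
    qed
    also have "\<dots> = (s a + (\<Sum>l\<in>J. s l * r l)) * Y v + (\<Sum>l\<in>J. s l * T v l)"
      by (simp add: distrib_left distrib_right sum.distrib sum_distrib_right mult.assoc)
    finally show ?thesis by (simp add: rs)
  qed
  define A where "A i j = (\<Sum>l\<in>J. s l * (b' l i * b a j - b a i * b' l j))" for i j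
  have "trivial_motion n d p (\<lambda>v j. (\<Sum>i\<in>I. b i j * g i v) - (\<Sum>l\<in>J. b' l j * g' l v))"
    unfolding trivial_motion_def
  proof (intro exI[of _ A] exI[of _ "\<lambda>j. b a j * c"] conjI allI impI)
    show "A i j = - A j i" for i j
      unfolding A_def sum_negf[symmetric] by (rule sum.cong) (auto simp: algebra_simps)
    fix v i assume v: "v < n" and i: "i < d"
    have "(\<Sum>k\<in>I. b k i * g k v) = b a i * g a v + (\<Sum>l\<in>J. b l i * g l v)"
      using fJ aJ by (simp add: IJ)
    also have "\<dots> = b a i * c - b a i * (\<Sum>l\<in>J. s l * T v l) + (\<Sum>l\<in>J. b' l i * g l v)"
      unfolding ga[OF v] sy b'_def
      by (simp add: right_diff_distrib left_diff_distrib sum_subtractf sum_distrib_left algebra_simps)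
    finally have "(\<Sum>k\<in>I. b k i * g k v) - (\<Sum>l\<in>J. b' l i * g' l v)
        = b a i * c - b a i * (\<Sum>l\<in>J. s l * T v l) + (\<Sum>l\<in>J. s l * (b' l i * Y v))"
      by (simp add: g'_def right_diff_distrib sum_subtractf algebra_simps)
    also have "\<dots> = b a i * c + (\<Sum>l\<in>J. s l * (b' l i * Y v - b a i * T v l))"
      by (simp add: sum_distrib_left right_diff_distrib sum_subtractf mult.left_commute)
    also have "(\<Sum>l\<in>J. s l * (b' l i * Y v - b a i * T v l)) = (\<Sum>j<d. A i j * p v j)"
    proof -
      have "(\<Sum>j<d. A i j * p v j) = (\<Sum>l\<in>J. \<Sum>j<d. s l * (b' l i * b a j - b a i * b' l j) * p v j)"
        unfolding A_def sum_distrib_right by (rule sum.swap)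
      also have "\<dots> = (\<Sum>l\<in>J. s l * (b' l i * Y v - b a i * T v l))"
      proof (rule sum.cong[OF refl])
        fix l
        have "(\<Sum>j<d. s l * (b' l i * b a j - b a i * b' l j) * p v j)
            = (\<Sum>j<d. s l * b' l i * (b a j * p v j)) - (\<Sum>j<d. s l * b a i * (b' l j * p v j))"
          unfolding sum_subtractf[symmetric] by (rule sum.cong) (auto simp: algebra_simps)
        then show "(\<Sum>j<d. s l * (b' l i * b a j - b a i * b' l j) * p v j) = s l * (b' l i * Y v - b a i * T v l)"
          unfolding Y_def ybar_def T_def
          by (simp only: sum_distrib_left[symmetric] right_diff_distrib[of "s l"] mult.assoc)
      qed
      finally show ?thesis by simp
    qed
    finally show "(\<Sum>k\<in>I. b k i * g k v) - (\<Sum>l\<in>J. b' l i * g' l v) = (\<Sum>j<d. A i j * p v j) + b a i * c"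
      by simp
  qed
  from trivial_motion_add[OF tr this]
  have "trivial_motion n d p (\<lambda>v j. m v j - (\<Sum>l\<in>J. b' l j * g' l v))"
    by (rule trivial_motion_cong[rotated]) simp
  moreover have "b' i j = (if i = j then 1 else 0)" if ij: "i \<in> J" "j \<in> J" for i j
    using bu[of i j] bu[of a j] ij a by (auto simp: J_def b'_def)
  ultimately have "representation_of n d p m J b' g'"
    using I by (auto simp: representation_of_def J_def)
  moreover have "card J < card I" using fJ aJ by (simp add: IJ)
  ultimately show ?thesis by blast
qed

section \<open>Minimal representations of a nontrivial motion\<close>

lemma supp_inD: "w \<in> supp_in A \<Longrightarrow> x \<notin> A \<Longrightarrow> w x = 0"
  by (simp add: supp_in_def)

lemma supp_inI: "(\<And>x. x \<notin> A \<Longrightarrow> w x = 0) \<Longrightarrow> w \<in> supp_in A"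
  by (simp add: supp_in_def)

text \<open>\<open>minimal\<close> chooses the fewest fields; \<open>deg\<close> is the degree bound
  \<open>(n + d - 2) / 2\<close> kept free of division and subtraction. Of an edge only the
  vanishing strain is recorded.\<close>

locale frame =
  fixes n d :: nat and p m :: "nat \<Rightarrow> nat \<Rightarrow> real" and I :: "nat set"
    and b g :: "nat \<Rightarrow> nat \<Rightarrow> real" and N :: "nat \<Rightarrow> nat set"
  assumes gen: "generic n d p" and dn: "d < n"
    and nontrivial: "\<not> trivial_motion n d p m"
    and rep: "representation_of n d p m I b g"
    and minimal: "\<And>I' b' g'. representation_of n d p m I' b' g' \<Longrightarrow> card I \<le> card I'"
    and deg: "\<And>v. v < n \<Longrightarrow> n + d \<le> 2 * card (N v) + 2"
    and nbr: "\<And>u v. v < n \<Longrightarrow> u \<in> N v \<Longrightarrow> u < n \<and> u \<noteq> v \<and> strain d p m u v = 0"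
begin

abbreviation V :: "nat set" where "V \<equiv> {0..<n}"
abbreviation z :: "nat \<Rightarrow> nat \<times> nat \<Rightarrow> real" where "z \<equiv> zlift d p I b g"
abbreviation k :: nat where "k \<equiv> card I"

definition rho :: "nat set \<Rightarrow> nat" where "rho S = dim (z ` S)"

lemma I_sub: "I \<subseteq> {..<d}" and finite_I: "finite I"
  and b_unit: "i \<in> I \<Longrightarrow> j \<in> I \<Longrightarrow> b i j = (if i = j then 1 else 0)"
  using rep finite_subset by (auto simp: representation_of_def)

lemma card_pairidx: "card (pairidx I) = 2 * k" "finite (pairidx I)"
  using finite_I by (auto simp: pairidx_def card_cartesian_product)

lemma z_last: "z v (2, 0) = 1"
  by (simp add: zlift_def)

lemma z_supp: "z v \<in> supp_in (insert (2, 0) (pairidx I))"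
  by (auto simp: zlift_def supp_in_def pairidx_def)

text \<open>Trivial motions have no strain, and a field of constant direction \<open>b i\<close>
  strains a pair by the product of the differences of \<open>ybar\<close> and of \<open>g i\<close>;
  the factor 2 comes from the symmetric form \<open>hyp\<close>.\<close>

lemma strain_hyp:
  assumes "u < n" "v < n"
  shows "2 * strain d p m u v = hyp I (z u - z v) (z u - z v)"
proof -
  define m' where "m' v j = m v j - (\<Sum>i\<in>I. b i j * g i v)" for v j
  have "trivial_motion n d p m'" using rep unfolding m'_def by (simp add: representation_of_def)
  then have 0: "strain d p m' u v = 0" using trivial_motion_strain assms by blast
  have "m u j - m v j = (m' u j - m' v j) + (\<Sum>i\<in>I. b i j * (g i u - g i v))" for j
    by (simp add: m'_def right_diff_distrib sum_subtractf)
  then have "strain d p m u v = strain d p m' u v + (\<Sum>j<d. (p u j - p v j) * (\<Sum>i\<in>I. b i j * (g i u - g i v)))"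
    by (simp add: strain_def distrib_left sum.distrib)
  also have "\<dots> = (\<Sum>j<d. \<Sum>i\<in>I. b i j * (p u j - p v j) * (g i u - g i v))"
    by (simp add: 0 sum_distrib_left mult_ac)
  also have "\<dots> = (\<Sum>i\<in>I. \<Sum>j<d. b i j * (p u j - p v j) * (g i u - g i v))"
    by (rule sum.swap)
  also have "\<dots> = (\<Sum>i\<in>I. (ybar d p b u i - ybar d p b v i) * (g i u - g i v))"
    by (simp only: ybar_def sum_distrib_right[symmetric] right_diff_distrib[of "b _ _"] sum_subtractf)
  finally show ?thesis by (simp add: hyp_def zlift_def mult_ac sum_distrib_left)
qed

text \<open>For nonempty \<open>T\<close> this is the direction space of the affine hull of the
  \<open>z v\<close> with \<open>v \<in> T\<close>; its dimension is
  \<open>rho T - 1\<close>.\<close>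

definition Dbar :: "nat set \<Rightarrow> (nat \<times> nat \<Rightarrow> real) set" where
  "Dbar T = {w \<in> span (z ` T). w (2, 0) = 0}"

lemma subspace_last: "subspace {w. (w :: nat \<times> nat \<Rightarrow> real) (2, 0) = 0}"
  by (simp add: subspace_def)

lemma subspace_Dbar: "subspace (Dbar T)"
proof -
  have "Dbar T = span (z ` T) \<inter> {w. w (2, 0) = 0}" by (auto simp: Dbar_def)
  then show ?thesis using subspace_inter[OF subspace_span subspace_last] by simp
qed

lemma Dbar_diff: "u \<in> T \<Longrightarrow> v \<in> T \<Longrightarrow> z u - z v \<in> Dbar T"
  by (simp add: Dbar_def span_diff span_base z_last)

lemma Dbar_mono: "span (z ` S) \<subseteq> span (z ` T) \<Longrightarrow> Dbar S \<subseteq> Dbar T"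
  by (auto simp: Dbar_def)

lemma Dbar_supp: "Dbar T \<subseteq> supp_in (pairidx I)"
proof
  fix w assume w: "w \<in> Dbar T"
  have "z ` T \<subseteq> supp_in (insert (2, 0) (pairidx I))" using z_supp by (simp add: image_subset_iff)
  then have "span (z ` T) \<subseteq> supp_in (insert (2, 0) (pairidx I))" by (rule span_minimal[OF _ subspace_supp_in])
  then have "w \<in> supp_in (insert (2, 0) (pairidx I))" using w by (auto simp: Dbar_def)
  then have "w x = 0" if "x \<notin> pairidx I" for x
    using w supp_inD[of w "insert (2, 0) (pairidx I)" x] that by (cases "x = (2, 0)") (auto simp: Dbar_def)
  then show "w \<in> supp_in (pairidx I)" by (rule supp_inI)
qed

lemma Dbar_basis:
  assumes "finite T" "t \<in> T"
  obtains W where "finite W" "independent W" "W \<subseteq> Dbar T" "Dbar T \<subseteq> span W" "card W + 1 = rho T"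
proof -
  have "z t \<noteq> 0" using z_last[of t] by auto
  then have "independent {z t}" by simp
  then obtain K where K: "{z t} \<subseteq> K" "K \<subseteq> z ` T" "independent K" "z ` T \<subseteq> span K"
    using maximal_independent_subset_extend[of "{z t}" "z ` T"] assms(2) by auto
  have fK: "finite K" using K(2) assms(1) finite_subset by blast
  have cK: "card K = rho T" unfolding rho_def using dim_unique[OF K(2,4,3) refl] by simp
  define W0 where "W0 = (\<lambda>c. c - z t) ` (K - {z t})"
  obtain W where W: "W \<subseteq> W0" "independent W" "W0 \<subseteq> span W"
    by (rule maximal_independent_subset[of W0])
  have fW: "finite W" using W(1) fK finite_subset unfolding W0_def by blast
  have W0D: "W0 \<subseteq> Dbar T"
  proof
    fix w assume "w \<in> W0"
    then obtain s where "s \<in> T" "w = z s - z t" using K(2) unfolding W0_def by blast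
    then show "w \<in> Dbar T" using Dbar_diff assms(2) by simp
  qed
  have KW: "K \<subseteq> span (insert (z t) W)"
  proof
    fix c assume c: "c \<in> K"
    show "c \<in> span (insert (z t) W)"
    proof (cases "c = z t")
      case False
      then have "c - z t \<in> span W" using W(3) c unfolding W0_def by blast
      then have "c - z t \<in> span (insert (z t) W)" by (rule rev_subsetD[OF _ span_mono]) auto
      then have "(c - z t) + z t \<in> span (insert (z t) W)" by (intro span_add) (auto intro: span_base)
      then show ?thesis by simp
    qed (auto intro: span_base)
  qed
  have "card K \<le> card (insert (z t) W)"
    using independent_span_bound[OF _ K(3) KW] fW by auto
  also have "\<dots> \<le> card W + 1" using fW by (simp add: card_insert_if)
  finally have 1: "rho T \<le> card W + 1" using cK by simp
  have "card W \<le> card W0" using W(1) fK unfolding W0_def by (intro card_mono) auto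
  also have "\<dots> \<le> card (K - {z t})" unfolding W0_def using fK by (intro card_image_le) auto
  also have "\<dots> < card K" using fK K(1) by (intro psubset_card_mono) auto
  finally have 2: "card W + 1 \<le> rho T" using cK by simp
  have "Dbar T \<subseteq> span W"
  proof
    fix u assume u: "u \<in> Dbar T"
    have "span (z ` T) \<subseteq> span (insert (z t) W)"
    proof (rule span_minimal[OF _ subspace_span])
      have "span K \<subseteq> span (insert (z t) W)" using KW by (rule span_minimal[OF _ subspace_span])
      then show "z ` T \<subseteq> span (insert (z t) W)" using K(4) by (rule order_trans[rotated])
    qed
    then have "u \<in> span (insert (z t) W)" using u by (auto simp: Dbar_def)
    then obtain c where c: "u - c *\<^sub>R z t \<in> span W" using span_breakdown_eq by blast
    have "W \<subseteq> {w. w (2, 0) = 0}" using W(1) W0D by (auto simp: Dbar_def)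
    then have "span W \<subseteq> {w. w (2, 0) = 0}" by (rule span_minimal[OF _ subspace_last])
    then have "(u - c *\<^sub>R z t) (2, 0) = 0" using c by blast
    then have "c = 0" using u z_last[of t] by (simp add: Dbar_def)
    then show "u \<in> span W" using c by simp
  qed
  then show ?thesis using that fW W(1,2) W0D 1 2 by (metis le_antisym order_trans)
qed

text \<open>Minimality of \<open>k\<close>: such a vector, if nonzero, would let
  \<open>representation_reduce\<close> remove a field. It is applied to vectors of
  \<open>Dbar V\<close>, whose isotropy follows from orthogonality.\<close>

lemma hyp_nondegenerate:
  assumes w: "w \<in> supp_in (pairidx I)" and orth: "\<And>u. u \<in> Dbar V \<Longrightarrow> hyp I w u = 0" and iso: "hyp I w w = 0"
  shows "w = 0"
proof (rule ccontr)
  assume "w \<noteq> 0"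
  moreover have "hyp I w (z v - z 0) = 0" if "v < n" for v
    using that dn by (intro orth Dbar_diff) auto
  ultimately obtain I' b' g' where "representation_of n d p m I' b' g'" "card I' < card I"
    using representation_reduce[OF gen dn rep w _ _ iso] by blast
  then show False using minimal by fastforce
qed

text \<open>Exchanging the two halves turns \<open>hyp\<close> into the standard inner product, so
  orthogonal complements can be computed as annihilators.\<close>

definition swp :: "(nat \<times> nat \<Rightarrow> real) \<Rightarrow> nat \<times> nat \<Rightarrow> real" where
  "swp w = (\<lambda>(a, i). if a = 0 \<and> i \<in> I then w (1, i) else if a = 1 \<and> i \<in> I then w (0, i) else 0)"

lemma swp_supp: "swp w \<in> supp_in (pairidx I)"
  by (auto simp: swp_def supp_in_def pairidx_def)

lemma hyp_swp: "hyp I w u = ip (pairidx I) (swp u) w"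
proof -
  have "ip (pairidx I) (swp u) w = (\<Sum>a\<in>{0, 1}. \<Sum>i\<in>I. swp u (a, i) * w (a, i))"
    unfolding ip_def pairidx_def by (simp add: sum.cartesian_product)
  also have "\<dots> = hyp I w u" by (simp add: swp_def hyp_def sum.distrib mult.commute)
  finally show ?thesis by simp
qed

lemma orthogonal_complement:
  assumes "finite W"
  obtains P where "finite P" "independent P" "P \<subseteq> supp_in (pairidx I)"
    "\<And>w u. w \<in> span P \<Longrightarrow> u \<in> span W \<Longrightarrow> hyp I w u = 0" "2 * k \<le> card P + card W"
    "\<And>w. w \<in> supp_in (pairidx I) \<Longrightarrow> (\<And>u. u \<in> W \<Longrightarrow> hyp I w u = 0) \<Longrightarrow> w \<in> span P"
proof -
  let ?A = "annih (pairidx I) (swp ` W)"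
  obtain P where P: "P \<subseteq> ?A" "independent P" "?A \<subseteq> span P" "card P = dim ?A"
    using basis_exists[of ?A] by metis
  have Psup: "P \<subseteq> supp_in (pairidx I)" using P(1) by (auto simp: annih_def)
  have "P \<subseteq> span (unitf ` pairidx I)" using Psup by (simp add: span_unitf card_pairidx)
  then have fP: "finite P" using independent_span_bound[OF _ P(2), of "unitf ` pairidx I"] card_pairidx by auto
  have PW: "hyp I w u = 0" if w: "w \<in> span P" and u: "u \<in> W" for w u
  proof -
    have "hyp I s u = 0" if "s \<in> P" for s using P(1) that u by (auto simp: annih_def hyp_swp)
    then show ?thesis using w by (rule hyp_zero_span)
  qed
  show ?thesis
  proof
    show "finite P" "independent P" "P \<subseteq> supp_in (pairidx I)" by fact+
    show "hyp I w u = 0" if w: "w \<in> span P" and u: "u \<in> span W" for w u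
      using hyp_zero_span[of W I w u] PW[OF w] u by (simp add: hyp_commute)
    have "swp ` W \<subseteq> supp_in (pairidx I)" by (simp add: image_subset_iff swp_supp)
    then have "2 * k \<le> dim ?A + dim (swp ` W)"
      using annih_dim_ge[of "pairidx I" "swp ` W"] card_pairidx by simp
    moreover have "dim (swp ` W) \<le> card W"
      using dim_le_card[OF span_superset, of "swp ` W"] card_image_le[OF assms, of swp] assms
      by (meson finite_imageI le_trans)
    ultimately show "2 * k \<le> card P + card W" using P(4) by simp
    show "w \<in> span P" if "w \<in> supp_in (pairidx I)" "\<And>u. u \<in> W \<Longrightarrow> hyp I w u = 0" for w
      using that P(3) by (auto simp: annih_def hyp_swp)
  qed
qed

section \<open>Derivations acting on the points\<close>

definition fixes_dirs :: "(real \<Rightarrow> real) \<Rightarrow> bool" where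
  "fixes_dirs D \<longleftrightarrow> derivation D \<and> (\<forall>i\<in>I. \<forall>j<d. D (b i j) = 0)"

definition fixes_pt :: "(real \<Rightarrow> real) \<Rightarrow> nat \<Rightarrow> bool" where
  "fixes_pt D v \<longleftrightarrow> (\<forall>j<d. D (p v j) = 0) \<and> (\<forall>i\<in>I. D (g i v) = 0)"

definition dz :: "(real \<Rightarrow> real) \<Rightarrow> nat \<Rightarrow> nat \<times> nat \<Rightarrow> real" where
  "dz D v = (\<lambda>(a, i). if a = 0 \<and> i \<in> I then D (ybar d p b v i) else if a = 1 \<and> i \<in> I then D (g i v) else 0)"

lemma D_ybar:
  assumes "fixes_dirs D" "i \<in> I"
  shows "D (ybar d p b v i) = (\<Sum>j<d. b i j * D (p v j))"
proof -
  have D: "derivation D" using assms by (simp add: fixes_dirs_def)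
  have "D (ybar d p b v i) = (\<Sum>j<d. D (b i j * p v j))"
    unfolding ybar_def by (rule derivation_on_sum[OF D, THEN conjunct2]) simp
  then show ?thesis using assms by (simp add: derivation_on_mult[OF D] fixes_dirs_def)
qed

lemma dz_fixed: "fixes_dirs D \<Longrightarrow> fixes_pt D v \<Longrightarrow> dz D v = 0"
  by (auto simp: dz_def fun_eq_iff D_ybar fixes_pt_def)

text \<open>The equation that \<open>z u - z v\<close> is isotropic along an edge, differentiated by
  \<open>D\<close>.\<close>

lemma dz_edge:
  assumes D: "fixes_dirs D" and e: "v < n" "u \<in> N v"
  shows "hyp I (z u - z v) (dz D u - dz D v) = 0"
proof -
  have der: "derivation D" using D by (simp add: fixes_dirs_def)
  let ?y = "\<lambda>v. ybar d p b v"
  have "hyp I (z u - z v) (z u - z v) = 0" using strain_hyp[of u v] nbr[OF e] e(1) by simp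
  then have "(\<Sum>i\<in>I. 2 * ((?y u i - ?y v i) * (g i u - g i v))) = 0"
    by (simp add: hyp_def zlift_def mult.commute)
  then have "(\<Sum>i\<in>I. (?y u i - ?y v i) * (g i u - g i v)) = 0" by (simp add: sum_distrib_left[symmetric])
  then have "D (\<Sum>i\<in>I. (?y u i - ?y v i) * (g i u - g i v)) = 0" using derivation_on_0[OF der] by simp
  then have "(\<Sum>i\<in>I. D ((?y u i - ?y v i) * (g i u - g i v))) = 0"
    using derivation_on_sum[OF der, of I "\<lambda>i. (?y u i - ?y v i) * (g i u - g i v)"] by simp
  then show ?thesis
    by (simp add: hyp_def zlift_def dz_def derivation_on_mult[OF der] derivation_on_diff[OF der] mult.commute add.commute)
qed

text \<open>Write \<open>z v\<close> as an affine combination of the \<open>z s\<close>, whose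
  coordinates \<open>D\<close> annihilates. Only the weights get differentiated, and their
  derivatives sum to \<open>D 1 = 0\<close>, which puts the result into the direction space.\<close>

lemma dz_span:
  assumes D: "fixes_dirs D" and S: "finite S" "\<And>s. s \<in> S \<Longrightarrow> fixes_pt D s" and v: "z v \<in> span (z ` S)"
  shows "dz D v \<in> Dbar S"
proof -
  have der: "derivation D" using D by (simp add: fixes_dirs_def)
  obtain l where l: "z v = (\<Sum>s\<in>S. l s *\<^sub>R z s)" using span_image_sum[OF S(1) v] by blast
  have "(\<Sum>s\<in>S. l s) = 1" using fun_cong[OF l, of "(2, 0)"] by (simp add: z_last)
  then have l0: "(\<Sum>s\<in>S. D (l s)) = 0"
    using derivation_on_sum[OF der, of S l] derivation_on_1[OF der] by simp
  have Dz: "D (z s x) = 0" if "s \<in> S" for s x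
  proof -
    have "dz D s x = 0" using dz_fixed[OF D S(2)[OF that]] by simp
    then show ?thesis
      by (cases x) (auto simp: dz_def zlift_def derivation_on_0[OF der] derivation_on_1[OF der] split: if_splits)
  qed
  have "dz D v x = D (z v x)" for x
    by (cases x) (auto simp: dz_def zlift_def derivation_on_0[OF der] derivation_on_1[OF der])
  moreover have "D (z v x) = (\<Sum>s\<in>S. D (l s) *\<^sub>R z s) x" for x
  proof -
    have "D (z v x) = D (\<Sum>s\<in>S. l s * z s x)" using fun_cong[OF l, of x] by simp
    also have "\<dots> = (\<Sum>s\<in>S. D (l s * z s x))"
      by (rule derivation_on_sum[OF der, THEN conjunct2]) simp
    also have "\<dots> = (\<Sum>s\<in>S. D (l s) * z s x)"
      using Dz by (intro sum.cong) (auto simp: derivation_on_mult[OF der])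
    finally show ?thesis by simp
  qed
  ultimately have eq: "dz D v = (\<Sum>s\<in>S. D (l s) *\<^sub>R z s)" by (simp add: fun_eq_iff)
  have "dz D v \<in> span (z ` S)" unfolding eq by (intro span_sum span_scale span_base) auto
  moreover have "dz D v (2, 0) = 0" by (simp add: dz_def)
  ultimately show ?thesis by (simp add: Dbar_def)
qed

text \<open>The cost of a vertex counts the equations it contributes when a derivation that fixes the
  directions is forced to vanish vertex by vertex; a total over all vertices is at least \<open>n * d\<close>.\<close>
definition cost :: "nat \<Rightarrow> nat set \<Rightarrow> int \<Rightarrow> bool" where
  "cost v P c \<longleftrightarrow> (\<exists>Y. finite Y \<and> int (card Y) \<le> c \<and>
     (\<forall>D. fixes_dirs D \<longrightarrow> (\<forall>s\<in>P. fixes_pt D s) \<longrightarrow> (\<forall>y\<in>Y. D y = 0) \<longrightarrow> fixes_pt D v))"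

lemma cost_mono: "cost v P c \<Longrightarrow> c \<le> c' \<Longrightarrow> cost v P c'"
  unfolding cost_def by (meson order_trans)

text \<open>The unknowns are the \<open>d\<close> values \<open>D (p v j)\<close> and the
  \<open>k\<close> values \<open>D (g i v)\<close>. Each \<open>w\<close> in \<open>W\<close> is a
  linear equation for them, and these equations stay independent because the normalisation of
  \<open>b\<close> on \<open>I\<close> makes the translation \<open>\<beta>\<close> injective on the
  space containing \<open>W\<close>. What remains free is a set of coordinates, and these are the
  reals to be killed.\<close>

lemma cost_step:
  assumes W: "independent W" "W \<subseteq> supp_in (pairidx I)"
    and ann: "\<And>D w. fixes_dirs D \<Longrightarrow> \<forall>s\<in>P. fixes_pt D s \<Longrightarrow> w \<in> W \<Longrightarrow> hyp I w (dz D v) = 0"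
  shows "cost v P (int d + int k - int (card W))"
proof -
  define A where "A = {0::nat} \<times> {..<d} \<union> {1} \<times> I"
  have fA: "finite A" using finite_I by (simp add: A_def)
  have "card A = card ({0::nat} \<times> {..<d}) + card ({1::nat} \<times> I)"
    unfolding A_def using finite_I by (intro card_Un_disjoint) auto
  then have cA: "card A = d + k" by (simp add: card_cartesian_product)
  have sumA: "(\<Sum>x\<in>A. h x) = (\<Sum>j<d. h (0, j)) + (\<Sum>i\<in>I. h (1, i))" for h :: "nat \<times> nat \<Rightarrow> real"
  proof -
    have "(\<Sum>x\<in>A. h x) = (\<Sum>x\<in>{0} \<times> {..<d}. h x) + (\<Sum>x\<in>{1} \<times> I. h x)"
      unfolding A_def using finite_I by (intro sum.union_disjoint) auto
    then show ?thesis by (simp add: sum.cartesian_product')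
  qed
  define \<beta> :: "(nat \<times> nat \<Rightarrow> real) \<Rightarrow> nat \<times> nat \<Rightarrow> real" where "\<beta> w = (\<lambda>(a, j). if a = 0 \<and> j < d then \<Sum>i\<in>I. w (1, i) * b i j
     else if a = 1 \<and> j \<in> I then w (0, j) else 0)" for w
  have lin: "linear \<beta>"
    by (rule linearI) (auto simp: \<beta>_def fun_eq_iff algebra_simps sum.distrib sum_distrib_left)
  have coords: "\<beta> w (1, i) = w (0, i)" "\<beta> w (0, i) = w (1, i)" if i: "i \<in> I" for w i
  proof -
    have "(\<Sum>l\<in>I. w (1, l) * b l i) = (\<Sum>l\<in>I. if l = i then w (1, l) else 0)"
      using b_unit i by (intro sum.cong) auto
    then show "\<beta> w (0, i) = w (1, i)" using i I_sub finite_I by (auto simp: \<beta>_def)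
    show "\<beta> w (1, i) = w (0, i)" using i by (simp add: \<beta>_def)
  qed
  have inj: "inj_on \<beta> (supp_in (pairidx I))"
  proof (rule inj_onI)
    fix w w' assume w: "w \<in> supp_in (pairidx I)" "w' \<in> supp_in (pairidx I)" and eq: "\<beta> w = \<beta> w'"
    have "w (0, i) = w' (0, i)" "w (1, i) = w' (1, i)" if "i \<in> I" for i
      using coords[OF that, of w] coords[OF that, of w'] eq by simp_all
    then have "w x = w' x" for x
      using supp_inD[OF w(1), of x] supp_inD[OF w(2), of x]
      by (cases "x \<in> pairidx I") (auto simp: pairidx_def)
    then show "w = w'" by blast
  qed
  have "span W \<subseteq> supp_in (pairidx I)" using W(2) by (rule span_minimal[OF _ subspace_supp_in])
  then have injW: "inj_on \<beta> (span W)" using inj inj_on_subset by blast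
  have ind: "independent (\<beta> ` W)" using linear_independent_injective_image[OF lin W(1) injW] .
  have "card (\<beta> ` W) = card W"
    by (rule card_image[OF inj_on_subset[OF injW span_superset]])
  moreover have "\<beta> ` W \<subseteq> supp_in A" by (auto simp: \<beta>_def supp_in_def A_def)
  ultimately obtain J where J: "J \<subseteq> A" "card J + card W = d + k"
    "\<And>c. (\<forall>w\<in>\<beta> ` W. ip A w c = 0) \<Longrightarrow> (\<forall>j\<in>J. c j = 0) \<Longrightarrow> (\<forall>a\<in>A. c a = 0)"
    using complete_by_coordinates[OF fA ind] cA by auto
  define val where "val = (\<lambda>(a, j). if a = (0::nat) then p v j else g j v)"
  have fJ: "finite J" using J(1) fA finite_subset by blast
  have "fixes_pt D v" if D: "fixes_dirs D" and P: "\<forall>s\<in>P. fixes_pt D s" and Y: "\<forall>y\<in>val ` J. D y = 0" for D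
  proof -
    have "\<forall>a\<in>A. D (val a) = 0"
    proof (rule J(3))
      show "\<forall>j\<in>J. D (val j) = 0" using Y by blast
      show "\<forall>w\<in>\<beta> ` W. ip A w (\<lambda>a. D (val a)) = 0"
      proof clarify
        fix w assume w: "w \<in> W"
        have "ip A (\<beta> w) (\<lambda>a. D (val a)) = (\<Sum>j<d. (\<Sum>i\<in>I. w (1, i) * b i j) * D (p v j)) + (\<Sum>i\<in>I. w (0, i) * D (g i v))"
          unfolding ip_def sumA by (simp add: \<beta>_def val_def)
        also have "(\<Sum>j<d. (\<Sum>i\<in>I. w (1, i) * b i j) * D (p v j)) = (\<Sum>i\<in>I. w (1, i) * D (ybar d p b v i))"
          by (simp add: D_ybar[OF D] sum_distrib_left sum_distrib_right mult.assoc) (rule sum.swap)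
        finally have "ip A (\<beta> w) (\<lambda>a. D (val a)) = hyp I w (dz D v)"
          by (simp add: hyp_def dz_def sum.distrib)
        then show "ip A (\<beta> w) (\<lambda>a. D (val a)) = 0" using ann[OF D P w] by simp
      qed
    qed
    then have "D (val (0, j)) = 0" if "j < d" for j using that by (auto simp: A_def)
    moreover have "D (val (1, i)) = 0" if "i \<in> I" for i
      using that \<open>\<forall>a\<in>A. D (val a) = 0\<close> by (auto simp: A_def)
    ultimately show ?thesis by (simp add: fixes_pt_def val_def)
  qed
  moreover have "int (card (val ` J)) \<le> int d + int k - int (card W)"
    using card_image_le[OF fJ, of val] J(2) by linarith
  ultimately show ?thesis unfolding cost_def using fJ by blast
qed

end

lemma independent_Un_disjoint:
  fixes A B :: "'b::real_vector set"
  assumes "independent A" "independent B" "finite B"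
    and "\<And>x. x \<in> span A \<Longrightarrow> x \<in> span B \<Longrightarrow> x = 0"
  shows "independent (A \<union> B) \<and> A \<inter> B = {}"
  using assms(3,2,4)
proof (induction B rule: finite_induct)
  case empty
  then show ?case using assms(1) by simp
next
  case (insert y B)
  have yB: "y \<notin> span B" "independent B" using insert.prems(1) insert.hyps(2) independent_insert[of y B] by auto
  have "span B \<subseteq> span (insert y B)" by (rule span_mono) auto
  then have IH: "independent (A \<union> B)" "A \<inter> B = {}" using insert.IH[OF yB(2)] insert.prems(2) by blast+
  have "y \<notin> span (A \<union> B)"
  proof
    assume "y \<in> span (A \<union> B)"
    then obtain x w where xw: "y = x + w" "x \<in> span A" "w \<in> span B" unfolding span_Un by blast
    have "y - w \<in> span (insert y B)"
      using xw(3) \<open>span B \<subseteq> span (insert y B)\<close> by (intro span_diff) (auto intro: span_base)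
    then have "x \<in> span (insert y B)" using xw(1) by simp
    then have "x = 0" using insert.prems(2) xw(2) by blast
    then show False using xw yB(1) by simp
  qed
  moreover from this have "y \<notin> A" using span_superset[of "A \<union> B"] by blast
  ultimately show ?case using IH independent_insertI[of y "A \<union> B"] by auto
qed

context frame
begin

section \<open>The rank function of the vectors z\<close>

definition fullrank :: "nat set \<Rightarrow> bool" where
  "fullrank S \<longleftrightarrow> rho S = card S"

lemma rho_empty: "rho {} = 0"
  using dim_le_card[of "z ` {}" "{}"] by (simp add: rho_def)

lemma rho_mono: "S \<subseteq> T \<Longrightarrow> finite T \<Longrightarrow> rho S \<le> rho T"
  unfolding rho_def by (rule dim_mono_fin[of _ _ "z ` T"]) (auto intro: span_base)

lemma rho_insert_span: "finite S \<Longrightarrow> z v \<in> span (z ` S) \<Longrightarrow> rho (insert v S) = rho S"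
  unfolding rho_def by (rule span_eq_dim) (simp add: span_redundant)

lemma rho_insert_notin_span:
  assumes "finite S" "z v \<notin> span (z ` S)"
  shows "rho (insert v S) = rho S + 1"
proof -
  obtain K where K: "K \<subseteq> z ` S" "independent K" "z ` S \<subseteq> span K" "card K = dim (z ` S)"
    using basis_exists[of "z ` S"] by metis
  have fK: "finite K" using K(1) assms(1) finite_subset by blast
  have "span K \<subseteq> span (z ` S)" using K(1) by (rule span_mono)
  then have v: "z v \<notin> span K" using assms(2) by blast
  then have "z v \<notin> K" using span_base by blast
  then have "card (insert (z v) K) = rho S + 1" using fK K(4) by (simp add: rho_def)
  moreover have "dim (z ` insert v S) = card (insert (z v) K)"
  proof (rule dim_unique[OF _ _ independent_insertI[OF v K(2)] refl])
    show "insert (z v) K \<subseteq> z ` insert v S" using K(1) by auto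
    show "z ` insert v S \<subseteq> span (insert (z v) K)"
      using K(3) span_mono[of K "insert (z v) K"] by (auto intro: span_base)
  qed
  ultimately show ?thesis by (simp add: rho_def)
qed

lemma rho_insert_le: "finite S \<Longrightarrow> rho (insert v S) \<le> rho S + 1"
  using rho_insert_span[of S v] rho_insert_notin_span[of S v] by (cases "z v \<in> span (z ` S)") auto

lemma rho_submodular: "finite S \<Longrightarrow> finite T \<Longrightarrow> C \<subseteq> S \<Longrightarrow> C \<subseteq> T \<Longrightarrow> rho (S \<union> T) + rho C \<le> rho S + rho T"
  unfolding rho_def image_Un by (rule dim_submodular) auto

lemma rho_le_card: "finite S \<Longrightarrow> rho S \<le> card S"
  by (induction S rule: finite_induct) (auto simp: rho_empty intro: order_trans[OF rho_insert_le])

lemma rho_Un_le: "finite S \<Longrightarrow> finite T \<Longrightarrow> rho (S \<union> T) \<le> rho S + card T"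
  using rho_submodular[of S T "{}"] rho_le_card[of T] by (simp add: rho_empty)

lemma fullrank_subset: "fullrank X \<Longrightarrow> finite X \<Longrightarrow> S \<subseteq> X \<Longrightarrow> fullrank S"
proof -
  assume X: "fullrank X" "finite X" "S \<subseteq> X"
  have fS: "finite S" using X finite_subset by blast
  have "card X \<le> rho S + card (X - S)"
    using rho_Un_le[of S "X - S"] X fS by (simp add: fullrank_def Un_absorb1)
  moreover have "card X = card S + card (X - S)"
    using X fS card_Diff_subset[of S X] card_mono[of X S] by simp
  ultimately show ?thesis using rho_le_card[OF fS] by (simp add: fullrank_def)
qed

text \<open>The lifted points are independent, and each is determined linearly by \<open>z s\<close>
  and the \<open>d - k\<close> coordinates of \<open>p s\<close> outside \<open>I\<close>; so
  passing to the \<open>z s\<close> loses at most \<open>d - k\<close> dimensions.\<close>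

lemma general_position:
  assumes S: "S \<subseteq> V" "card S \<le> Suc d"
  shows "card S + k \<le> rho S + d"
proof -
  have fS: "finite S" using S(1) finite_subset by blast
  let ?L = "(\<lambda>s. lift d (p s)) ` S"
  have ind: "inj_on (\<lambda>s. lift d (p s)) S" "independent ?L"
    using generic_lift_independent[OF gen S] by auto
  obtain K where K: "K \<subseteq> z ` S" "independent K" "z ` S \<subseteq> span K" "card K = dim (z ` S)"
    using basis_exists[of "z ` S"] by metis
  have fK: "finite K" using K(1) fS finite_subset by blast
  define \<Psi> :: "(nat \<times> nat \<Rightarrow> real) \<Rightarrow> nat \<Rightarrow> real" where
    "\<Psi> w = (\<lambda>j. if j \<in> I then w (0, j) else if j = d then w (2, 0) else 0)" for w
  have lin: "linear \<Psi>" by (rule linearI) (auto simp: \<Psi>_def fun_eq_iff)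
  \<comment> \<open>By the normalisation, \<open>ybar\<close> gives the coordinates in
    \<open>I\<close> up to a combination of the coordinates outside \<open>I\<close>; the vector
    \<open>e j\<close> carries the correction for coordinate \<open>j\<close>.\<close>
  define e :: "nat \<Rightarrow> nat \<Rightarrow> real" where
    "e j = (\<lambda>i. if i = j then 1 else if i \<in> I then - b i j else 0)" for j
  let ?C = "e ` ({..<d} - I)"
  have dI: "d \<notin> I" using I_sub by auto
  have decomp: "lift d (p s) = \<Psi> (z s) + (\<Sum>j\<in>{..<d} - I. p s j *\<^sub>R e j)" for s
  proof
    fix i
    show "lift d (p s) i = (\<Psi> (z s) + (\<Sum>j\<in>{..<d} - I. p s j *\<^sub>R e j)) i"
    proof (cases "i \<in> I")
      case True
      have split: "{..<d} = I \<union> ({..<d} - I)" using I_sub by auto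
      have "(\<Sum>j<d. b i j * p s j) = (\<Sum>j\<in>I. b i j * p s j) + (\<Sum>j\<in>{..<d} - I. b i j * p s j)"
        by (subst split, rule sum.union_disjoint) (use finite_I in auto)
      also have "(\<Sum>j\<in>I. b i j * p s j) = (\<Sum>j\<in>I. if j = i then p s j else 0)"
        using True b_unit by (intro sum.cong) auto
      also have "\<dots> = p s i" using True finite_I by simp
      finally have "ybar d p b s i = p s i + (\<Sum>j\<in>{..<d} - I. b i j * p s j)" by (simp add: ybar_def)
      moreover have "(\<Sum>j\<in>{..<d} - I. p s j * e j i) = - (\<Sum>j\<in>{..<d} - I. b i j * p s j)"
        unfolding sum_negf[symmetric] using True by (intro sum.cong) (auto simp: e_def)
      ultimately show ?thesis using True I_sub by (auto simp: lift_def \<Psi>_def zlift_def)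
    next
      case False
      have "(\<Sum>j\<in>{..<d} - I. p s j * e j i) = (\<Sum>j\<in>{..<d} - I. if j = i then p s j else 0)"
        using False by (intro sum.cong) (auto simp: e_def)
      then show ?thesis using False dI z_last[of s] by (auto simp: lift_def \<Psi>_def)
    qed
  qed
  have "?L \<subseteq> span (\<Psi> ` K \<union> ?C)"
  proof clarify
    fix s assume s: "s \<in> S"
    have "z s \<in> span K" using K(3) s by blast
    then have "\<Psi> (z s) \<in> span (\<Psi> ` K)" using linear_span_image[OF lin, of K] by blast
    then have "\<Psi> (z s) \<in> span (\<Psi> ` K \<union> ?C)" by (rule rev_subsetD[OF _ span_mono]) auto
    moreover have "(\<Sum>j\<in>{..<d} - I. p s j *\<^sub>R e j) \<in> span (\<Psi> ` K \<union> ?C)"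
      by (intro span_sum span_scale span_base) auto
    ultimately show "lift d (p s) \<in> span (\<Psi> ` K \<union> ?C)" unfolding decomp[of s] by (rule span_add)
  qed
  then have "card ?L \<le> card (\<Psi> ` K \<union> ?C)"
    using independent_span_bound[OF _ ind(2)] fK by auto
  also have "\<dots> \<le> card (\<Psi> ` K) + card ?C" by (rule card_Un_le)
  also have "\<dots> \<le> card K + card ({..<d} - I)"
    using fK by (intro add_mono card_image_le) auto
  also have "card ({..<d} - I) = d - k" using I_sub finite_I by (simp add: card_Diff_subset)
  finally have "card S \<le> rho S + (d - k)" using K(4) ind(1) by (simp add: card_image rho_def)
  moreover have "k \<le> d" using card_mono[OF _ I_sub] by simp
  ultimately show ?thesis by simp
qed

section \<open>Upper bounds for the cost of a vertex\<close>

lemma hyp_edge_fixed: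
  assumes "fixes_dirs D" "fixes_pt D s" "v < n" "s \<in> N v"
  shows "hyp I (z s - z v) (dz D v) = 0"
proof -
  have "hyp I (z s - z v) (- dz D v) = 0"
    using dz_edge[OF assms(1,3,4)] dz_fixed[OF assms(1,2)] by simp
  moreover have "hyp I (z s - z v) (- dz D v) = - hyp I (z s - z v) (dz D v)"
    unfolding hyp_def sum_negf[symmetric] by (rule sum.cong) (auto simp: algebra_simps)
  ultimately show ?thesis by simp
qed

text \<open>A combination with coefficient sum 0 is a combination of the differences
  \<open>z s - z v\<close>, and each of these gives the equation of an edge with one fixed
  end.\<close>

lemma hyp_Dbar_fixed:
  assumes D: "fixes_dirs D" and v: "v < n" and S: "finite S" "S \<subseteq> N v" "\<And>s. s \<in> S \<Longrightarrow> fixes_pt D s"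
    and w: "w \<in> Dbar (insert v S)"
  shows "hyp I w (dz D v) = 0"
proof -
  have "w \<in> span (z ` insert v S)" using w by (simp add: Dbar_def)
  then obtain l where l: "w = (\<Sum>s\<in>insert v S. l s *\<^sub>R z s)"
    using span_image_sum[of "insert v S" w z] S(1) by auto
  have "(\<Sum>s\<in>insert v S. l s) = 0" using fun_cong[OF l, of "(2, 0)"] w by (simp add: z_last Dbar_def)
  then have "(\<Sum>s\<in>insert v S. l s *\<^sub>R z v) = 0" by (simp only: scaleR_sum_left[symmetric]) simp
  then have "w = (\<Sum>s\<in>insert v S. l s *\<^sub>R (z s - z v))"
    using l by (simp only: scaleR_diff_right sum_subtractf) simp
  moreover have "hyp I (l s *\<^sub>R (z s - z v)) (dz D v) = 0" if "s \<in> insert v S" for s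
  proof (cases "s = v")
    case False
    then show ?thesis using that S hyp_edge_fixed[OF D _ v, of s] by (auto simp: hyp_scale_left)
  qed (simp add: hyp_scale_left hyp_zero_left)
  ultimately show ?thesis by (simp only: hyp_sum_left) simp
qed

lemma finite_nbrs: "v < n \<Longrightarrow> S \<subseteq> N v \<Longrightarrow> finite S \<and> S \<subseteq> V"
proof -
  assume "v < n" "S \<subseteq> N v"
  then have "S \<subseteq> V" using nbr by fastforce
  then show ?thesis using finite_subset by blast
qed

text \<open>Fixed neighbours give one equation for each dimension of
  \<open>Dbar (insert v S)\<close>, that is \<open>rho (insert v S) - 1\<close> equations.\<close>

lemma cost_base:
  assumes v: "v < n" and S: "S \<subseteq> N v" "S \<subseteq> P"
  shows "cost v P (int d + int k + 1 - int (rho (insert v S)))"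
proof -
  have fS: "finite S" using finite_nbrs[OF v S(1)] by blast
  have fvS: "finite (insert v S)" using fS by simp
  obtain W where W: "finite W" "independent W" "W \<subseteq> Dbar (insert v S)" "Dbar (insert v S) \<subseteq> span W"
      "card W + 1 = rho (insert v S)"
    by (rule Dbar_basis[OF fvS insertI1])
  have "cost v P (int d + int k - int (card W))"
  proof (rule cost_step[OF W(2)])
    show "W \<subseteq> supp_in (pairidx I)" using W(3) Dbar_supp by (rule order_trans)
    show "hyp I w (dz D v) = 0" if "fixes_dirs D" "\<forall>s\<in>P. fixes_pt D s" "w \<in> W" for D w
      using that W(3) S by (intro hyp_Dbar_fixed[OF _ v fS S(1)]) auto
  qed
  then show ?thesis by (rule cost_mono) (use W(5) in linarith)
qed

lemma span_full: "X \<subseteq> V \<Longrightarrow> rho X = rho V \<Longrightarrow> z ` V \<subseteq> span (z ` X)"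
  unfolding rho_def by (rule dim_eq_imp_span[of _ _ "z ` V"]) (auto intro: span_base)

text \<open>Once a spanning set \<open>X\<close> is fixed, \<open>dz D v\<close> lies in
  \<open>Dbar V\<close> and so satisfies the equations of the orthogonal complement of
  \<open>Dbar V\<close> too, at least \<open>2 * k + 1 - rho V\<close> of them. They are independent
  of the edge equations, since a common vector would lie in the radical of \<open>Dbar V\<close>,
  which is zero by minimality.\<close>

lemma cost_outside_basis:
  assumes v: "v < n" and S: "S \<subseteq> N v" "S \<subseteq> P" and X: "X \<subseteq> V" "X \<subseteq> P" "rho X = rho V"
  shows "cost v P (int d + int k + 1 - int (rho (insert v S)) - (2 * int k + 1 - int (rho V)))"
proof -
  have fS: "finite S" "S \<subseteq> V" using finite_nbrs[OF v S(1)] by blast+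
  have fX: "finite X" using X(1) finite_subset by blast
  have fvS: "finite (insert v S)" using fS by simp
  obtain W where W: "finite W" "independent W" "W \<subseteq> Dbar (insert v S)" "Dbar (insert v S) \<subseteq> span W"
      "card W + 1 = rho (insert v S)"
    by (rule Dbar_basis[OF fvS insertI1])
  have vV: "v \<in> V" using v by simp
  obtain U where U: "finite U" "independent U" "U \<subseteq> Dbar V" "Dbar V \<subseteq> span U" "card U + 1 = rho V"
    by (rule Dbar_basis[OF finite_atLeastLessThan vV])
  obtain Q where Q: "finite Q" "independent Q" "Q \<subseteq> supp_in (pairidx I)"
    "\<And>w u. w \<in> span Q \<Longrightarrow> u \<in> span U \<Longrightarrow> hyp I w u = 0" "2 * k \<le> card Q + card U"
    using orthogonal_complement[OF U(1)] by metis
  have "span (z ` insert v S) \<subseteq> span (z ` V)" using fS v by (intro span_mono) auto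
  then have WV: "W \<subseteq> Dbar V" using W(3) Dbar_mono by blast
  have "x = 0" if "x \<in> span W" "x \<in> span Q" for x
  proof (rule hyp_nondegenerate)
    have "span W \<subseteq> Dbar V" using WV by (rule span_minimal[OF _ subspace_Dbar])
    then have x: "x \<in> Dbar V" using that by blast
    then show "x \<in> supp_in (pairidx I)" using Dbar_supp by blast
    show "hyp I x u = 0" if "u \<in> Dbar V" for u using Q(4) U(4) that \<open>x \<in> span Q\<close> by blast
    then show "hyp I x x = 0" using x by blast
  qed
  then have WQ: "independent (W \<union> Q)" "W \<inter> Q = {}"
    using independent_Un_disjoint[OF W(2) Q(2,1)] by blast+
  have "cost v P (int d + int k - int (card (W \<union> Q)))"
  proof (rule cost_step[OF WQ(1)])
    show "W \<union> Q \<subseteq> supp_in (pairidx I)" using order_trans[OF W(3) Dbar_supp] Q(3) by simp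
    show "hyp I w (dz D v) = 0" if D: "fixes_dirs D" "\<forall>s\<in>P. fixes_pt D s" and w: "w \<in> W \<union> Q" for D w
    proof (cases "w \<in> W")
      case True
      then show ?thesis using D W(3) S by (intro hyp_Dbar_fixed[OF _ v fS(1) S(1)]) auto
    next
      case False
      have "z v \<in> span (z ` X)" using span_full[OF X(1,3)] v by auto
      then have "dz D v \<in> Dbar X" using D X(2) by (intro dz_span[OF _ fX]) auto
      then have "dz D v \<in> Dbar V" using Dbar_mono[OF span_mono[OF image_mono[OF X(1)]]] by blast
      moreover have "w \<in> span Q" using w False by (auto intro: span_base)
      ultimately show ?thesis using Q(4) U(4) by blast
    qed
  qed
  moreover have "card (W \<union> Q) = card W + card Q" using W(1) Q(1) WQ(2) by (rule card_Un_disjoint)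
  ultimately show ?thesis
    by (elim cost_mono) (use W(5) U(5) Q(5) in linarith)
qed

text \<open>Isotropic differences mean vanishing strain, so \<open>v\<close> with its neighbours is
  a cluster; the degree bound gives each outside vertex \<open>d\<close> neighbours in it, and
  \<open>rigid_cluster\<close> makes the motion trivial.\<close>

lemma no_isotropic_star:
  assumes v: "v < n"
    and iso: "\<And>x y. x \<in> insert v (N v) \<Longrightarrow> y \<in> insert v (N v) \<Longrightarrow> hyp I (z x - z y) (z x - z y) = 0"
  shows False
proof -
  let ?K = "insert v (N v)"
  have fN: "finite (N v)" "N v \<subseteq> V" using finite_nbrs[OF v] by blast+
  have vN: "v \<notin> N v" using nbr[OF v] by blast
  have K: "?K \<subseteq> V" "card ?K = card (N v) + 1" using fN v vN by auto
  have "trivial_motion n d p m"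
  proof (rule rigid_cluster[OF gen K(1)])
    show "Suc d \<le> card ?K" using deg[OF v] dn K(2) by linarith
    show "strain d p m s t = 0" if "s \<in> ?K" "t \<in> ?K" for s t
    proof -
      have "s < n" "t < n" using that K(1) by auto
      then show ?thesis using strain_hyp[of s t] iso[OF that] by simp
    qed
    show "d \<le> card {s \<in> ?K. strain d p m x s = 0}" if x: "x < n" "x \<notin> ?K" for x
    proof -
      have fx: "finite (N x)" "N x \<subseteq> V" "x \<notin> N x" using finite_nbrs[OF x(1)] nbr[OF x(1)] by blast+
      \<comment> \<open>Outside the star and apart from \<open>x\<close> itself only
        \<open>n - card (N v) - 2\<close> vertices remain, which by the two degree bounds leaves at
        least \<open>d\<close> neighbours of \<open>x\<close> inside the star.\<close>
      have "N x - ?K \<subseteq> V - insert x ?K" using fx by auto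
      then have "card (N x - ?K) \<le> card (V - insert x ?K)" by (intro card_mono) auto
      also have "\<dots> = n - (card (N v) + 2)"
        using K fN x by (subst card_Diff_subset) auto
      finally have 1: "card (N x - ?K) \<le> n - (card (N v) + 2)" .
      have "card (insert x ?K) \<le> card V" using K(1) x by (intro card_mono) auto
      then have 2: "card (N v) + 2 \<le> n" using K fN x by simp
      have "card (N x) = card (N x \<inter> ?K) + card (N x - ?K)"
        using fx(1) card_Int_Diff by blast
      then have "d \<le> card (N x \<inter> ?K)" using 1 2 deg[OF x(1)] deg[OF v] by linarith
      also have "\<dots> \<le> card {s \<in> ?K. strain d p m x s = 0}"
        using fN nbr[OF x(1)] strain_commute by (intro card_mono) auto
      finally show ?thesis .
    qed
  qed
  then show False using nontrivial by blast
qed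

text \<open>Gains one equation over \<open>cost_base\<close> if \<open>z v\<close> depends on its
  earlier neighbours. Then \<open>dz D v\<close> lies in \<open>Dbar S\<close> besides being
  orthogonal to it, so a vector of the orthogonal complement outside \<open>Dbar S\<close> supplies
  a further equation. If there is no such vector, \<open>Dbar S\<close> is its own orthogonal
  complement, all of \<open>N v\<close> lies in the span, and the star of \<open>v\<close> is
  totally isotropic.\<close>

lemma cost_improved:
  assumes v: "v < n" and S: "S \<subseteq> N v" "S \<subseteq> P" and V: "rho V = 2 * k + 1" and Nv: "rho (N v) = k + 1"
  shows "cost v P (int d + int k - int (rho S))"
proof (cases "z v \<in> span (z ` S)")
  case False
  have fS: "finite S" "S \<subseteq> V" using finite_nbrs[OF v S(1)] by blast+
  show ?thesis by (rule cost_mono[OF cost_base[OF v S]]) (use rho_insert_notin_span[OF fS(1) False] in simp)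
next
  case True
  have fS: "finite S" "S \<subseteq> V" using finite_nbrs[OF v S(1)] by blast+
  have "S \<noteq> {}"
  proof
    assume "S = {}"
    then have "z v = 0" using True by simp
    then show False using z_last[of v] by simp
  qed
  then obtain t where t: "t \<in> S" by blast
  obtain W where W: "finite W" "independent W" "W \<subseteq> Dbar S" "Dbar S \<subseteq> span W" "card W + 1 = rho S"
    using Dbar_basis[OF fS(1) t] by metis
  obtain Q where Q: "finite Q" "independent Q" "Q \<subseteq> supp_in (pairidx I)"
    "\<And>w u. w \<in> span Q \<Longrightarrow> u \<in> span W \<Longrightarrow> hyp I w u = 0" "2 * k \<le> card Q + card W"
    using orthogonal_complement[OF W(1)] by metis
  have spanv: "span (z ` insert v S) = span (z ` S)" using True by (simp add: span_redundant)
  show ?thesis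
  proof (cases "Q \<subseteq> span W")
    case False
    then obtain w0 where w0: "w0 \<in> Q" "w0 \<notin> span W" by blast
    have "cost v P (int d + int k - int (card (insert w0 W)))"
    proof (rule cost_step)
      show "independent (insert w0 W)" using w0(2) W(2) by (rule independent_insertI)
      show "insert w0 W \<subseteq> supp_in (pairidx I)" using order_trans[OF W(3) Dbar_supp] Q(3) w0(1) by blast
      show "hyp I w (dz D v) = 0" if D: "fixes_dirs D" "\<forall>s\<in>P. fixes_pt D s" and w: "w \<in> insert w0 W" for D w
      proof (cases "w = w0")
        case True
        have "dz D v \<in> Dbar S" using D S(2) \<open>z v \<in> span (z ` S)\<close> by (intro dz_span[OF _ fS(1)]) auto
        then show ?thesis using Q(4)[of w0 "dz D v"] w0(1) W(4) True span_base by blast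
      next
        case False
        then have "w \<in> Dbar S" using w W(3) by blast
        then have "w \<in> Dbar (insert v S)" using Dbar_mono[of S "insert v S"] spanv by blast
        then show ?thesis using D S by (intro hyp_Dbar_fixed[OF _ v fS(1) S(1)]) auto
      qed
    qed
    moreover have "w0 \<notin> W" using w0(2) span_base by blast
    ultimately show ?thesis using W(1,5) by (elim cost_mono) simp
  next
    case Qsub: True
    \<comment> \<open>The complement has dimension at least \<open>2 * k - card W\<close>, so its
      containment in \<open>span W\<close> forces \<open>card W \<ge> k\<close>, whereas the rank
      \<open>k + 1\<close> of \<open>N v\<close> allows at most \<open>k\<close>.\<close>
    have "card Q \<le> card W" using independent_span_bound[OF W(1) Q(2) Qsub] by simp
    moreover have rS: "rho S \<le> k + 1" using rho_mono[OF S(1)] finite_nbrs[OF v] Nv by auto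
    ultimately have "card W = card Q" "rho S = k + 1" using W(5) Q(5) by linarith+
    have "W \<subseteq> span Q"
    proof (rule dim_eq_imp_span[OF Qsub _ W(1)])
      show "W \<subseteq> span W" by (rule span_superset)
      show "dim W \<le> dim Q"
        using dim_eq_card_independent[OF W(2)] dim_eq_card_independent[OF Q(2)] \<open>card W = card Q\<close> by simp
    qed
    then have WQ: "span W \<subseteq> span Q" by (rule span_minimal[OF _ subspace_span])
    have zN: "z ` N v \<subseteq> span (z ` S)"
    proof (rule dim_eq_imp_span)
      show "z ` S \<subseteq> span (z ` N v)" using image_mono[OF S(1)] span_superset by (rule order_trans)
      show "z ` N v \<subseteq> span (z ` N v)" by (rule span_superset)
      show "finite (z ` N v)" using finite_nbrs[OF v order_refl] by simp
      show "dim (z ` N v) \<le> dim (z ` S)" using \<open>rho S = k + 1\<close> Nv by (simp add: rho_def)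
    qed
    have "hyp I (z x - z y) (z x - z y) = 0" if "x \<in> insert v (N v)" "y \<in> insert v (N v)" for x y
    proof -
      have "z x \<in> span (z ` S)" "z y \<in> span (z ` S)" using that zN True by auto
      then have "z x - z y \<in> Dbar S" by (simp add: Dbar_def span_diff z_last)
      then show ?thesis using Q(4) W(4) WQ by blast
    qed
    then show ?thesis using no_isotropic_star[OF v] by blast
  qed
qed

section \<open>Summation along a vertex ordering\<close>

lemma count_lower:
  assumes pos: "inj_on pos V" and A: "A \<subseteq> V" "\<And>v w. v \<in> A \<Longrightarrow> w \<in> V \<Longrightarrow> pos w < pos v \<Longrightarrow> w \<in> A"
    and cost: "\<And>v. v < n \<Longrightarrow> cost v {w \<in> V. pos w < (pos v :: nat)} (c v)"
  shows "\<exists>Y. finite Y \<and> int (card Y) \<le> (\<Sum>v\<in>A. c v) \<and>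
    (\<forall>D. fixes_dirs D \<longrightarrow> (\<forall>y\<in>Y. D y = 0) \<longrightarrow> (\<forall>v\<in>A. fixes_pt D v))"
proof -
  have "finite A" using A(1) finite_subset by blast
  then show ?thesis using A
  proof (induction "card A" arbitrary: A)
    case 0
    then show ?case by (intro exI[of _ "{}"]) auto
  next
    case (Suc q)
    then have ne: "A \<noteq> {}" by auto
    define v where "v = arg_max_on pos A"
    have v: "v \<in> A" "\<And>w. w \<in> A \<Longrightarrow> pos w \<le> pos v"
    proof -
      have "Max (pos ` A) \<in> pos ` A" using Suc.prems(1) ne by (intro Max_in) auto
      then obtain u where "u \<in> A" "pos u = Max (pos ` A)" by force
      then have "is_arg_max pos (\<lambda>x. x \<in> A) u"
        using Suc.prems(1) by (auto simp: is_arg_max_def not_less)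
      then have "is_arg_max pos (\<lambda>x. x \<in> A) v"
        unfolding v_def arg_max_on_def arg_max_def by (rule someI)
      then show "v \<in> A" "\<And>w. w \<in> A \<Longrightarrow> pos w \<le> pos v" by (auto simp: is_arg_max_def not_less)
    qed
    let ?B = "A - {v}"
    have lower: "w \<in> ?B" if "u \<in> ?B" "w \<in> V" "pos w < pos u" for u w
      using that Suc.prems(3)[of u w] v(2)[of u] by auto
    obtain Y where Y: "finite Y" "int (card Y) \<le> (\<Sum>v\<in>?B. c v)"
      "\<And>D. fixes_dirs D \<Longrightarrow> \<forall>y\<in>Y. D y = 0 \<Longrightarrow> \<forall>v\<in>?B. fixes_pt D v"
    proof -
      have "q = card ?B" using Suc.hyps(2) Suc.prems(1) v(1) by (simp add: card_Diff_singleton)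
      moreover have "finite ?B" "?B \<subseteq> V" using Suc.prems(1,2) by auto
      ultimately show ?thesis using Suc.hyps(1)[of ?B] lower that by blast
    qed
    have vn: "v < n" using v(1) Suc.prems(2) by auto
    obtain Z where Z: "finite Z" "int (card Z) \<le> c v"
      "\<And>D. fixes_dirs D \<Longrightarrow> \<forall>s\<in>{w \<in> V. pos w < pos v}. fixes_pt D s \<Longrightarrow> \<forall>y\<in>Z. D y = 0 \<Longrightarrow> fixes_pt D v"
      using cost[OF vn] unfolding cost_def by blast
    have before: "{w \<in> V. pos w < pos v} \<subseteq> ?B" using Suc.prems(3)[OF v(1)] by auto
    show ?case
    proof (intro exI[of _ "Y \<union> Z"] conjI allI impI ballI)
      show "finite (Y \<union> Z)" using Y Z by simp
      have "(\<Sum>v\<in>A. c v) = c v + (\<Sum>v\<in>?B. c v)" using Suc.prems(1) v(1) by (simp add: sum.remove)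
      then show "int (card (Y \<union> Z)) \<le> (\<Sum>v\<in>A. c v)" using card_Un_le[of Y Z] Y(2) Z(2) by linarith
      fix D u assume D: "fixes_dirs D" "\<forall>y\<in>Y \<union> Z. D y = 0" and u: "u \<in> A"
      have B: "\<forall>v\<in>?B. fixes_pt D v" using Y(3)[OF D(1)] D(2) by blast
      moreover have "fixes_pt D v" using Z(3)[OF D(1)] D(2) B before by blast
      ultimately show "fixes_pt D u" using u by blast
    qed
  qed
qed

text \<open>The directions cost the entries of \<open>b\<close> not prescribed by the normalisation,
  \<open>k * (d - k)\<close> in number, the dimension of a Grassmannian. Together with the reals
  charged to the vertices they force a derivation to kill all coordinates of \<open>p\<close>, so
  there are at least \<open>n * d\<close> of them.\<close>

lemma count:
  assumes pos: "inj_on pos V" and cost: "\<And>v. v < n \<Longrightarrow> cost v {w \<in> V. pos w < (pos v :: nat)} (c v)"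
  shows "int n * int d \<le> int k * (int d - int k) + (\<Sum>v\<in>V. c v)"
proof -
  obtain Y where Y: "finite Y" "int (card Y) \<le> (\<Sum>v\<in>V. c v)"
    "\<And>D. fixes_dirs D \<Longrightarrow> \<forall>y\<in>Y. D y = 0 \<Longrightarrow> \<forall>v\<in>V. fixes_pt D v"
    using count_lower[OF pos order_refl _ cost] by blast
  define B where "B = (\<lambda>(i, j). b i j) ` (I \<times> ({..<d} - I))"
  have kd: "k \<le> d" using card_mono[OF _ I_sub] by simp
  have fB: "finite B" using finite_I by (simp add: B_def)
  have "card B \<le> card (I \<times> ({..<d} - I))" unfolding B_def using finite_I by (intro card_image_le) auto
  also have "\<dots> = k * (d - k)" using I_sub finite_I by (simp add: card_cartesian_product card_Diff_subset)
  finally have cB: "card B \<le> k * (d - k)" .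
  have "n * d \<le> card (Y \<union> B)"
  proof (rule generic_derivation_vector(2)[OF gen])
    show "finite (Y \<union> B)" using Y fB by simp
    fix D assume D: "derivation D" "\<forall>y\<in>Y \<union> B. D y = 0"
    have "D (b i j) = 0" if "i \<in> I" "j < d" for i j
    proof (cases "j \<in> I")
      case True
      then show ?thesis using b_unit[OF that(1) True] derivation_on_0[OF D(1)] derivation_on_1[OF D(1)] by simp
    next
      case False
      then have "b i j \<in> B" using that unfolding B_def by force
      then show ?thesis using D(2) by blast
    qed
    then have "fixes_dirs D" using D(1) by (simp add: fixes_dirs_def)
    then have "\<forall>v\<in>V. fixes_pt D v" using Y(3) D(2) by blast
    then show "\<forall>v<n. \<forall>i<d. D (p v i) = 0" by (simp add: fixes_pt_def)
  qed
  then have "int (n * d) \<le> int (card Y) + int (card B)" using card_Un_le[of Y B] by linarith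
  moreover have "int (card B) \<le> int k * (int d - int k)"
  proof -
    have "int (card B) \<le> int (k * (d - k))" using cB by (simp only: of_nat_le_iff)
    also have "\<dots> = int k * (int d - int k)" using kd by (simp add: of_nat_diff)
    finally show ?thesis .
  qed
  ultimately show ?thesis using Y(2) by simp
qed

text \<open>The unit that is missing for a vertex outside the basis when
  \<open>cost_improved\<close> does not apply.\<close>

definition loss :: "nat \<Rightarrow> int" where
  "loss v = (if rho V = 2 * k + 1 \<and> rho (N v) = k + 1 then 0 else 1)"

text \<open>Basis vertices come first and use \<open>cost_base\<close>, where rank is cardinality. A
  later vertex uses \<open>cost_improved\<close> if \<open>loss v = 0\<close>, in which case the
  codimension term is 0; otherwise it uses \<open>cost_outside_basis\<close>, with
  \<open>rho (insert v S)\<close> bounded below by \<open>rho S\<close>.\<close>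

theorem ordered_count:
  assumes pos: "inj_on pos V" and X: "X \<subseteq> V" "fullrank X" "rho X = rho V"
    and first: "\<And>x v. x \<in> X \<Longrightarrow> v \<in> V - X \<Longrightarrow> pos x < (pos v :: nat)"
  shows "int n * int d \<le> int k * (int d - int k)
     + (\<Sum>x\<in>X. int d + int k - int (card {w \<in> N x \<inter> X. pos w < pos x}))
     + (\<Sum>v\<in>V - X. int d + int k - (2 * int k + 1 - int (rho V)) - int (rho {w \<in> N v. pos w < pos v}) + loss v)"
proof -
  define c where "c v = (if v \<in> X then int d + int k - int (card {w \<in> N v \<inter> X. pos w < pos v})
     else int d + int k - (2 * int k + 1 - int (rho V)) - int (rho {w \<in> N v. pos w < pos v}) + loss v)" for v
  have fX: "finite X" using X(1) finite_subset by blast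
  have "cost v {w \<in> V. pos w < pos v} (c v)" if v: "v < n" for v
  proof (cases "v \<in> X")
    case True
    let ?S = "{w \<in> N v \<inter> X. pos w < pos v}"
    have "?S \<subseteq> X" "v \<notin> ?S" using nbr[OF v] by auto
    then have "fullrank (insert v ?S)" using True by (intro fullrank_subset[OF X(2) fX]) auto
    then have "rho (insert v ?S) = card ?S + 1"
      using \<open>v \<notin> ?S\<close> finite_subset[OF \<open>?S \<subseteq> X\<close> fX] by (simp add: fullrank_def)
    moreover have "cost v {w \<in> V. pos w < pos v} (int d + int k + 1 - int (rho (insert v ?S)))"
      using X(1) by (intro cost_base[OF v]) auto
    ultimately show ?thesis using True by (elim cost_mono) (simp add: c_def)
  next
    case False
    let ?S = "{w \<in> N v. pos w < pos v}"
    have S: "?S \<subseteq> N v" "?S \<subseteq> {w \<in> V. pos w < pos v}" using nbr[OF v] by auto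
    show ?thesis
    proof (cases "rho V = 2 * k + 1 \<and> rho (N v) = k + 1")
      case True
      then show ?thesis using cost_improved[OF v S] False by (simp add: c_def loss_def)
    next
      case lossy: False
      have "X \<subseteq> {w \<in> V. pos w < pos v}" using X(1) first v False by auto
      from cost_outside_basis[OF v S X(1) this X(3)]
      have "cost v {w \<in> V. pos w < pos v}
          (int d + int k + 1 - int (rho (insert v ?S)) - (2 * int k + 1 - int (rho V)))" .
      moreover have "rho ?S \<le> rho (insert v ?S)"
        using finite_nbrs[OF v S(1)] by (intro rho_mono) auto
      ultimately show ?thesis using False lossy by (elim cost_mono) (auto simp: c_def loss_def)
    qed
  qed
  from count[OF pos this]
  have "int n * int d \<le> int k * (int d - int k) + (\<Sum>v\<in>V. c v)" .
  also have "(\<Sum>v\<in>V. c v) = (\<Sum>v\<in>X. c v) + (\<Sum>v\<in>V - X. c v)"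
    using X(1) by (subst sum.subset_diff[OF X(1)]) auto
  finally show ?thesis by (simp add: c_def)
qed

end

section \<open>Vertex orderings\<close>

lemma sum_card_swap:
  assumes "finite A" "finite B"
  shows "(\<Sum>a\<in>A. card {x \<in> B. P a x}) = (\<Sum>x\<in>B. card {a \<in> A. P a x})"
proof -
  have "(\<Sum>a\<in>A. card {x \<in> B. P a x}) = (\<Sum>a\<in>A. \<Sum>x\<in>B. if P a x then 1 else 0)"
    using assms by (intro sum.cong) (auto simp: sum.If_cases Int_def)
  also have "\<dots> = (\<Sum>x\<in>B. \<Sum>a\<in>A. if P a x then 1 else 0)" by (rule sum.swap)
  also have "\<dots> = (\<Sum>x\<in>B. card {a \<in> A. P a x})"
    using assms by (intro sum.cong) (auto simp: sum.If_cases Int_def)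
  finally show ?thesis .
qed

text \<open>In the application \<open>K\<close> is the number of fields, \<open>M\<close> the rank
  of all \<open>z v\<close>, \<open>c\<close> its deficiency, and \<open>L\<close> the sum of
  \<open>excess v - 2 * loss v\<close> outside the basis. For \<open>K \<le> 9\<close> the crude
  bounds on \<open>L\<close> suffice: \<open>c = 0\<close> leads to
  \<open>N \<le> 23 * D + 2\<close>, and \<open>c \<ge> 1\<close> to
  \<open>2 * N * c \<le> 30 * D * c\<close>. For larger \<open>K\<close> the bound \<open>L3\<close>
  grows with \<open>N * K\<close> and takes over.\<close>

lemma counting_contradiction:
  fixes N D K c L M :: int
  assumes K: "1 \<le> K" "K \<le> D" and c: "0 \<le> c" "c \<le> K" and N: "29 * D \<le> N" and M: "M = 2 * K + 1 - c"
    and main: "4 * N * D \<le> 4 * K * (D - K) + 4 * M * (D + K) + 4 * (N - M) * (D - K - 1 + M)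
       - M * (N + D - 2) - 2 * (N - M) * (K + 1) - 2 * L"
    and L1: "c = 0 \<Longrightarrow> - (N - M) \<le> L" and L2: "- 2 * (N - M) \<le> L"
    and L3: "10 \<le> K \<Longrightarrow> N * (M - K - 4) - 3 * (M * (M - K - 1)) - 6 * (N - M) \<le> 3 * L"
  shows False
proof -
  have main': "3 * (N * c) + 3 * N + 2 * L
      \<le> 2 * (K * D) + 6 * (K * c) + 10 * K + 4 - D - 4 * (c * c) + D * c"
    using main unfolding M by (simp add: algebra_simps)
  have D: "1 \<le> D" using K by simp
  have cc: "0 \<le> c * c" using c by simp
  have Kc: "K * c \<le> D * c" using K c by (intro mult_right_mono) auto
  have KD: "K * K \<le> K * D" using K by (intro mult_left_mono) auto
  have Nc: "29 * (D * c) \<le> N * c" using mult_right_mono[OF N c(1)] by (simp add: mult.assoc)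
  show False
  proof (cases "K \<le> 9")
    case small: True
    have KD9: "K * D \<le> 9 * D" using small D by (intro mult_right_mono) auto
    show False
    proof (cases "c = 0")
      case True
      then show False using main' L1 KD9 N D K small unfolding M by simp
    next
      case False
      then have c1: "1 \<le> c" using c by simp
      have "D \<le> D * c" "N \<le> N * c" using mult_left_mono[OF c1, of D] mult_left_mono[OF c1, of N] D N by auto
      moreover have "4 * K + 2 - 2 * c - 2 * N \<le> L" using L2 unfolding M by (simp add: algebra_simps)
      ultimately have "2 * (N * c) \<le> 17 * D + 6 * K + 7 * (D * c)"
        using main' KD9 Kc c cc by linarith
      then show False using \<open>D \<le> D * c\<close> Nc D K by linarith
    qed
  next
    case False
    then have K10: "10 \<le> K" by simp
    have "10 * D \<le> K * D" using K10 D by (intro mult_right_mono) auto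
    \<comment> \<open>The factor \<open>2 * K + 7 * c - 9\<close> is the coefficient of
      \<open>N\<close> after eliminating \<open>L\<close> from \<open>main'\<close> and
      \<open>L3\<close>; it is positive for \<open>K \<ge> 10\<close>. The other side is about
      \<open>18 * K * D + 3 * D * c\<close>.\<close>
    moreover have "29 * D * (2 * K + 7 * c - 9) \<le> N * (2 * K + 7 * c - 9)"
      using N K10 c by (intro mult_right_mono) auto
    moreover have "N * (2 * K + 7 * c - 9) = 2 * (N * K) + 7 * (N * c) - 9 * N"
      by (simp add: algebra_simps)
    moreover have "29 * D * (2 * K + 7 * c - 9) = 58 * (K * D) + 203 * (D * c) - 261 * D"
      by (simp add: algebra_simps)
    moreover have "0 \<le> D * c" using D c by simp
    moreover have "N * (K - c - 3) - 3 * ((2 * K + 1 - c) * (K - c)) - 6 * N + 6 * (2 * K + 1 - c) \<le> 3 * L"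
      using L3[OF K10] unfolding M by (simp add: algebra_simps)
    then have "N * K - N * c - 3 * N - 6 * (K * K) + 9 * (K * c) - 3 * K + 3 * c - 3 * (c * c) - 6 * N + 12 * K + 6 - 6 * c \<le> 3 * L"
      by (simp add: algebra_simps)
    ultimately show False using main' KD K10 K D c cc by linarith
  qed
qed

section \<open>Neighbourhoods and their ranks\<close>

locale symmetric_frame = frame +
  assumes sym: "u < n \<Longrightarrow> v < n \<Longrightarrow> u \<in> N v \<Longrightarrow> v \<in> N u"
    and d_pos: "1 \<le> d" and big: "29 * d \<le> n"
begin

lemma N_sub: "v < n \<Longrightarrow> N v \<subseteq> V" and N_irrefl: "v < n \<Longrightarrow> v \<notin> N v" and finite_N: "v < n \<Longrightarrow> finite (N v)"
  using finite_nbrs[of v "N v"] nbr by blast+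

lemma k_le_d: "k \<le> d"
  using card_mono[OF _ I_sub] by simp

lemma k_pos: "1 \<le> k"
proof (rule ccontr)
  assume "\<not> 1 \<le> k"
  then have "I = {}" using finite_I by (simp add: card_eq_0_iff not_le)
  then show False using rep nontrivial by (simp add: representation_of_def)
qed

lemma rho_big: "S \<subseteq> V \<Longrightarrow> d < card S \<Longrightarrow> k + 1 \<le> rho S"
proof -
  assume S: "S \<subseteq> V" "d < card S"
  then obtain T where T: "T \<subseteq> S" "card T = Suc d" by (metis Suc_leI obtain_subset_with_card_n)
  have "Suc d + k \<le> rho T + d" using general_position[of T] T S by auto
  moreover have "rho T \<le> rho S" using T S finite_subset[OF S(1)] by (intro rho_mono) auto
  ultimately show ?thesis by linarith
qed

lemma rho_N: "v < n \<Longrightarrow> k + 1 \<le> rho (N v)"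
proof -
  assume v: "v < n"
  have "d < card (N v)" using deg[OF v] big d_pos by linarith
  then show ?thesis using rho_big[OF N_sub[OF v]] by blast
qed

lemma N_swap: "v < n \<Longrightarrow> {u \<in> V. v \<in> N u} = N v"
proof (intro set_eqI iffI)
  fix u
  assume v: "v < n"
  show "u \<in> N v" if "u \<in> {u \<in> V. v \<in> N u}" using that v sym[of v u] by simp
  show "u \<in> {u \<in> V. v \<in> N u}" if "u \<in> N v" using that v nbr[OF v that] sym[of u v] by simp
qed

lemma rho_V_upper: "rho V \<le> 2 * k + 1"
proof -
  have "0 \<in> V" using dn by simp
  obtain W where W: "finite W" "independent W" "W \<subseteq> Dbar V" "Dbar V \<subseteq> span W" "card W + 1 = rho V"
    by (rule Dbar_basis[OF finite_atLeastLessThan \<open>0 \<in> V\<close>])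
  have "W \<subseteq> span (unitf ` pairidx I)"
    using order_trans[OF W(3) Dbar_supp] by (simp add: span_unitf card_pairidx)
  then have "card W \<le> card (unitf ` pairidx I)"
    using independent_span_bound[OF _ W(2)] card_pairidx(2) by blast
  also have "\<dots> \<le> 2 * k" using card_image_le[OF card_pairidx(2), of unitf] card_pairidx(1) by simp
  finally show ?thesis using W(5) by simp
qed

lemma rho_V_lower: "k + 1 \<le> rho V"
  using dn by (intro rho_big) auto

text \<open>A largest set \<open>X\<close> that is independent modulo the span of \<open>A\<close>
  already spans, since any further vertex outside the span could be added.\<close>

lemma basis_extension:
  assumes "A \<subseteq> V"
  shows "\<exists>X\<subseteq>V - A. rho (A \<union> X) = rho V \<and> rho (A \<union> X) = rho A + card X"
proof -
  define Q where "Q X \<longleftrightarrow> X \<subseteq> V - A \<and> rho (A \<union> X) = rho A + card X" for X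
  have fA: "finite A" using assms finite_subset by blast
  have "Q {}" by (simp add: Q_def)
  moreover have "\<forall>X. Q X \<longrightarrow> card X < n + 1"
  proof (intro allI impI)
    fix X assume "Q X"
    then have "card X \<le> card V" by (intro card_mono) (auto simp: Q_def)
    then show "card X < n + 1" by simp
  qed
  ultimately obtain X where X: "Q X" "\<And>Y. Q Y \<Longrightarrow> card Y \<le> card X"
    using ex_has_greatest_nat[of Q "{}" card "n + 1"] by auto
  have fX: "finite X" using X(1) finite_subset by (auto simp: Q_def)
  have "z v \<in> span (z ` (A \<union> X))" if v: "v \<in> V" for v
  proof (rule ccontr)
    assume nv: "z v \<notin> span (z ` (A \<union> X))"
    have "v \<notin> A \<union> X"
    proof
      assume "v \<in> A \<union> X"
      then have "z v \<in> span (z ` (A \<union> X))" by (intro span_base imageI)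
      then show False using nv by blast
    qed
    moreover have "rho (insert v (A \<union> X)) = rho (A \<union> X) + 1"
      using nv fA fX by (intro rho_insert_notin_span) auto
    ultimately have "Q (insert v X)" using X(1) v fX by (auto simp: Q_def)
    then show False using X(2)[of "insert v X"] \<open>v \<notin> A \<union> X\<close> fX by simp
  qed
  then have sub: "z ` V \<subseteq> span (z ` (A \<union> X))" by blast
  have "rho V \<le> rho (A \<union> X)" unfolding rho_def
    by (rule dim_mono_fin[OF sub span_superset]) (use fA fX in simp)
  moreover have "rho (A \<union> X) \<le> rho V" using X(1) assms by (intro rho_mono) (auto simp: Q_def)
  ultimately show ?thesis using X(1) by (intro exI[of _ X]) (auto simp: Q_def)
qed

text \<open>Inclusion-exclusion with two degrees of at least \<open>(n + d - 2) / 2\<close>: the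
  surplus of the intersection over \<open>d - 2\<close> bounds the number of vertices missed by both
  neighbourhoods.\<close>

lemma card_common:
  assumes "v < n" "w < n"
  shows "int d - 2 \<le> int (card (N v \<inter> N w))"
    and "int (card (V - (N v \<union> N w))) \<le> int (card (N v \<inter> N w)) - (int d - 2)"
proof -
  have sub: "N v \<union> N w \<subseteq> V" using N_sub assms by blast
  have 1: "card (N v) + card (N w) = card (N v \<union> N w) + card (N v \<inter> N w)"
    using card_Un_Int finite_N assms by blast
  have 2: "card (N v \<union> N w) \<le> n" using card_mono[OF _ sub] by simp
  have 3: "card (V - (N v \<union> N w)) = n - card (N v \<union> N w)"
    using card_Diff_subset[OF finite_subset[OF sub] sub] by simp
  show "int d - 2 \<le> int (card (N v \<inter> N w))" using 1 2 deg[OF assms(1)] deg[OF assms(2)] by linarith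
  show "int (card (V - (N v \<union> N w))) \<le> int (card (N v \<inter> N w)) - (int d - 2)"
    unfolding 3 using 1 2 deg[OF assms(1)] deg[OF assms(2)] by linarith
qed

text \<open>\<open>k + 1\<close> is the rank that general position forces on every
  neighbourhood.\<close>

definition excess :: "nat \<Rightarrow> int" where
  "excess v = int (rho (N v)) - (int k + 1)"

lemma excess_nonneg: "v < n \<Longrightarrow> 0 \<le> excess v"
  using rho_N[of v] by (simp add: excess_def)

text \<open>Let \<open>v0\<close> have least excess and let \<open>X\<close>, of size
  \<open>q\<close>, complete its neighbourhood to full rank. A neighbourhood gains rank from each of
  its members in \<open>X\<close>, and double counting the edges at \<open>X\<close> puts half of
  \<open>X\<close> into it on average. The vertices of \<open>T\<close>, which share at most
  \<open>d\<close> neighbours with \<open>v0\<close>, may lose 3, but they miss so little of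
  \<open>X\<close> that their excess is at least \<open>q - 3\<close>. Whether or not
  \<open>T\<close> holds more than half of the vertices, \<open>n * (q - 3)\<close> is at most twice
  the sum; minimality at \<open>v0\<close> contributes the third copy.\<close>

lemma excess_sum:
  assumes d2: "2 \<le> d"
  shows "int n * (int (rho V) - int k - 4) \<le> 3 * (\<Sum>v\<in>V. excess v)"
proof -
  have "\<exists>v0. v0 \<in> V \<and> (\<forall>v\<in>V. excess v0 \<le> excess v)"
  proof -
    have "Min (excess ` V) \<in> excess ` V" using dn by (intro Min_in) auto
    then obtain v0 where "v0 \<in> V" "excess v0 = Min (excess ` V)" by force
    then show ?thesis by (intro exI[of _ v0]) auto
  qed
  then obtain v0 where v0: "v0 < n" "\<And>v. v < n \<Longrightarrow> excess v0 \<le> excess v" by auto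
  obtain X where X: "X \<subseteq> V - N v0" "rho (N v0 \<union> X) = rho V" "rho (N v0 \<union> X) = rho (N v0) + card X"
    using basis_extension[OF N_sub[OF v0(1)]] by blast
  have fX: "finite X" using X(1) finite_subset by blast
  define q where "q = int (card X)"
  define a where "a v = int (card (N v \<inter> X))" for v
  define c where "c v = card (N v \<inter> N v0)" for v
  \<comment> \<open>Submodularity transports the independence of \<open>X\<close> modulo
    \<open>N v0\<close> to independence of \<open>N v \<inter> X\<close> modulo the common
    neighbours.\<close>
  have main: "int (rho (N v \<inter> N v0)) + a v \<le> int (rho (N v))" if v: "v < n" for v
  proof -
    let ?S = "N v \<inter> N v0" and ?Q = "N v \<inter> X"
    have fin: "finite ?S" "finite ?Q" "finite (N v0)" using finite_N v v0 fX by auto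
    have "(?S \<union> ?Q) \<union> N v0 = N v0 \<union> ?Q" by blast
    then have 1: "rho (N v0 \<union> ?Q) + rho ?S \<le> rho (?S \<union> ?Q) + rho (N v0)"
      using rho_submodular[of "?S \<union> ?Q" "N v0" ?S] fin by auto
    have "(N v0 \<union> ?Q) \<union> (X - ?Q) = N v0 \<union> X" by blast
    then have 2: "rho (N v0) + card X \<le> rho (N v0 \<union> ?Q) + card (X - ?Q)"
      using rho_Un_le[of "N v0 \<union> ?Q" "X - ?Q"] fin fX X(3) by auto
    have 3: "card (X - ?Q) + card ?Q = card X"
      using card_Diff_subset[of ?Q X] card_mono[of X ?Q] fX by simp
    have "rho (?S \<union> ?Q) \<le> rho (N v)" using finite_N[OF v] by (intro rho_mono) auto
    then show ?thesis using 1 2 3 by (simp add: a_def)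
  qed
  define T where "T = {v \<in> V. c v \<le> d}"
  have out: "a v \<le> excess v" if v: "v < n" "d < c v" for v
  proof -
    have "k + 1 \<le> rho (N v \<inter> N v0)" using v N_sub[OF v(1)] by (intro rho_big) (auto simp: c_def)
    then show ?thesis using main[OF v(1)] by (simp add: excess_def)
  qed
  have inT: "a v - 3 \<le> excess v" "q - 3 \<le> excess v" if v: "v < n" "c v \<le> d" for v
  proof -
    have "c v + k \<le> rho (N v \<inter> N v0) + d"
      unfolding c_def using N_sub[OF v(1)] v(2) by (intro general_position) (auto simp: c_def)
    then have 1: "a v + int (c v) - int d - 1 \<le> excess v" using main[OF v(1)] by (simp add: excess_def)
    \<comment> \<open>The origin of the 3: with \<open>c v \<ge> d - 2\<close> common neighbours,
      general position guarantees only the rank \<open>k - 2\<close> instead of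
      \<open>k + 1\<close>.\<close>
    have "int d - 2 \<le> int (c v)" unfolding c_def by (rule card_common(1)[OF v(1) v0(1)])
    then show "a v - 3 \<le> excess v" using 1 by linarith
    \<comment> \<open>Members of \<open>X\<close> missed by \<open>N v\<close> avoid both
      neighbourhoods, so there are at most \<open>c v - (d - 2)\<close> of them, the same surplus by
      which the rank bound exceeds its worst case.\<close>
    have "card (X - N v) \<le> card (V - (N v \<union> N v0))" using X(1) by (intro card_mono) auto
    then have "int (card (X - N v)) \<le> int (c v) - (int d - 2)"
      using card_common(2)[OF v(1) v0(1)] unfolding c_def by linarith
    moreover have "card X = card (X \<inter> N v) + card (X - N v)" using card_Int_Diff[OF fX] by blast
    then have "q = a v + int (card (X - N v))" by (simp add: q_def a_def Int_commute)
    ultimately show "q - 3 \<le> excess v" using 1 by linarith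
  qed
  have "(\<Sum>v\<in>V. card (N v \<inter> X)) = (\<Sum>x\<in>X. card (N x))"
  proof -
    have "(\<Sum>v\<in>V. card (N v \<inter> X)) = (\<Sum>v\<in>V. card {x \<in> X. x \<in> N v})"
      by (intro sum.cong arg_cong[where f = card]) auto
    also have "\<dots> = (\<Sum>x\<in>X. card {v \<in> V. x \<in> N v})" using fX by (intro sum_card_swap) auto
    also have "\<dots> = (\<Sum>x\<in>X. card (N x))"
    proof (intro sum.cong refl arg_cong[where f = card])
      fix x assume "x \<in> X"
      then have "x < n" using X(1) by auto
      then show "{v \<in> V. x \<in> N v} = N x" by (rule N_swap)
    qed
    finally show ?thesis .
  qed
  then have sa: "(\<Sum>v\<in>V. a v) = (\<Sum>x\<in>X. int (card (N x)))"
    unfolding a_def by (metis of_nat_sum)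
  have "q * int n \<le> 2 * (\<Sum>x\<in>X. int (card (N x)))"
  proof -
    have "(\<Sum>x\<in>X. int n) \<le> (\<Sum>x\<in>X. 2 * int (card (N x)))"
    proof (rule sum_mono)
      fix x assume "x \<in> X"
      then have "x < n" using X(1) by auto
      then show "int n \<le> 2 * int (card (N x))" using deg[of x] d2 by linarith
    qed
    then show ?thesis by (simp add: q_def sum_distrib_left)
  qed
  then have A: "q * int n \<le> 2 * (\<Sum>v\<in>V. a v)" using sa by simp
  have TV: "T \<subseteq> V" "finite T" by (auto simp: T_def)
  have "(\<Sum>v\<in>V. a v - (if v \<in> T then 3 else 0)) \<le> (\<Sum>v\<in>V. excess v)"
  proof (rule sum_mono)
    fix v assume "v \<in> V"
    then show "a v - (if v \<in> T then 3 else 0) \<le> excess v" using out[of v] inT(1)[of v] by (auto simp: T_def not_le)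
  qed
  moreover have "(\<Sum>v\<in>V. a v - (if v \<in> T then 3 else 0)) = (\<Sum>v\<in>V. a v) - 3 * int (card T)"
  proof -
    have "(\<Sum>v\<in>V. if v \<in> T then 3 else 0 :: int) = 3 * int (card T)"
      using TV by (simp add: sum.If_cases Int_absorb1)
    then show ?thesis by (simp add: sum_subtractf)
  qed
  ultimately have B: "(\<Sum>v\<in>V. a v) - 3 * int (card T) \<le> (\<Sum>v\<in>V. excess v)" by simp
  have C: "int (card T) * (q - 3) \<le> (\<Sum>v\<in>V. excess v)"
  proof -
    have "int (card T) * (q - 3) = (\<Sum>v\<in>T. q - 3)" by simp
    also have "\<dots> \<le> (\<Sum>v\<in>T. excess v)" using inT(2) by (intro sum_mono) (auto simp: T_def)
    also have "\<dots> \<le> (\<Sum>v\<in>V. excess v)" using TV excess_nonneg by (intro sum_mono2) auto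
    finally show ?thesis .
  qed
  have E0: "0 \<le> (\<Sum>v\<in>V. excess v)" using excess_nonneg by (intro sum_nonneg) auto
  have half: "int n * (q - 3) \<le> 2 * (\<Sum>v\<in>V. excess v)"
  proof (cases "2 * card T \<le> n")
    case True
    then have "6 * int (card T) \<le> 3 * int n" by linarith
    then show ?thesis using A B by (simp add: algebra_simps)
  next
    case False
    show ?thesis
    proof (cases "3 \<le> q")
      case True
      then have "int n * (q - 3) \<le> (2 * int (card T)) * (q - 3)" using False by (intro mult_right_mono) auto
      then show ?thesis using C by simp
    next
      case False
      then have "int n * (q - 3) \<le> 0" by (intro mult_nonneg_nonpos) auto
      then show ?thesis using E0 by linarith
    qed
  qed
  have "int n * excess v0 = (\<Sum>v\<in>V. excess v0)" by simp
  also have "\<dots> \<le> (\<Sum>v\<in>V. excess v)" using v0(2) by (intro sum_mono) auto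
  finally have low: "int n * excess v0 \<le> (\<Sum>v\<in>V. excess v)" .
  have "int (rho V) - int k - 4 = q - 3 + excess v0" using X(2,3) by (simp add: q_def excess_def)
  then have "int n * (int (rho V) - int k - 4) = int n * (q - 3) + int n * excess v0"
    by (simp only: distrib_left)
  then show ?thesis using half low by linarith
qed

text \<open>The basis comes first in both orders and the rest once increasing, once decreasing. The
  earlier neighbours of an outside vertex then cover \<open>N v\<close>, and both sets contain
  \<open>N v \<inter> X\<close>, so submodularity bounds the sum of their ranks from below. The
  edges at \<open>X\<close> add up to the degree sum over \<open>X\<close>: those leaving
  \<open>X\<close> count once, those inside once in each order.\<close>

lemma two_orders:
  assumes X: "X \<subseteq> V" "fullrank X" "rho X = rho V"
  shows "2 * int n * int d \<le> 2 * int k * (int d - int k) + 2 * int (rho V) * (int d + int k)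
     + 2 * (int n - int (rho V)) * (int d - int k - 1 + int (rho V))
     - (\<Sum>x\<in>X. int (card (N x))) - (\<Sum>v\<in>V - X. int (rho (N v)) - 2 * loss v)"
proof -
  have fX: "finite X" using X(1) finite_subset by blast
  have cX: "card X = rho V" using X(2,3) by (simp add: fullrank_def)
  define e where "e = (\<Sum>x\<in>X. int (card {w \<in> N x \<inter> X. w < x}))"
  define p1 where "p1 v = (if v \<in> X then v else n + v)" for v
  \<comment> \<open>Outside \<open>X\<close> the value \<open>2 * n - v\<close> exceeds
    \<open>n\<close>, hence all positions in \<open>X\<close>, and it reverses the order.\<close>
  define p2 where "p2 v = (if v \<in> X then v else 2 * n - v)" for v
  define S where "S v = {w \<in> N v. p1 w < p1 v}" for v
  define T where "T v = {w \<in> N v. p2 w < p2 v}" for v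
  define C where "C = int d + int k - (2 * int k + 1 - int (rho V))"
  have XV: "x < n" if "x \<in> X" for x using that X(1) by auto
  have o1: "int n * int d \<le> int k * (int d - int k) + (\<Sum>x\<in>X. int d + int k - int (card {w \<in> N x \<inter> X. p1 w < p1 x}))
     + (\<Sum>v\<in>V - X. C - int (rho (S v)) + loss v)"
    unfolding S_def C_def
  proof (rule ordered_count[OF _ X])
    show "inj_on p1 V" by (rule inj_onI) (auto simp: p1_def split: if_splits dest: XV)
    show "p1 x < p1 v" if "x \<in> X" "v \<in> V - X" for x v using that XV[of x] by (auto simp: p1_def)
  qed
  have o2: "int n * int d \<le> int k * (int d - int k) + (\<Sum>x\<in>X. int d + int k - int (card {w \<in> N x \<inter> X. p2 w < p2 x}))
     + (\<Sum>v\<in>V - X. C - int (rho (T v)) + loss v)"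
    unfolding T_def C_def
  proof (rule ordered_count[OF _ X])
    show "inj_on p2 V" by (rule inj_onI) (auto simp: p2_def split: if_splits dest: XV)
    show "p2 x < p2 v" if "x \<in> X" "v \<in> V - X" for x v using that XV[of x] by (auto simp: p2_def)
  qed
  have inX: "(\<Sum>x\<in>X. int d + int k - int (card {w \<in> N x \<inter> X. q w < q x})) = int (rho V) * (int d + int k) - e"
    if "\<And>x. x \<in> X \<Longrightarrow> q x = x" for q :: "nat \<Rightarrow> nat"
  proof -
    have "{w \<in> N x \<inter> X. q w < q x} = {w \<in> N x \<inter> X. w < x}" if "x \<in> X" for x
      using that \<open>\<And>x. x \<in> X \<Longrightarrow> q x = x\<close> by auto
    then show ?thesis by (simp add: sum_subtractf e_def cX)
  qed
  have e1: "(\<Sum>x\<in>X. int d + int k - int (card {w \<in> N x \<inter> X. p1 w < p1 x})) = int (rho V) * (int d + int k) - e"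
    by (rule inX) (simp add: p1_def)
  have e2: "(\<Sum>x\<in>X. int d + int k - int (card {w \<in> N x \<inter> X. p2 w < p2 x})) = int (rho V) * (int d + int k) - e"
    by (rule inX) (simp add: p2_def)
  have sub: "int (rho (N v)) + int (card (N v \<inter> X)) \<le> int (rho (S v)) + int (rho (T v))" if v: "v \<in> V - X" for v
  proof -
    have vn: "v < n" "v \<notin> X" using v by auto
    have "w \<in> S v \<union> T v" if w: "w \<in> N v" for w
    proof -
      have "w < n" "w \<noteq> v" using nbr[OF vn(1) w] by auto
      then show ?thesis using w vn by (auto simp: S_def T_def p1_def p2_def)
    qed
    then have "S v \<union> T v = N v" by (auto simp: S_def T_def)
    moreover have "N v \<inter> X \<subseteq> S v" "N v \<inter> X \<subseteq> T v"
      using vn XV by (fastforce simp: S_def T_def p1_def p2_def)+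
    moreover have "finite (S v)" "finite (T v)" using finite_N[OF vn(1)] by (auto simp: S_def T_def)
    ultimately have "rho (N v) + rho (N v \<inter> X) \<le> rho (S v) + rho (T v)"
      using rho_submodular[of "S v" "T v" "N v \<inter> X"] by simp
    moreover have "rho (N v \<inter> X) = card (N v \<inter> X)"
      using fullrank_subset[OF X(2) fX, of "N v \<inter> X"] by (simp add: fullrank_def)
    ultimately show ?thesis by linarith
  qed
  have cVX: "int (card (V - X)) = int n - int (rho V)"
    using card_Diff_subset[OF fX X(1)] card_mono[OF _ X(1)] cX by simp
  have "(\<Sum>v\<in>V - X. C - int (rho (S v)) + loss v) + (\<Sum>v\<in>V - X. C - int (rho (T v)) + loss v)
      = (\<Sum>v\<in>V - X. 2 * C - (int (rho (S v)) + int (rho (T v))) + 2 * loss v)"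
    unfolding sum.distrib[symmetric] by (rule sum.cong) auto
  also have "\<dots> \<le> (\<Sum>v\<in>V - X. 2 * C - (int (rho (N v)) + int (card (N v \<inter> X))) + 2 * loss v)"
    using sub by (intro sum_mono) fastforce
  also have "\<dots> = 2 * (int n - int (rho V)) * C - (\<Sum>v\<in>V - X. int (rho (N v)) - 2 * loss v)
       - (\<Sum>v\<in>V - X. int (card (N v \<inter> X)))"
    by (simp add: sum.distrib sum_subtractf cVX)
  finally have VX: "(\<Sum>v\<in>V - X. C - int (rho (S v)) + loss v) + (\<Sum>v\<in>V - X. C - int (rho (T v)) + loss v)
     \<le> 2 * (int n - int (rho V)) * C - (\<Sum>v\<in>V - X. int (rho (N v)) - 2 * loss v)
       - (\<Sum>v\<in>V - X. int (card (N v \<inter> X)))" .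
  have "(\<Sum>x\<in>X. card (N x)) = (\<Sum>v\<in>V - X. card (N v \<inter> X)) + 2 * (\<Sum>x\<in>X. card {w \<in> N x \<inter> X. w < x})"
  proof -
    have split: "card (N x) = card {v \<in> V - X. x \<in> N v} + (card {w \<in> X. w \<in> N x \<and> w < x} + card {w \<in> X. w \<in> N x \<and> x < w})"
      if x: "x \<in> X" for x
    proof -
      have "{w \<in> X. w \<in> N x \<and> w < x} \<union> {w \<in> X. w \<in> N x \<and> x < w} = {w \<in> X. w \<in> N x}"
        using N_irrefl[OF XV[OF x]] by auto (metis linorder_neqE_nat)
      moreover have "card ({w \<in> X. w \<in> N x \<and> w < x} \<union> {w \<in> X. w \<in> N x \<and> x < w})
          = card {w \<in> X. w \<in> N x \<and> w < x} + card {w \<in> X. w \<in> N x \<and> x < w}"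
        by (rule card_Un_disjoint) (use fX in auto)
      ultimately have sides: "card {w \<in> X. w \<in> N x} = card {w \<in> X. w \<in> N x \<and> w < x} + card {w \<in> X. w \<in> N x \<and> x < w}"
        by simp
      have "N x = {v \<in> V - X. x \<in> N v} \<union> {w \<in> X. w \<in> N x}"
      proof -
        have "(y < n \<and> x \<in> N y) = (y \<in> N x)" for y using N_swap[OF XV[OF x]] by auto
        then show ?thesis by auto
      qed
      moreover have "card ({v \<in> V - X. x \<in> N v} \<union> {w \<in> X. w \<in> N x})
          = card {v \<in> V - X. x \<in> N v} + card {w \<in> X. w \<in> N x}"
        by (rule card_Un_disjoint) (use fX in auto)
      ultimately have "card (N x) = card {v \<in> V - X. x \<in> N v} + card {w \<in> X. w \<in> N x}"
        by simp
      then show ?thesis using sides by simp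
    qed
    have s1: "(\<Sum>x\<in>X. card {v \<in> V - X. x \<in> N v}) = (\<Sum>v\<in>V - X. card {x \<in> X. x \<in> N v})"
      using fX by (intro sum_card_swap) auto
    have s2: "(\<Sum>x\<in>X. card {w \<in> X. w \<in> N x \<and> x < w}) = (\<Sum>w\<in>X. card {x \<in> X. w \<in> N x \<and> x < w})"
      using fX by (intro sum_card_swap) auto
    have s3: "(\<Sum>w\<in>X. card {x \<in> X. w \<in> N x \<and> x < w}) = (\<Sum>x\<in>X. card {w \<in> X. w \<in> N x \<and> w < x})"
    proof (intro sum.cong refl arg_cong[where f = card] Collect_cong conj_cong)
      show "(w \<in> N x) = (x \<in> N w)" if "w \<in> X" "x \<in> X" for w x
        using sym[of w x] sym[of x w] XV that by blast
    qed
    have "(\<Sum>x\<in>X. card (N x)) = (\<Sum>x\<in>X. card {v \<in> V - X. x \<in> N v} + (card {w \<in> X. w \<in> N x \<and> w < x} + card {w \<in> X. w \<in> N x \<and> x < w}))"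
      using split by (intro sum.cong) auto
    also have "\<dots> = (\<Sum>v\<in>V - X. card {x \<in> X. x \<in> N v}) + 2 * (\<Sum>x\<in>X. card {w \<in> X. w \<in> N x \<and> w < x})"
      unfolding sum.distrib s1 s2 s3 by simp
    also have "(\<Sum>v\<in>V - X. card {x \<in> X. x \<in> N v}) = (\<Sum>v\<in>V - X. card (N v \<inter> X))"
      by (intro sum.cong refl arg_cong[where f = card]) auto
    also have "(\<Sum>x\<in>X. card {w \<in> X. w \<in> N x \<and> w < x}) = (\<Sum>x\<in>X. card {w \<in> N x \<inter> X. w < x})"
      by (intro sum.cong refl arg_cong[where f = card]) auto
    finally show ?thesis .
  qed
  then have "int (\<Sum>x\<in>X. card (N x))
      = int ((\<Sum>v\<in>V - X. card (N v \<inter> X)) + 2 * (\<Sum>x\<in>X. card {w \<in> N x \<inter> X. w < x}))"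
    by (rule arg_cong)
  then have "(\<Sum>x\<in>X. int (card (N x))) = (\<Sum>v\<in>V - X. int (card (N v \<inter> X))) + 2 * e"
    by (simp only: e_def of_nat_sum of_nat_add of_nat_mult of_nat_numeral)
  then have tot: "2 * int n * int d \<le> 2 * (int k * (int d - int k)) + 2 * (int (rho V) * (int d + int k))
     + 2 * (int n - int (rho V)) * C - (\<Sum>v\<in>V - X. int (rho (N v)) - 2 * loss v) - (\<Sum>x\<in>X. int (card (N x)))"
    using o1 o2 VX unfolding e1 e2 by linarith
  have "C = int d - int k - 1 + int (rho V)" by (simp add: C_def)
  then show ?thesis using tot by (simp add: mult.assoc)
qed

text \<open>The inequality of \<open>two_orders\<close> is doubled so that the degree bound enters
  without halves. All that depends on individual neighbourhoods is gathered in \<open>L\<close>, for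
  which three lower bounds of different strength are available.\<close>

theorem contradiction: False
proof -
  obtain X where X: "X \<subseteq> V" "rho X = rho V" "rho X = card X"
    using basis_extension[of "{}"] by (auto simp: rho_empty)
  then have full: "fullrank X" by (simp add: fullrank_def)
  have fX: "finite X" using X(1) finite_subset by blast
  define M where "M = int (rho V)"
  define c where "c = 2 * int k + 1 - M"
  define L where "L = (\<Sum>v\<in>V - X. excess v - 2 * loss v)"
  have cVX: "int (card (V - X)) = int n - M"
    using card_Diff_subset[OF fX X(1)] card_mono[OF _ X(1)] X by (simp add: M_def)
  have S1: "M * (int n + int d - 2) \<le> 2 * (\<Sum>x\<in>X. int (card (N x)))"
  proof -
    have "(\<Sum>x\<in>X. int n + int d - 2) \<le> (\<Sum>x\<in>X. 2 * int (card (N x)))"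
    proof (rule sum_mono)
      fix x assume "x \<in> X"
      then have "x < n" using X(1) by auto
      then show "int n + int d - 2 \<le> 2 * int (card (N x))" using deg[of x] by linarith
    qed
    then show ?thesis using X by (simp add: M_def sum_distrib_left)
  qed
  have S2: "(\<Sum>v\<in>V - X. int (rho (N v)) - 2 * loss v) = (int n - M) * (int k + 1) + L"
  proof -
    have "(\<Sum>v\<in>V - X. int (rho (N v)) - 2 * loss v) = (\<Sum>v\<in>V - X. (int k + 1) + (excess v - 2 * loss v))"
      by (rule sum.cong) (auto simp: excess_def)
    also have "\<dots> = (\<Sum>v\<in>V - X. int k + 1) + L" unfolding L_def by (rule sum.distrib)
    also have "(\<Sum>v\<in>V - X. int k + 1) = (int n - M) * (int k + 1)" by (simp only: sum_constant cVX)
    finally show ?thesis .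
  qed
  have loss: "0 \<le> loss v" "loss v \<le> 1" for v by (auto simp: loss_def)
  have main: "4 * int n * int d \<le> 4 * int k * (int d - int k) + 4 * M * (int d + int k)
       + 4 * (int n - M) * (int d - int k - 1 + M)
       - M * (int n + int d - 2) - 2 * (int n - M) * (int k + 1) - 2 * L"
    using two_orders[OF X(1) full X(2)] S1 unfolding S2 M_def[symmetric]
    by (simp add: algebra_simps)
  \<comment> \<open>If the rank of all \<open>z v\<close> is maximal, \<open>loss v = 1\<close>
    means that the rank of \<open>N v\<close> is not \<open>k + 1\<close>, so the excess recovers
    one of the two lost units.\<close>
  have L1: "- (int n - M) \<le> L" if "c = 0"
  proof -
    have "rho V = 2 * k + 1" using that by (simp add: c_def M_def)
    then have "-1 \<le> excess v - 2 * loss v" if "v \<in> V - X" for v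
      using excess_nonneg[of v] that by (auto simp: loss_def excess_def)
    then have "(\<Sum>v\<in>V - X. -1) \<le> L" unfolding L_def by (rule sum_mono)
    then show ?thesis by (simp add: cVX)
  qed
  have L2: "- 2 * (int n - M) \<le> L"
  proof -
    have "(\<Sum>v\<in>V - X. -2) \<le> L" unfolding L_def
    proof (rule sum_mono)
      fix v assume "v \<in> V - X"
      then show "-2 \<le> excess v - 2 * loss v" using excess_nonneg[of v] loss[of v] by simp
    qed
    then show ?thesis by (simp add: cVX)
  qed
  \<comment> \<open>\<open>excess_sum\<close> runs over all vertices; the \<open>M\<close> basis
    vertices account for at most \<open>M - k - 1\<close> each and are subtracted.\<close>
  have L3: "int n * (M - int k - 4) - 3 * (M * (M - int k - 1)) - 6 * (int n - M) \<le> 3 * L" if k10: "10 \<le> int k"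
  proof -
    have "(\<Sum>v\<in>X. excess v) \<le> (\<Sum>v\<in>X. M - int k - 1)"
    proof (rule sum_mono)
      fix v assume "v \<in> X"
      then have "v < n" using X(1) by auto
      then have "rho (N v) \<le> rho V" using N_sub by (intro rho_mono) auto
      then show "excess v \<le> M - int k - 1" by (simp add: excess_def M_def)
    qed
    then have 1: "(\<Sum>v\<in>X. excess v) \<le> M * (M - int k - 1)" using X by (simp add: M_def)
    have "(\<Sum>v\<in>V - X. loss v) \<le> (\<Sum>v\<in>V - X. 1)" using loss by (intro sum_mono) auto
    then have 2: "(\<Sum>v\<in>V - X. loss v) \<le> int n - M" by (simp add: cVX)
    have 3: "L = (\<Sum>v\<in>V - X. excess v) - 2 * (\<Sum>v\<in>V - X. loss v)"
      by (simp add: L_def sum_subtractf sum_distrib_left)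
    have 4: "(\<Sum>v\<in>V. excess v) = (\<Sum>v\<in>X. excess v) + (\<Sum>v\<in>V - X. excess v)"
      by (subst sum.subset_diff[OF X(1)]) auto
    have "2 \<le> d" using k_le_d k10 by linarith
    then have "int n * (M - int k - 4) \<le> 3 * (\<Sum>v\<in>V. excess v)" using excess_sum by (simp add: M_def)
    moreover have "A - 3 * B - 6 * C \<le> 3 * L"
      if "A \<le> 3 * (\<Sum>v\<in>V. excess v)" "(\<Sum>v\<in>X. excess v) \<le> B" "(\<Sum>v\<in>V - X. loss v) \<le> C" for A B C
      using that 3 4 by linarith
    ultimately show ?thesis using 1 2 by blast
  qed
  show False
  proof (rule counting_contradiction[OF _ _ _ _ _ _ main L1 L2 L3, of c])
    show "1 \<le> int k" "int k \<le> int d" using k_pos k_le_d by simp_all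
    show "0 \<le> c" "c \<le> int k" using rho_V_upper rho_V_lower by (simp_all add: c_def M_def)
    show "29 * int d \<le> int n" using big by linarith
    show "M = 2 * int k + 1 - c" by (simp add: c_def)
  qed
qed

end

section \<open>From infinitesimal to continuous rigidity\<close>

text \<open>A representation with the fewest fields exists because the motion itself, with the unit
  vectors as directions, is a representation; for a nontrivial motion the resulting frame is
  contradictory.\<close>

theorem generic_infinitesimally_rigid:
  assumes gen: "generic n d p" and d: "1 \<le> d" "29 * d \<le> n"
    and E: "is_graph n E" "\<And>v. v < n \<Longrightarrow> n + d \<le> 2 * Defs.degree n E v + 2"
    and m: "\<And>u v. u < n \<Longrightarrow> v < n \<Longrightarrow> {u, v} \<in> E \<Longrightarrow> strain d p m u v = 0"
  shows "trivial_motion n d p m"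
proof (rule ccontr)
  assume nt: "\<not> trivial_motion n d p m"
  let ?Q = "\<lambda>k. \<exists>I b g. representation_of n d p m I b g \<and> card I = k"
  have "?Q (card {..<d})" using trivial_representation by blast
  then have "?Q (LEAST k. ?Q k)" by (rule LeastI)
  then obtain I b g where rep: "representation_of n d p m I b g" "card I = (LEAST k. ?Q k)" by blast
  have "symmetric_frame n d p m I b g (\<lambda>v. {u. u < n \<and> {u, v} \<in> E})"
  proof
    show "generic n d p" "\<not> trivial_motion n d p m" "representation_of n d p m I b g" "1 \<le> d" "29 * d \<le> n"
      by fact+
    show "d < n" using d by simp
    show "card I \<le> card I'" if "representation_of n d p m I' b' g'" for I' b' g'
      unfolding rep(2) using that by (intro Least_le) blast
    show "n + d \<le> 2 * card {u. u < n \<and> {u, v} \<in> E} + 2" if "v < n" for v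
      using E(2)[OF that] by (simp add: Defs.degree_def)
    show "u < n \<and> u \<noteq> v \<and> strain d p m u v = 0" if "v < n" "u \<in> {u. u < n \<and> {u, v} \<in> E}" for u v
    proof -
      have "\<exists>a b. {u, v} = {a, b} \<and> a \<noteq> b \<and> a < n \<and> b < n"
        using E(1)[unfolded is_graph_def, rule_format, of "{u, v}"] that by simp
      then show ?thesis using that m by (auto simp: doubleton_eq_iff)
    qed
    show "v \<in> {w. w < n \<and> {w, u} \<in> E}" if "u < n" "v < n" "u \<in> {w. w < n \<and> {w, v} \<in> E}" for u v
      using that by (simp add: insert_commute)
  qed
  then show False by (rule symmetric_frame.contradiction)
qed

section \<open>Congruent configurations\<close>

lemma barycentric_coordinates:
  assumes gen: "generic n d p" and dn: "d < n"
  obtains B l where "B \<subseteq> {0..<n}" "card B = Suc d" "\<And>x. x < n \<Longrightarrow> (\<Sum>s\<in>B. l x s) = (1::real)"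
    "\<And>x i. x < n \<Longrightarrow> i < d \<Longrightarrow> p x i = (\<Sum>s\<in>B. l x s * p s i)"
    "\<And>mu t. (\<And>i. i < d \<Longrightarrow> (\<Sum>s\<in>B. mu s * p s i) = 0) \<Longrightarrow> (\<Sum>s\<in>B. mu s) = 0 \<Longrightarrow> t \<in> B \<Longrightarrow> mu t = (0::real)"
proof -
  define B where "B = {0..<Suc d}"
  have B: "B \<subseteq> {0..<n}" "card B = Suc d" using dn by (auto simp: B_def)
  have fB: "finite B" by (simp add: B_def)
  have "\<exists>w c. \<forall>s\<in>B. (\<Sum>i<d. w i * p s i) + c = (if s = t then 1 else 0)" for t
    by (rule generic_affine_interpolation[OF gen B])
  then obtain w c where wc: "\<And>t s. s \<in> B \<Longrightarrow> (\<Sum>i<d. w t i * p s i) + c t = (if s = t then 1 else 0)"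
    by metis
  define l where "l x s = (\<Sum>i<d. w s i * p x i) + c s" for x s
  have lB: "l r s = (if r = s then 1 else 0)" if "r \<in> B" for r s using wc[OF that] by (simp add: l_def)
  have lin: "(\<Sum>s\<in>B. a s * l x s) = (\<Sum>i<d. p x i * (\<Sum>s\<in>B. a s * w s i)) + (\<Sum>s\<in>B. a s * c s)" for a x
  proof -
    have "(\<Sum>s\<in>B. a s * l x s) = (\<Sum>s\<in>B. \<Sum>i<d. a s * (w s i * p x i)) + (\<Sum>s\<in>B. a s * c s)"
      by (simp add: l_def distrib_left sum.distrib sum_distrib_left)
    also have "(\<Sum>s\<in>B. \<Sum>i<d. a s * (w s i * p x i)) = (\<Sum>i<d. p x i * (\<Sum>s\<in>B. a s * w s i))"
      by (subst sum.swap) (simp add: sum_distrib_left mult_ac)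
    finally show ?thesis .
  qed
  have delta: "(\<Sum>s\<in>B. a s * l r s) = a r" if r: "r \<in> B" for a r
  proof -
    have "(\<Sum>s\<in>B. a s * l r s) = (\<Sum>s\<in>B. if s = r then a s else 0)"
      using lB[OF r] by (intro sum.cong) auto
    then show ?thesis using r fB by simp
  qed
  \<comment> \<open>The interpolant of an affine function on \<open>B\<close> equals the function
    everywhere, as their difference is affine and vanishes on \<open>B\<close>. Constants and
    coordinate functions give the first two identities for \<open>l\<close>.\<close>
  have aff: "(\<Sum>s\<in>B. ((\<Sum>i<d. p s i * h i) + e) * l x s) = (\<Sum>i<d. p x i * h i) + e" for x h e
  proof -
    let ?a = "\<lambda>s. (\<Sum>i<d. p s i * h i) + e"
    let ?h = "\<lambda>i. (\<Sum>s\<in>B. ?a s * w s i) - h i" and ?e = "(\<Sum>s\<in>B. ?a s * c s) - e"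
    have eq: "(\<Sum>i<d. p y i * ?h i) + ?e = (\<Sum>s\<in>B. ?a s * l y s) - ((\<Sum>i<d. p y i * h i) + e)" for y
      unfolding lin by (simp only: right_diff_distrib sum_subtractf)
    have z: "(\<Sum>i<d. p s i * ?h i) + ?e = 0" if "s \<in> B" for s
      unfolding eq delta[OF that] by simp
    have "?e = 0" "\<And>i. i < d \<Longrightarrow> ?h i = 0"
      using generic_affine_zero[OF gen B, of ?h ?e] z by blast+
    then have "(\<Sum>i<d. p x i * ?h i) + ?e = 0" by simp
    then show ?thesis unfolding eq by simp
  qed
  show ?thesis
  proof (rule that[of B l])
    show "B \<subseteq> {0..<n}" "card B = Suc d" by (rule B)+
    show "(\<Sum>s\<in>B. l x s) = 1" for x using aff[of "\<lambda>_. 0" 1 x] by simp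
    show "p x i = (\<Sum>s\<in>B. l x s * p s i)" if "i < d" for x i
    proof -
      have "(\<Sum>j<d. p y j * (if j = i then 1 else 0)) = p y i" for y
        using that by (simp add: if_distrib cong: if_cong)
      then show ?thesis using aff[of "\<lambda>j. if j = i then 1 else 0" 0 x] by (simp add: mult.commute)
    qed
    show "mu t = 0" if mu: "\<And>i. i < d \<Longrightarrow> (\<Sum>s\<in>B. mu s * p s i) = 0" "(\<Sum>s\<in>B. mu s) = 0" and t: "t \<in> B" for mu t
    proof -
      have "mu t = (\<Sum>s\<in>B. mu s * l s t)"
      proof -
        have "(\<Sum>s\<in>B. mu s * l s t) = (\<Sum>s\<in>B. if s = t then mu s else 0)"
          using lB by (intro sum.cong) auto
        then show ?thesis using t fB by simp
      qed
      also have "\<dots> = (\<Sum>i<d. w t i * (\<Sum>s\<in>B. mu s * p s i)) + c t * (\<Sum>s\<in>B. mu s)"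
      proof -
        have "(\<Sum>s\<in>B. mu s * l s t) = (\<Sum>s\<in>B. \<Sum>i<d. mu s * (w t i * p s i)) + (\<Sum>s\<in>B. mu s * c t)"
          by (simp add: l_def distrib_left sum.distrib sum_distrib_left)
        also have "(\<Sum>s\<in>B. \<Sum>i<d. mu s * (w t i * p s i)) = (\<Sum>i<d. w t i * (\<Sum>s\<in>B. mu s * p s i))"
          by (subst sum.swap) (simp add: sum_distrib_left mult_ac)
        also have "(\<Sum>s\<in>B. mu s * c t) = c t * (\<Sum>s\<in>B. mu s)" by (simp add: sum_distrib_left mult.commute)
        finally show ?thesis .
      qed
      also have "\<dots> = 0" using mu by simp
      finally show ?thesis .
    qed
  qed
qed

text \<open>When the squared distances are expanded, the terms with a single norm \<open>N\<close>
  vanish because the weights sum to 0. Hence the length of such a combination, and with it every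
  affine dependence, is determined by the distances alone.\<close>

lemma zero_weight_norm:
  assumes "finite B" "(\<Sum>s\<in>B. mu s) = (0::real)"
  shows "2 * (\<Sum>i<d. (\<Sum>s\<in>B. mu s * q s i)\<^sup>2) = - (\<Sum>s\<in>B. \<Sum>t\<in>B. mu s * mu t * dist2 d (q s) (q t))"
proof -
  define N where "N s = (\<Sum>i<d. (q s i)\<^sup>2)" for s
  have dist: "dist2 d (q s) (q t) = N s + N t - 2 * (\<Sum>i<d. q s i * q t i)" for s t
    by (simp add: dist2_def N_def power2_diff sum.distrib sum_subtractf sum_distrib_left mult.assoc)
  have "(\<Sum>s\<in>B. \<Sum>t\<in>B. mu s * mu t * N s) = (\<Sum>s\<in>B. mu s * N s * (\<Sum>t\<in>B. mu t))"
    by (simp add: sum_distrib_left mult_ac)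
  then have 1: "(\<Sum>s\<in>B. \<Sum>t\<in>B. mu s * mu t * N s) = 0" using assms by simp
  have "(\<Sum>s\<in>B. \<Sum>t\<in>B. mu s * mu t * N t) = (\<Sum>s\<in>B. mu s * (\<Sum>t\<in>B. mu t * N t))"
    by (simp add: sum_distrib_left mult_ac)
  then have 2: "(\<Sum>s\<in>B. \<Sum>t\<in>B. mu s * mu t * N t) = 0" using assms by (simp add: sum_distrib_right[symmetric])
  have 3: "(\<Sum>s\<in>B. \<Sum>t\<in>B. mu s * mu t * (\<Sum>i<d. q s i * q t i)) = (\<Sum>i<d. (\<Sum>s\<in>B. mu s * q s i)\<^sup>2)"
  proof -
    have "(\<Sum>s\<in>B. \<Sum>t\<in>B. mu s * mu t * (\<Sum>i<d. q s i * q t i))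
        = (\<Sum>s\<in>B. \<Sum>t\<in>B. \<Sum>i<d. (mu s * q s i) * (mu t * q t i))"
      by (simp add: sum_distrib_left mult_ac)
    also have "\<dots> = (\<Sum>s\<in>B. \<Sum>i<d. \<Sum>t\<in>B. (mu s * q s i) * (mu t * q t i))"
      by (intro sum.cong refl sum.swap)
    also have "\<dots> = (\<Sum>i<d. \<Sum>s\<in>B. \<Sum>t\<in>B. (mu s * q s i) * (mu t * q t i))" by (rule sum.swap)
    also have "\<dots> = (\<Sum>i<d. (\<Sum>s\<in>B. mu s * q s i)\<^sup>2)" by (simp add: power2_eq_square sum_product)
    finally show ?thesis .
  qed
  have "(\<Sum>s\<in>B. \<Sum>t\<in>B. mu s * mu t * dist2 d (q s) (q t)) =
      (\<Sum>s\<in>B. \<Sum>t\<in>B. mu s * mu t * N s) + (\<Sum>s\<in>B. \<Sum>t\<in>B. mu s * mu t * N t)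
      - 2 * (\<Sum>s\<in>B. \<Sum>t\<in>B. mu s * mu t * (\<Sum>i<d. q s i * q t i))"
    by (simp add: dist distrib_left right_diff_distrib sum.distrib sum_subtractf sum_distrib_left mult_ac)
  then show ?thesis using 1 2 3 by simp
qed

lemma congruent_combination_zero:
  assumes "finite B" "(\<Sum>s\<in>B. mu s) = (0::real)"
    and D: "\<And>s t. s \<in> B \<Longrightarrow> t \<in> B \<Longrightarrow> dist2 d (q s) (q t) = dist2 d (p s) (p t)"
    and 0: "\<And>i. i < d \<Longrightarrow> (\<Sum>s\<in>B. mu s * p s i) = 0" and i: "i < d"
  shows "(\<Sum>s\<in>B. mu s * q s i) = 0"
proof -
  have "2 * (\<Sum>i<d. (\<Sum>s\<in>B. mu s * q s i)\<^sup>2) = 2 * (\<Sum>i<d. (\<Sum>s\<in>B. mu s * p s i)\<^sup>2)"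
    unfolding zero_weight_norm[OF assms(1,2)] using D by (intro arg_cong[where f = uminus] sum.cong) auto
  then have "(\<Sum>i<d. (\<Sum>s\<in>B. mu s * q s i)\<^sup>2) = 0" using 0 by simp
  then show ?thesis using i by (simp add: sum_nonneg_eq_0_iff)
qed

text \<open>A configuration congruent to \<open>p\<close> need not be generic, but it has the same
  affine dependencies and therefore the same barycentric coordinates. This carries over motions with
  their strains and the spanning property without constructing an isometry.\<close>

lemma congruent_transfer:
  assumes gen: "generic n d p" and dn: "d < n"
    and D: "\<And>u v. u < n \<Longrightarrow> v < n \<Longrightarrow> dist2 d (q u) (q v) = dist2 d (p u) (p v)"
  shows "\<exists>m'. \<forall>u<n. \<forall>v<n. strain d p m' u v = strain d q m u v"
    and "(\<And>u v. u < n \<Longrightarrow> v < n \<Longrightarrow> (\<Sum>i<d. (q u i - q v i) * w i) = 0) \<Longrightarrow> i < d \<Longrightarrow> w i = 0"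
proof -
  obtain B l where B: "B \<subseteq> {0..<n}" "card B = Suc d" and l1: "\<And>x. x < n \<Longrightarrow> (\<Sum>s\<in>B. l x s) = (1::real)"
    and lp: "\<And>x i. x < n \<Longrightarrow> i < d \<Longrightarrow> p x i = (\<Sum>s\<in>B. l x s * p s i)"
    and lind: "\<And>mu t. (\<And>i. i < d \<Longrightarrow> (\<Sum>s\<in>B. mu s * p s i) = 0) \<Longrightarrow> (\<Sum>s\<in>B. mu s) = 0 \<Longrightarrow> t \<in> B \<Longrightarrow> mu t = (0::real)"
    by (rule barycentric_coordinates[OF gen dn]) blast
  have fB: "finite B" using B(1) finite_subset by blast
  have Bn: "s < n" if "s \<in> B" for s using B(1) that by auto
  have lq: "q x i = (\<Sum>s\<in>B. l x s * q s i)" if x: "x < n" and i: "i < d" for x i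
  proof -
    \<comment> \<open>The affine dependence expressing \<open>x\<close> through \<open>B\<close>; it
      is written as a difference so that it also covers \<open>x \<in> B\<close>, where it is zero
      at \<open>x\<close> by cancellation.\<close>
    define mu where "mu s = (if s \<in> B then l x s else 0) - (if s = x then 1 else 0)" for s
    have fin: "finite (insert x B)" using fB by simp
    have msum: "(\<Sum>s\<in>insert x B. mu s * h s) = (\<Sum>s\<in>B. l x s * h s) - h x" for h :: "nat \<Rightarrow> real"
    proof -
      have "(\<Sum>s\<in>insert x B. (if s \<in> B then l x s else 0) * h s) = (\<Sum>s\<in>B. l x s * h s)"
        using fin by (intro sum.mono_neutral_cong_right) auto
      moreover have "(\<Sum>s\<in>insert x B. (if s = x then 1 else 0) * h s) = (\<Sum>s\<in>insert x B. if s = x then h s else 0)"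
        by (rule sum.cong) auto
      ultimately show ?thesis using fin by (simp add: mu_def left_diff_distrib sum_subtractf)
    qed
    have "(\<Sum>s\<in>insert x B. mu s * q s i) = 0"
    proof (rule congruent_combination_zero[OF fin _ _ _ i])
      show "(\<Sum>s\<in>insert x B. mu s) = 0" using msum[of "\<lambda>_. 1"] l1[OF x] by simp
      show "dist2 d (q s) (q t) = dist2 d (p s) (p t)" if "s \<in> insert x B" "t \<in> insert x B" for s t
        using that Bn x by (intro D) auto
      show "(\<Sum>s\<in>insert x B. mu s * p s i) = 0" if "i < d" for i
        using lp[OF x that] by (simp add: msum)
    qed
    then show ?thesis by (simp add: msum)
  qed
  show "\<exists>m'. \<forall>u<n. \<forall>v<n. strain d p m' u v = strain d q m u v"
  proof -
    \<comment> \<open>On \<open>B\<close> the inner product of the velocity \<open>m x\<close> with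
      \<open>q s\<close> is rewritten as an affine function of \<open>p s\<close>. Its linear part
      is the transferred velocity; the constant drops out of strains because the weights
      \<open>l u s - l v s\<close> sum to 0.\<close>
    have "\<exists>w c. \<forall>s\<in>B. (\<Sum>i<d. w i * p s i) + c = (\<Sum>i<d. m x i * q s i)" for x
      by (rule generic_affine_interpolation[OF gen B])
    then obtain m' c where m': "\<And>x s. s \<in> B \<Longrightarrow> (\<Sum>i<d. m' x i * p s i) + c x = (\<Sum>i<d. m x i * q s i)"
      by metis
    have "strain d p m' u v = strain d q m u v" if uv: "u < n" "v < n" for u v
    proof -
      have expand: "strain d r h u v = (\<Sum>s\<in>B. (l u s - l v s) * ((\<Sum>i<d. h u i * r s i) - (\<Sum>i<d. h v i * r s i)))"
        if r: "\<And>x i. x < n \<Longrightarrow> i < d \<Longrightarrow> r x i = (\<Sum>s\<in>B. l x s * r s i)" for r h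
      proof -
        have "strain d r h u v = (\<Sum>i<d. \<Sum>s\<in>B. (l u s - l v s) * r s i * (h u i - h v i))"
          unfolding strain_def using r[OF uv(1)] r[OF uv(2)]
          by (intro sum.cong refl) (simp add: sum_subtractf[symmetric] sum_distrib_right left_diff_distrib)
        also have "\<dots> = (\<Sum>s\<in>B. \<Sum>i<d. (l u s - l v s) * r s i * (h u i - h v i))" by (rule sum.swap)
        also have "\<dots> = (\<Sum>s\<in>B. (l u s - l v s) * ((\<Sum>i<d. h u i * r s i) - (\<Sum>i<d. h v i * r s i)))"
          by (simp add: sum_subtractf[symmetric] sum_distrib_left left_diff_distrib[symmetric] mult_ac)
        finally show ?thesis .
      qed
      have "strain d q m u v = (\<Sum>s\<in>B. (l u s - l v s) *
          (((\<Sum>i<d. m' u i * p s i) + c u) - ((\<Sum>i<d. m' v i * p s i) + c v)))"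
      proof -
        have "strain d q m u v = (\<Sum>s\<in>B. (l u s - l v s) * ((\<Sum>i<d. m u i * q s i) - (\<Sum>i<d. m v i * q s i)))"
          by (rule expand) (rule lq)
        then show ?thesis by (simp add: m')
      qed
      also have "\<dots> = (\<Sum>s\<in>B. (l u s - l v s) * ((\<Sum>i<d. m' u i * p s i) - (\<Sum>i<d. m' v i * p s i))
           + (l u s - l v s) * (c u - c v))"
        by (intro sum.cong refl) (simp add: algebra_simps)
      also have "\<dots> = strain d p m' u v + (\<Sum>s\<in>B. l u s - l v s) * (c u - c v)"
      proof -
        have "strain d p m' u v = (\<Sum>s\<in>B. (l u s - l v s) * ((\<Sum>i<d. m' u i * p s i) - (\<Sum>i<d. m' v i * p s i)))"
          by (rule expand) (rule lp)
        then show ?thesis by (simp add: sum.distrib sum_distrib_right)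
      qed
      also have "(\<Sum>s\<in>B. l u s - l v s) = 0" using l1 uv by (simp add: sum_subtractf)
      finally show ?thesis by simp
    qed
    then show ?thesis by blast
  qed
  assume w: "\<And>u v. u < n \<Longrightarrow> v < n \<Longrightarrow> (\<Sum>i<d. (q u i - q v i) * w i) = 0" and i: "i < d"
  show "w i = 0"
  proof (rule ccontr)
    assume wi: "w i \<noteq> 0"
    have "B \<noteq> {}" using B(2) by auto
    then obtain r where r: "r \<in> B" by blast
    \<comment> \<open>These are \<open>d - 1\<close> equations for weights on \<open>d\<close>
      points, so a nonzero solution exists; the missing equation for coordinate \<open>i\<close>
      then follows from orthogonality to \<open>w\<close>, as \<open>w i\<close> is nonzero.\<close>
    define T where "T = (\<lambda>j s. q s j - q r j) ` ({..<d} - {i})"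
    have "card T \<le> card ({..<d} - {i})" unfolding T_def by (rule card_image_le) simp
    also have "\<dots> < card (B - {r})" using i r B(2) fB by (simp add: card_Diff_singleton)
    finally have "card T < card (B - {r})" .
    moreover have "finite T" unfolding T_def by (intro finite_imageI finite_Diff finite_lessThan)
    ultimately obtain mu where mu: "mu \<in> supp_in (B - {r})" "mu \<noteq> 0" "\<And>t. t \<in> T \<Longrightarrow> ip (B - {r}) t mu = 0"
      using annih_nonzero[OF finite_Diff[OF fB], where T = T] by metis
    have memT: "(\<lambda>s. q s j - q r j) \<in> T" if "j < d" "j \<noteq> i" for j
      unfolding T_def by (rule imageI) (use that in simp)
    have mq: "(\<Sum>s\<in>B - {r}. mu s * (q s j - q r j)) = 0" if j: "j < d" for j
    proof (cases "j = i")
      case False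
      have "ip (B - {r}) (\<lambda>s. q s j - q r j) mu = 0" by (rule mu(3)[OF memT[OF j False]])
      then show ?thesis by (simp add: ip_def mult.commute)
    next
      case True
      let ?h = "\<lambda>j. \<Sum>s\<in>B - {r}. mu s * (q s j - q r j)"
      have other: "?h j = 0" if "j < d" "j \<noteq> i" for j
      proof -
        have "ip (B - {r}) (\<lambda>s. q s j - q r j) mu = 0" by (rule mu(3)[OF memT[OF that]])
        then show ?thesis by (simp add: ip_def mult.commute)
      qed
      have "(\<Sum>j<d. ?h j * w j) = (\<Sum>s\<in>B - {r}. mu s * (\<Sum>j<d. (q s j - q r j) * w j))"
        by (simp only: sum_distrib_right sum_distrib_left mult.assoc) (rule sum.swap)
      also have "\<dots> = 0" using w Bn r by (intro sum.neutral) auto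
      also have "(\<Sum>j<d. ?h j * w j) = ?h i * w i"
        using i other by (subst sum.remove[of _ i]) auto
      finally show ?thesis using wi True by simp
    qed
    define mu' where "mu' s = (if s = r then - (\<Sum>s\<in>B - {r}. mu s) else mu s)" for s
    have msum: "(\<Sum>s\<in>B. mu' s * h s) = (\<Sum>s\<in>B - {r}. mu s * (h s - h r))" for h :: "nat \<Rightarrow> real"
    proof -
      have "(\<Sum>s\<in>B. mu' s * h s) = mu' r * h r + (\<Sum>s\<in>B - {r}. mu' s * h s)"
        using fB r by (rule sum.remove)
      also have "(\<Sum>s\<in>B - {r}. mu' s * h s) = (\<Sum>s\<in>B - {r}. mu s * h s)"
        by (rule sum.cong) (auto simp: mu'_def)
      finally show ?thesis by (simp add: mu'_def right_diff_distrib sum_subtractf sum_distrib_right)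
    qed
    have m0: "(\<Sum>s\<in>B. mu' s) = 0" using msum[of "\<lambda>_. 1"] by simp
    have "mu' t = 0" if "t \<in> B" for t
    proof (rule lind[OF _ m0 that])
      show "(\<Sum>s\<in>B. mu' s * p s j) = 0" if "j < d" for j
      proof (rule congruent_combination_zero[OF fB m0 _ _ that, where q = p and p = q])
        show "dist2 d (p s) (p t) = dist2 d (q s) (q t)" if "s \<in> B" "t \<in> B" for s t
          using D Bn that by simp
        show "(\<Sum>s\<in>B. mu' s * q s i) = 0" if "i < d" for i
          using mq[OF that] by (simp add: msum)
      qed
    qed
    then have "mu s = 0" if "s \<in> B - {r}" for s using that by (metis DiffE insertI1 mu'_def)
    then have "mu s = 0" for s using supp_inD[OF mu(1), of s] by (cases "s \<in> B - {r}") auto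
    then show False using mu(2) by auto
  qed
qed

text \<open>Let \<open>s x y\<close> be the inner product of the centred point \<open>Q x\<close>
  with \<open>m y\<close>. Vanishing strain makes \<open>s\<close> skew, while balance against
  rotations makes \<open>H\<close> symmetric. The squares of both matrices have the same trace,
  which is thus nonpositive and nonnegative; hence \<open>s = 0\<close>, and every
  \<open>m y\<close> is orthogonal to all differences of points.\<close>

lemma balanced_motion_zero:
  fixes q m :: "nat \<Rightarrow> nat \<Rightarrow> real"
  assumes span: "\<And>w i. (\<And>u v. u < n \<Longrightarrow> v < n \<Longrightarrow> (\<Sum>i<d. (q u i - q v i) * w i) = 0) \<Longrightarrow> i < d \<Longrightarrow> w i = 0"
    and st: "\<And>u v. u < n \<Longrightarrow> v < n \<Longrightarrow> strain d q m u v = 0"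
    and tr: "\<And>i. i < d \<Longrightarrow> (\<Sum>x<n. m x i) = 0"
    and ro: "\<And>i j. i < d \<Longrightarrow> j < d \<Longrightarrow> (\<Sum>x<n. m x i * q x j - m x j * q x i) = 0"
    and y: "y < n" and i: "i < d"
  shows "m y i = 0"
proof -
  have n: "real n > 0" using y by simp
  define c where "c i = (\<Sum>x<n. q x i) / n" for i
  define Q where "Q x i = q x i - c i" for x i
  define s where "s x y = (\<Sum>i<d. Q x i * m y i)" for x y
  define H where "H i j = (\<Sum>x<n. Q x i * m x j)" for i j
  have cen: "(\<Sum>x<n. Q x i) = 0" for i using n by (simp add: Q_def c_def sum_subtractf)
  have s1: "(\<Sum>v<n. s u v) = 0" for u
  proof -
    have "(\<Sum>v<n. s u v) = (\<Sum>i<d. Q u i * (\<Sum>v<n. m v i))"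
      unfolding s_def by (subst sum.swap) (simp add: sum_distrib_left)
    then show ?thesis using tr by simp
  qed
  have s2: "(\<Sum>v<n. s v u) = 0" for u
  proof -
    have "(\<Sum>v<n. s v u) = (\<Sum>i<d. (\<Sum>v<n. Q v i) * m u i)"
      unfolding s_def by (subst sum.swap) (simp add: sum_distrib_right)
    then show ?thesis using cen by simp
  qed
  have quad: "s u u - s u v - s v u + s v v = 0" if "u < n" "v < n" for u v
  proof -
    have "strain d q m u v = s u u - s u v - s v u + s v v"
      by (simp add: strain_def s_def Q_def sum_subtractf[symmetric] sum.distrib[symmetric])
        (simp add: algebra_simps)
    then show ?thesis using st[OF that] by simp
  qed
  define T where "T = (\<Sum>v<n. s v v)"
  \<comment> \<open>The strain equations are summed over \<open>v\<close>; the mixed terms vanish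
    because positions are centred and velocities sum to 0.\<close>
  have diag: "real n * s u u + T = 0" if "u < n" for u
  proof -
    have "(\<Sum>v<n. s u u - s u v - s v u + s v v) = 0" using quad[OF that] by simp
    then show ?thesis by (simp add: sum.distrib sum_subtractf s1 s2 T_def)
  qed
  have "(\<Sum>u<n. real n * s u u + T) = 0" using diag by simp
  then have "2 * real n * T = 0" by (simp add: sum.distrib T_def sum_distrib_left[symmetric])
  then have "T = 0" using n by simp
  then have "s u u = 0" if "u < n" for u using diag[OF that] n by simp
  then have skew: "s u v = - s v u" if "u < n" "v < n" for u v using quad[OF that] that by simp
  have sym: "H i j = H j i" if ij: "i < d" "j < d" for i j
  proof -
    have "H i j - H j i = (\<Sum>x<n. m x j * q x i - m x i * q x j) - c i * (\<Sum>x<n. m x j) + c j * (\<Sum>x<n. m x i)"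
      by (simp add: H_def Q_def sum_distrib_left sum_subtractf[symmetric] sum.distrib[symmetric] algebra_simps)
    then show ?thesis using ro[OF ij(2,1)] tr ij by simp
  qed
  have "(\<Sum>x<n. \<Sum>y<n. s x y * s y x) = (\<Sum>i<d. \<Sum>j<d. H i j * H j i)"
  proof -
    have "(\<Sum>x<n. \<Sum>y<n. s x y * s y x) = (\<Sum>x<n. \<Sum>y<n. \<Sum>i<d. \<Sum>j<d. (Q x i * m x j) * (Q y j * m y i))"
      by (simp add: s_def sum_product mult_ac)
    also have "\<dots> = (\<Sum>x<n. \<Sum>i<d. \<Sum>j<d. \<Sum>y<n. (Q x i * m x j) * (Q y j * m y i))"
      by (subst (3) sum.swap) (subst (2) sum.swap, rule refl)
    also have "\<dots> = (\<Sum>i<d. \<Sum>j<d. \<Sum>x<n. \<Sum>y<n. (Q x i * m x j) * (Q y j * m y i))"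
      by (subst (2) sum.swap) (subst (1) sum.swap, rule refl)
    also have "\<dots> = (\<Sum>i<d. \<Sum>j<d. H i j * H j i)" by (simp add: H_def sum_product)
    finally show ?thesis .
  qed
  also have "\<dots> = (\<Sum>i<d. \<Sum>j<d. (H i j)\<^sup>2)"
    by (intro sum.cong refl) (simp add: power2_eq_square sym[symmetric])
  also have "\<dots> \<ge> 0" by (simp add: sum_nonneg)
  finally have "0 \<le> (\<Sum>x<n. \<Sum>y<n. s x y * s y x)" .
  also have "\<dots> = - (\<Sum>x<n. \<Sum>y<n. (s x y)\<^sup>2)"
  proof -
    have "s x y * s y x = - (s x y)\<^sup>2" if "x < n" "y < n" for x y
      using skew[OF that] by (simp add: power2_eq_square)
    then show ?thesis by (simp add: sum_negf[symmetric])
  qed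
  finally have "(\<Sum>x<n. \<Sum>y<n. (s x y)\<^sup>2) \<le> 0" by simp
  then have "(\<Sum>x<n. \<Sum>y<n. (s x y)\<^sup>2) = 0" by (intro antisym) (simp_all add: sum_nonneg)
  then have s0: "s x y = 0" if "x < n" "y < n" for x y
    using that by (simp add: sum_nonneg_eq_0_iff sum_nonneg)
  show ?thesis
  proof (rule span[OF _ i, of "m y"])
    fix u v assume uv: "u < n" "v < n"
    have "(\<Sum>i<d. (q u i - q v i) * m y i) = s u y - s v y"
      by (simp add: s_def Q_def sum_subtractf[symmetric] algebra_simps)
    then show "(\<Sum>i<d. (q u i - q v i) * m y i) = 0" using s0 uv y by simp
  qed
qed

text \<open>Bolzano-Weierstrass for one coordinate at a time, passing to successive
  subsequences.\<close>

lemma common_convergent_subsequence: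
  fixes z :: "nat \<Rightarrow> 'a \<Rightarrow> real"
  assumes "finite A" "\<And>j a. a \<in> A \<Longrightarrow> \<bar>z j a\<bar> \<le> 1"
  shows "\<exists>r l. strict_mono (r :: nat \<Rightarrow> nat) \<and> (\<forall>a\<in>A. (\<lambda>j. z (r j) a) \<longlonglongrightarrow> l a)"
  using assms
proof (induction A rule: finite_induct)
  case empty
  show ?case by (intro exI[of _ id]) (auto simp: strict_mono_def)
next
  case (insert a A)
  obtain r l where r: "strict_mono (r :: nat \<Rightarrow> nat)" and l: "\<And>b. b \<in> A \<Longrightarrow> (\<lambda>j. z (r j) b) \<longlonglongrightarrow> l b"
    using insert.IH insert.prems by blast
  have "bounded (range (\<lambda>j. z (r j) a))"
    unfolding bounded_iff using insert.prems by (intro exI[of _ 1]) auto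
  then obtain r' l' where r': "strict_mono (r' :: nat \<Rightarrow> nat)" and l': "((\<lambda>j. z (r j) a) \<circ> r') \<longlonglongrightarrow> l'"
    using bounded_imp_convergent_subsequence by blast
  have "(\<lambda>j. z ((r \<circ> r') j) b) \<longlonglongrightarrow> (l(a := l')) b" if "b \<in> insert a A" for b
  proof (cases "b = a")
    case True
    then show ?thesis using l' by (simp add: o_def)
  next
    case False
    then have "(\<lambda>j. z (r j) b) \<longlonglongrightarrow> l b" using l that by blast
    from LIMSEQ_subseq_LIMSEQ[OF this r'] show ?thesis using False by (simp add: o_def)
  qed
  then show ?case using strict_mono_o[OF r r'] by blast
qed

text \<open>Projecting off the translations \<open>tau i\<close> and the infinitesimal rotations
  \<open>rho (i, k)\<close> changes no strain and makes the field balanced. The one nonzero strain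
  ensures that a nonzero field remains to be scaled to norm 1.\<close>

lemma normalised_balanced_motion:
  assumes zero: "\<And>u v. R u v \<Longrightarrow> strain d a m u v = 0"
    and nz: "u0 < n" "v0 < n" "strain d a m u0 v0 \<noteq> 0"
  shows "\<exists>z. (\<forall>u v. R u v \<longrightarrow> u < n \<longrightarrow> v < n \<longrightarrow> strain d a z u v = 0) \<and> (\<forall>i<d. (\<Sum>x<n. z x i) = 0) \<and>
     (\<forall>i<d. \<forall>k<d. (\<Sum>x<n. z x i * a x k - z x k * a x i) = 0) \<and> (\<Sum>x<n. \<Sum>i<d. (z x i)\<^sup>2) = 1"
proof -
  let ?A = "{..<n} \<times> {..<d}"
  have fA: "finite ?A" by simp
  define tau :: "nat \<Rightarrow> nat \<times> nat \<Rightarrow> real" where "tau i = (\<lambda>(x, j). if j = i then 1 else 0)" for i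
  define rho where "rho = (\<lambda>(i, k) (x, j). (if j = i then a x k else 0) - (if j = k then a x i else 0))"
  define T where "T = tau ` {..<d} \<union> rho ` ({..<d} \<times> {..<d})"
  have fT: "finite T" by (simp add: T_def)
  define h where "h = (\<lambda>(x, i). m x i)"
  obtain t where t: "t \<in> span T" and orth: "\<And>s. s \<in> span T \<Longrightarrow> ip ?A s (h - t) = 0"
    using orthogonal_projection[OF fA fT, of h] by metis
  define z where "z x i = m x i - t (x, i)" for x i
  have hz: "h - t = (\<lambda>(x, i). z x i)" by (auto simp: h_def z_def fun_eq_iff)
  have ip_sum: "ip ?A s (h - t) = (\<Sum>x<n. \<Sum>i<d. s (x, i) * z x i)" for s
    by (simp add: ip_def hz sum.cartesian_product case_prod_unfold)
  have tauT: "tau i \<in> span T" if "i < d" for i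
    by (rule span_base) (simp only: T_def, rule UnI1, rule imageI, use that in simp)
  have rhoT: "rho (i, k) \<in> span T" if "i < d" "k < d" for i k
    by (rule span_base) (simp only: T_def, rule UnI2, rule imageI, use that in simp)
  have pick: "(\<Sum>j<d. (if j = i then b else 0) * g j) = b * g i" if "i < d" for i b and g :: "nat \<Rightarrow> real"
  proof -
    have "(\<Sum>j<d. (if j = i then b else 0) * g j) = (\<Sum>j<d. if j = i then b * g j else 0)"
      by (rule sum.cong) auto
    then show ?thesis using that by simp
  qed
  have tr: "(\<Sum>x<n. z x i) = 0" if "i < d" for i
    using orth[OF tauT[OF that]] that by (simp add: ip_sum tau_def pick)
  have ro: "(\<Sum>x<n. z x i * a x k - z x k * a x i) = 0" if "i < d" "k < d" for i k
  proof -
    have "ip ?A (rho (i, k)) (h - t) = (\<Sum>x<n. (\<Sum>j<d. (if j = i then a x k else 0) * z x j)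
        - (\<Sum>j<d. (if j = k then a x i else 0) * z x j))"
      unfolding ip_sum sum_subtractf[symmetric] by (simp add: rho_def left_diff_distrib)
    then have "(\<Sum>x<n. a x k * z x i - a x i * z x k) = 0"
      using orth[OF rhoT[OF that]] by (simp only: pick[OF that(1)] pick[OF that(2)])
    then show ?thesis by (simp only: mult.commute)
  qed
  have t0: "strain d a (\<lambda>x i. t (x, i)) u v = 0" for u v
  proof -
    define S where "S = {g :: nat \<times> nat \<Rightarrow> real. strain d a (\<lambda>x i. g (x, i)) u v = 0}"
    have "subspace S"
    proof (rule subspaceI)
      show "0 \<in> S" by (simp add: S_def strain_def)
    next
      fix g g' assume "g \<in> S" "g' \<in> S"
      then have "strain d a (\<lambda>x i. g (x, i)) u v + strain d a (\<lambda>x i. g' (x, i)) u v = 0" by (simp add: S_def)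
      then show "g + g' \<in> S" by (simp add: S_def strain_def sum.distrib[symmetric] algebra_simps)
    next
      fix c g assume "g \<in> S"
      then have "c * strain d a (\<lambda>x i. g (x, i)) u v = 0" by (simp add: S_def)
      then show "c *\<^sub>R g \<in> S" by (simp add: S_def strain_def sum_distrib_left algebra_simps)
    qed
    moreover have "T \<subseteq> S"
    proof (rule subsetI)
      fix g assume "g \<in> T"
      then consider i where "i < d" "g = tau i" | i k where "i < d" "k < d" "g = rho (i, k)"
        unfolding T_def by (elim UnE imageE) auto
      then show "g \<in> S"
      proof cases
        case 1
        then show ?thesis by (simp add: S_def strain_def tau_def)
      next
        case 2
        have "strain d a (\<lambda>x j. rho (i, k) (x, j)) u v =
            (\<Sum>j<d. (if j = i then a u k - a v k else 0) * (a u j - a v j)) -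
            (\<Sum>j<d. (if j = k then a u i - a v i else 0) * (a u j - a v j))"
          unfolding strain_def sum_subtractf[symmetric]
          by (rule sum.cong) (auto simp: rho_def algebra_simps)
        then show ?thesis using 2 by (simp add: S_def pick)
      qed
    qed
    ultimately have "span T \<subseteq> S" by (rule span_minimal[rotated])
    then have "t \<in> S" using t by (rule subsetD)
    then show ?thesis by (simp add: S_def)
  qed
  have zm: "strain d a z u v = strain d a m u v" for u v
  proof -
    have "strain d a z u v = strain d a m u v - strain d a (\<lambda>x i. t (x, i)) u v"
      by (simp add: strain_def z_def sum_subtractf[symmetric] algebra_simps)
    then show ?thesis using t0 by simp
  qed
  define N where "N = (\<Sum>x<n. \<Sum>i<d. (z x i)\<^sup>2)"
  have "N \<noteq> 0"
  proof
    assume "N = 0"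
    then have "z x i = 0" if "x < n" "i < d" for x i
      using that by (simp add: N_def sum_nonneg_eq_0_iff sum_nonneg)
    then have "strain d a z u0 v0 = 0" using nz by (simp add: strain_def)
    then show False using nz zm by simp
  qed
  moreover have "N \<ge> 0" by (simp add: N_def sum_nonneg)
  ultimately have N: "N > 0" by simp
  define r where "r = 1 / sqrt N"
  have r2: "r\<^sup>2 * N = 1" using N by (simp add: r_def power_divide)
  show ?thesis
  proof (intro exI[of _ "\<lambda>x i. r * z x i"] conjI allI impI)
    show "strain d a (\<lambda>x i. r * z x i) u v = 0" if "R u v" for u v
    proof -
      have "strain d a (\<lambda>x i. r * z x i) u v = r * strain d a z u v"
        by (simp add: strain_def sum_distrib_left algebra_simps)
      then show ?thesis using zero[OF that] zm by simp
    qed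
    show "(\<Sum>x<n. r * z x i) = 0" if "i < d" for i
      using tr[OF that] by (simp add: sum_distrib_left[symmetric])
    show "(\<Sum>x<n. r * z x i * a x k - r * z x k * a x i) = 0" if "i < d" "k < d" for i k
    proof -
      have "(\<Sum>x<n. r * z x i * a x k - r * z x k * a x i) = r * (\<Sum>x<n. z x i * a x k - z x k * a x i)"
        by (simp add: sum_distrib_left algebra_simps)
      then show ?thesis using ro[OF that] by simp
    qed
    show "(\<Sum>x<n. \<Sum>i<d. (r * z x i)\<^sup>2) = 1"
      using r2 by (simp add: N_def power_mult_distrib sum_distrib_left)
  qed
qed

text \<open>The averaging trick: the difference of two configurations with equal edge lengths is an
  infinitesimal motion of their midpoint, so a sequence of non-congruent solutions would have a
  non-trivial infinitesimal motion as its rescaled limit.\<close>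
lemma nearby_solution_congruent:
  assumes gen: "generic n d p" and dn: "d < n"
    and inf: "\<And>m. (\<And>u v. u < n \<Longrightarrow> v < n \<Longrightarrow> {u, v} \<in> E \<Longrightarrow> strain d p m u v = 0) \<Longrightarrow> trivial_motion n d p m"
    and D0: "\<And>u v. u < n \<Longrightarrow> v < n \<Longrightarrow> dist2 d (q0 u) (q0 v) = dist2 d (p u) (p v)"
    and lim: "\<And>v i. v < n \<Longrightarrow> i < d \<Longrightarrow> (\<lambda>j. q j v i) \<longlonglongrightarrow> q0 v i"
    and edges: "\<And>j u v. u < n \<Longrightarrow> v < n \<Longrightarrow> {u, v} \<in> E \<Longrightarrow> dist2 d (q j u) (q j v) = dist2 d (p u) (p v)"
  shows "\<exists>j::nat. \<forall>u<n. \<forall>v<n. dist2 d (q j u) (q j v) = dist2 d (p u) (p v)"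
proof (rule ccontr)
  assume neg: "\<not> ?thesis"
  define a where "a j v i = (q j v i + q0 v i) / 2" for j v i
  \<comment> \<open>Coordinatewise \<open>x^2 - y^2 = (x + y) * (x - y)\<close> for the edge vectors
    of the two configurations.\<close>
  have mid: "2 * strain d (a j) (\<lambda>v i. q j v i - q0 v i) u v = dist2 d (q j u) (q j v) - dist2 d (q0 u) (q0 v)" for j u v
    unfolding strain_def dist2_def sum_distrib_left sum_subtractf[symmetric]
    by (rule sum.cong) (auto simp: a_def power2_eq_square field_simps)
  define R where "R u v \<longleftrightarrow> u < n \<and> v < n \<and> {u, v} \<in> E" for u v
  define P where "P j z \<longleftrightarrow> (\<forall>u v. R u v \<longrightarrow> u < n \<longrightarrow> v < n \<longrightarrow> strain d (a j) z u v = 0) \<and>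
     (\<forall>i<d. (\<Sum>x<n. z x i) = 0) \<and> (\<forall>i<d. \<forall>k<d. (\<Sum>x<n. z x i * a j x k - z x k * a j x i) = 0) \<and>
     (\<Sum>x<n. \<Sum>i<d. (z x i)\<^sup>2) = 1" for j z
  have "\<exists>z. P j z" for j
  proof -
    obtain u v where uv: "u < n" "v < n" "dist2 d (q j u) (q j v) \<noteq> dist2 d (p u) (p v)"
      using neg by blast
    show ?thesis unfolding P_def
    proof (rule normalised_balanced_motion[OF _ uv(1,2)])
      show "strain d (a j) (\<lambda>v i. q j v i - q0 v i) x y = 0" if "R x y" for x y
        using mid[of j x y] edges[of x y j] D0[of x y] that by (simp add: R_def)
      show "strain d (a j) (\<lambda>v i. q j v i - q0 v i) u v \<noteq> 0"
        using mid[of j u v] D0[OF uv(1,2)] uv(3) by auto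
    qed
  qed
  then obtain z where z: "\<And>j. P j (z j)" by metis
  have ze: "strain d (a j) (z j) u v = 0" if "R u v" for j u v
    using z[of j] that unfolding P_def by (simp add: R_def)
  have ztr: "(\<Sum>x<n. z j x i) = 0" if "i < d" for j i using z[of j] that unfolding P_def by blast
  have zro: "(\<Sum>x<n. z j x i * a j x k - z j x k * a j x i) = 0" if "i < d" "k < d" for j i k
    using z[of j] that unfolding P_def by blast
  have z1: "(\<Sum>x<n. \<Sum>i<d. (z j x i)\<^sup>2) = 1" for j using z[of j] unfolding P_def by blast
  have bd: "\<bar>z j x i\<bar> \<le> 1" if "x < n" "i < d" for j x i
  proof -
    have "(z j x i)\<^sup>2 \<le> (\<Sum>i<d. (z j x i)\<^sup>2)"
      using that by (intro member_le_sum) auto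
    also have "\<dots> \<le> (\<Sum>x<n. \<Sum>i<d. (z j x i)\<^sup>2)"
      using that by (intro member_le_sum[of x "{..<n}" "\<lambda>x. \<Sum>i<d. (z j x i)\<^sup>2"]) (auto intro: sum_nonneg)
    finally show ?thesis by (simp add: z1 abs_square_le_1)
  qed
  have "\<exists>r l. strict_mono (r :: nat \<Rightarrow> nat) \<and>
      (\<forall>e\<in>{..<n} \<times> {..<d}. (\<lambda>j. z (r j) (fst e) (snd e)) \<longlonglongrightarrow> l e)"
    using bd by (intro common_convergent_subsequence[where z = "\<lambda>j e. z j (fst e) (snd e)"]) auto
  then obtain r l where r: "strict_mono (r :: nat \<Rightarrow> nat)"
    and l: "\<And>e. e \<in> {..<n} \<times> {..<d} \<Longrightarrow> (\<lambda>j. z (r j) (fst e) (snd e)) \<longlonglongrightarrow> l e" by blast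
  define y where "y x i = l (x, i)" for x i
  have zl: "(\<lambda>j. z (r j) x i) \<longlonglongrightarrow> y x i" if "x < n" "i < d" for x i
    using l[of "(x, i)"] that by (simp add: y_def)
  have al: "(\<lambda>j. a (r j) x i) \<longlonglongrightarrow> q0 x i" if "x < n" "i < d" for x i
  proof -
    have "(\<lambda>j. (q (r j) x i + q0 x i) / 2) \<longlonglongrightarrow> (q0 x i + q0 x i) / 2"
      using LIMSEQ_subseq_LIMSEQ[OF lim[OF that] r] by (intro tendsto_intros) (simp_all add: o_def)
    then show ?thesis by (simp add: a_def)
  qed
  have const_lim: "L = c" if "g \<longlonglongrightarrow> L" "\<And>j. g j = c" for g :: "nat \<Rightarrow> real" and L c
  proof -
    have "g = (\<lambda>_. c)" using that(2) by (rule ext)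
    then show ?thesis using LIMSEQ_unique[OF that(1)] tendsto_const by metis
  qed
  have ye: "strain d q0 y u v = 0" if "R u v" for u v
  proof (rule const_lim)
    show "(\<lambda>j. strain d (a (r j)) (z (r j)) u v) \<longlonglongrightarrow> strain d q0 y u v"
      unfolding strain_def using that by (intro tendsto_intros al zl) (auto simp: R_def)
    show "strain d (a (r j)) (z (r j)) u v = 0" for j by (rule ze[OF that])
  qed
  have ytr: "(\<Sum>x<n. y x i) = 0" if "i < d" for i
  proof (rule const_lim)
    show "(\<lambda>j. \<Sum>x<n. z (r j) x i) \<longlonglongrightarrow> (\<Sum>x<n. y x i)"
      using that by (intro tendsto_intros zl) auto
  qed (rule ztr[OF that])
  have yro: "(\<Sum>x<n. y x i * q0 x k - y x k * q0 x i) = 0" if "i < d" "k < d" for i k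
  proof (rule const_lim)
    show "(\<lambda>j. \<Sum>x<n. z (r j) x i * a (r j) x k - z (r j) x k * a (r j) x i)
        \<longlonglongrightarrow> (\<Sum>x<n. y x i * q0 x k - y x k * q0 x i)"
      using that by (intro tendsto_intros zl al) auto
  qed (rule zro[OF that])
  have y1: "(\<Sum>x<n. \<Sum>i<d. (y x i)\<^sup>2) = 1"
  proof (rule const_lim)
    show "(\<lambda>j. \<Sum>x<n. \<Sum>i<d. (z (r j) x i)\<^sup>2) \<longlonglongrightarrow> (\<Sum>x<n. \<Sum>i<d. (y x i)\<^sup>2)"
      by (intro tendsto_intros zl) auto
  qed (rule z1)
  \<comment> \<open>The limit field is an infinitesimal motion of \<open>q0\<close>, whereas
    rigidity is assumed at \<open>p\<close>; congruence of the two configurations bridges the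
    gap.\<close>
  obtain m' where m': "\<And>u v. u < n \<Longrightarrow> v < n \<Longrightarrow> strain d p m' u v = strain d q0 y u v"
    using congruent_transfer(1)[OF gen dn D0] by metis
  have "trivial_motion n d p m'" using m' ye by (intro inf) (simp add: R_def)
  then have y0: "strain d q0 y u v = 0" if "u < n" "v < n" for u v
    using m'[OF that] trivial_motion_strain[OF _ that] by metis
  have sp: "w i = 0" if "\<And>u v. u < n \<Longrightarrow> v < n \<Longrightarrow> (\<Sum>i<d. (q0 u i - q0 v i) * w i) = 0" "i < d" for w i
    by (rule congruent_transfer(2)[OF gen dn, of q0]) (rule D0 that; assumption)+
  have "y x i = 0" if "x < n" "i < d" for x i
  proof (rule balanced_motion_zero[where n = n and d = d and q = q0 and m = y, OF _ y0 ytr yro that])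
    show "w i = 0" if "\<And>u v. u < n \<Longrightarrow> v < n \<Longrightarrow> (\<Sum>i<d. (q0 u i - q0 v i) * w i) = 0" "i < d" for w i
      by (rule sp) (rule that; assumption)+
  qed
  then show False using y1 by simp
qed

text \<open>The times of congruence form a nonempty subset of the unit interval that is closed by
  continuity and open by \<open>nearby_solution_congruent\<close>, so connectedness makes it the
  whole interval.\<close>

theorem infinitesimally_rigid_imp_rigid:
  assumes gen: "generic n d p" and dn: "d < n"
    and inf: "\<And>m. (\<And>u v. u < n \<Longrightarrow> v < n \<Longrightarrow> {u, v} \<in> E \<Longrightarrow> strain d p m u v = 0) \<Longrightarrow> trivial_motion n d p m"
  shows "rigid_framework n d E p"
  unfolding rigid_framework_def
proof (intro allI impI, elim conjE)
  fix m :: "real \<Rightarrow> nat \<Rightarrow> nat \<Rightarrow> real"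
  assume "\<forall>v<n. \<forall>i<d. continuous_on {0..1} (\<lambda>t. m t v i)"
    and "\<forall>v<n. \<forall>i<d. m 0 v i = p v i"
    and "\<forall>t\<in>{0..1}. \<forall>u<n. \<forall>v<n. {u, v} \<in> E \<longrightarrow> dist2 d (m t u) (m t v) = dist2 d (p u) (p v)"
  then have cont: "\<And>v i. v < n \<Longrightarrow> i < d \<Longrightarrow> continuous_on {0..1} (\<lambda>t. m t v i)"
    and init: "\<And>v i. v < n \<Longrightarrow> i < d \<Longrightarrow> m 0 v i = p v i"
    and edges: "\<And>t u v. t \<in> {0..1} \<Longrightarrow> u < n \<Longrightarrow> v < n \<Longrightarrow> {u, v} \<in> E \<Longrightarrow>
        dist2 d (m t u) (m t v) = dist2 d (p u) (p v)" by blast+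
  define g where "g t = (\<Sum>u<n. \<Sum>v<n. (dist2 d (m t u) (m t v) - dist2 d (p u) (p v))\<^sup>2)" for t
  have g0: "g t = 0 \<longleftrightarrow> (\<forall>u<n. \<forall>v<n. dist2 d (m t u) (m t v) = dist2 d (p u) (p v))" for t
    by (auto simp: g_def sum_nonneg_eq_0_iff sum_nonneg)
  define S where "S = {t \<in> {0..1}. g t = 0}"
  have "continuous_on {0..1} g"
    unfolding g_def dist2_def by (intro continuous_intros cont) auto
  then have "closedin (top_of_set {0..1}) S"
    unfolding S_def by (rule continuous_closedin_preimage_constant)
  moreover have "openin (top_of_set {0..1}) S"
    unfolding openin_euclidean_subtopology_iff
  proof (intro conjI ballI)
    show "S \<subseteq> {0..1}" by (auto simp: S_def)
    fix t assume t: "t \<in> S"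
    show "\<exists>e>0. \<forall>s\<in>{0..1}. dist s t < e \<longrightarrow> s \<in> S"
    proof (rule ccontr)
      assume "\<not> ?thesis"
      then have "\<exists>s\<in>{0..1}. dist s t < inverse (real (Suc j)) \<and> s \<notin> S" for j
        by (meson inverse_positive_iff_positive of_nat_0_less_iff zero_less_Suc)
      then obtain s where s: "\<And>j. s j \<in> {0..1}" "\<And>j. dist (s j) t < inverse (real (Suc j))" "\<And>j. s j \<notin> S"
        by metis
      have "(\<lambda>j. dist (s j) t) \<longlonglongrightarrow> 0"
        by (rule tendsto_sandwich[OF _ _ tendsto_const LIMSEQ_inverse_real_of_nat])
          (use s(2) in \<open>auto intro!: always_eventually less_imp_le\<close>)
      then have st: "s \<longlonglongrightarrow> t" by (rule tendsto_dist_iff[THEN iffD2])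
      have t01: "t \<in> {0..1}" using t by (simp add: S_def)
      have "\<exists>j. \<forall>u<n. \<forall>v<n. dist2 d (m (s j) u) (m (s j) v) = dist2 d (p u) (p v)"
      proof (rule nearby_solution_congruent[OF gen dn inf])
        show "dist2 d (m t u) (m t v) = dist2 d (p u) (p v)" if "u < n" "v < n" for u v
          using t g0[of t] that by (simp add: S_def)
        show "(\<lambda>j. m (s j) v i) \<longlonglongrightarrow> m t v i" if "v < n" "i < d" for v i
          by (rule continuous_on_tendsto_compose[OF cont[OF that] st t01]) (use s(1) in auto)
        show "dist2 d (m (s j) u) (m (s j) v) = dist2 d (p u) (p v)" if "u < n" "v < n" "{u, v} \<in> E" for j u v
          using edges[OF s(1)] that by blast
      qed
      then obtain j where "g (s j) = 0" unfolding g0 by blast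
      then show False using s(1)[of j] s(3)[of j] by (simp add: S_def)
    qed
  qed
  moreover have "0 \<in> S" using init by (simp add: S_def g0 dist2_def)
  ultimately have "S = {0..1}"
    using connected_Icc[of 0 "1::real"] unfolding connected_clopen by blast
  then show "\<forall>t\<in>{0..1}. \<forall>u<n. \<forall>v<n. dist2 d (m t u) (m t v) = dist2 d (p u) (p v)"
    using g0 by (auto simp: S_def)
qed

section \<open>Flexible graphs of large minimum degree\<close>

definition two_cliques :: "nat \<Rightarrow> nat \<Rightarrow> nat \<Rightarrow> nat set set" where
  "two_cliques n c s = {{u, v} | u v. u \<noteq> v \<and> u < n \<and> v < n \<and> (u < s \<and> v < s \<or> c \<le> u \<and> c \<le> v)}"

lemma two_cliques_edge: "{u, v} \<in> two_cliques n c s \<longleftrightarrow>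
    u \<noteq> v \<and> u < n \<and> v < n \<and> (u < s \<and> v < s \<or> c \<le> u \<and> c \<le> v)"
  by (auto simp: two_cliques_def doubleton_eq_iff)

lemma two_cliques_graph: "is_graph n (two_cliques n c s)"
  by (force simp: is_graph_def two_cliques_def)

text \<open>The cliques have \<open>s\<close> and \<open>n - c\<close> vertices, and
  \<open>s + c \<le> n\<close> makes the first no larger than the second.\<close>

lemma two_cliques_degree:
  assumes "c \<le> s" "s \<le> n" "s + c \<le> n" "k < s"
  shows "min_degree_ge n (two_cliques n c s) k"
  unfolding min_degree_ge_def
proof (intro allI impI)
  fix v assume v: "v < n"
  let ?N = "{u. u < n \<and> {u, v} \<in> two_cliques n c s}"
  show "k \<le> Defs.degree n (two_cliques n c s) v"
  proof (cases "v < s")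
    case True
    have "k \<le> card ({0..<s} - {v})" using True assms by simp
    also have "\<dots> \<le> card ?N"
      by (rule card_mono) (use True v assms in \<open>auto simp: two_cliques_edge\<close>)
    finally show ?thesis by (simp add: Defs.degree_def)
  next
    case False
    have "k \<le> card ({c..<n} - {v})" using False v assms by simp
    also have "\<dots> \<le> card ?N"
      by (rule card_mono) (use False v assms in \<open>auto simp: two_cliques_edge\<close>)
    finally show ?thesis by (simp add: Defs.degree_def)
  qed
qed

lemma flexible_imp_not_rigid:
  fixes m :: "real \<Rightarrow> nat \<Rightarrow> nat \<Rightarrow> real"
  assumes "\<And>v i. v < n \<Longrightarrow> i < d \<Longrightarrow> continuous_on {0..1} (\<lambda>t. m t v i)"
    and "\<And>v i. v < n \<Longrightarrow> i < d \<Longrightarrow> m 0 v i = p v i"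
    and "\<And>t u v. {u, v} \<in> E \<Longrightarrow> u < n \<Longrightarrow> v < n \<Longrightarrow> dist2 d (m t u) (m t v) = dist2 d (p u) (p v)"
    and "u < n" "v < n" "t \<in> {0..1}" "dist2 d (m t u) (m t v) \<noteq> dist2 d (p u) (p v)"
  shows "\<not> rigid_framework n d E p"
proof
  assume "rigid_framework n d E p"
  from this[unfolded rigid_framework_def, rule_format, of m] assms show False by blast
qed

text \<open>With overlap \<open>d - 1 = 0\<close> the cliques are disjoint, and one of them can be
  translated.\<close>

lemma two_cliques_flexible_line:
  assumes c: "0 < c" "c < n"
  shows "\<not> rigid_framework n 1 (two_cliques n c c) p"
proof -
  define m where "m t x i = p x i + (if x < c then 0 else t)" for t :: real and x i :: nat
  \<comment> \<open>A single time may fail, because a translation can carry the pair to the mirrored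
    position at the same distance; this cannot happen at both \<open>1/2\<close> and
    \<open>1\<close>.\<close>
  have "\<exists>t\<in>{0..1}. dist2 1 (m t 0) (m t c) \<noteq> dist2 1 (p 0) (p c)"
  proof (rule ccontr)
    assume "\<not> ?thesis"
    then have "\<And>t. t \<in> {0..1} \<Longrightarrow> dist2 1 (m t 0) (m t c) = dist2 1 (p 0) (p c)" by blast
    from this[of 1] this[of "1/2"] show False
      using c by (simp add: dist2_def m_def power2_eq_square algebra_simps)
  qed
  then obtain t where t: "t \<in> {0..1}" "dist2 1 (m t 0) (m t c) \<noteq> dist2 1 (p 0) (p c)" by blast
  show ?thesis
  proof (rule flexible_imp_not_rigid[where m = m and t = t and u = 0 and v = c])
    show "continuous_on {0..1} (\<lambda>t. m t v i)" for v i
      unfolding m_def by (cases "v < c") (auto intro!: continuous_intros)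
    show "dist2 1 (m t u) (m t v) = dist2 1 (p u) (p v)" if "{u, v} \<in> two_cliques n c c" for t u v
      using that by (auto simp: two_cliques_edge m_def dist2_def)
  qed (use c t in \<open>auto simp: m_def\<close>)
qed

section \<open>Rotation about a subspace of codimension two\<close>

lemma unit_orthogonal:
  assumes "finite A" "finite T" "h \<in> supp_in A" "T \<subseteq> supp_in A" "h \<notin> span T"
  obtains z where "z \<in> span (insert h T)" "ip A z z = 1" "\<And>t. t \<in> T \<Longrightarrow> ip A t z = 0" "ip A h z \<noteq> 0"
proof -
  obtain t where t: "t \<in> span T" and orth: "\<And>s. s \<in> span T \<Longrightarrow> ip A s (h - t) = 0"
    using orthogonal_projection[OF assms(1,2), of h] by metis
  define y where "y = h - t"
  have "span T \<subseteq> supp_in A" by (rule span_minimal[OF assms(4) subspace_supp_in])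
  then have "t \<in> supp_in A" using t by (rule subsetD)
  then have y: "y \<in> supp_in A" unfolding y_def by (rule subspace_diff[OF subspace_supp_in assms(3)])
  have "ip A y y \<noteq> 0"
  proof
    assume "ip A y y = 0"
    then have "y a = 0" for a
      using supp_inD[OF y, of a] assms(1) by (cases "a \<in> A") (simp_all add: ip_self_eq_0)
    then have "h = t" by (simp add: y_def fun_eq_iff)
    then show False using t assms(5) by simp
  qed
  then have pos: "ip A y y > 0" using ip_self_nonneg[of A y] by simp
  have hy: "ip A h y = ip A y y"
    using orth[OF t] by (simp add: y_def ip_diff_left)
  define z where "z = (1 / sqrt (ip A y y)) *\<^sub>R y"
  show ?thesis
  proof (rule that[of z])
    have "T \<subseteq> insert h T" by (rule subset_insertI)
    then have ts: "t \<in> span (insert h T)" using t by (rule subsetD[OF span_mono])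
    show "z \<in> span (insert h T)"
      unfolding z_def y_def by (rule span_scale[OF span_diff[OF span_base[OF insertI1] ts]])
    show "ip A z z = 1" using pos by (simp add: z_def ip_scale_left ip_scale_right)
    show "ip A s z = 0" if "s \<in> T" for s
      using orth[OF span_base[OF that]] by (simp add: z_def ip_scale_right y_def)
    show "ip A h z \<noteq> 0" using pos by (simp add: z_def ip_scale_right hy)
  qed
qed

text \<open>For orthonormal \<open>a\<close> and \<open>b\<close>, the rotation by
  \<open>\<theta>\<close> in their plane, equal to the identity on the orthogonal
  complement.\<close>

definition rotation ::
    "'a set \<Rightarrow> ('a \<Rightarrow> real) \<Rightarrow> ('a \<Rightarrow> real) \<Rightarrow> real \<Rightarrow> ('a \<Rightarrow> real) \<Rightarrow> 'a \<Rightarrow> real" where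
  "rotation A a b \<theta> w = w + (ip A w a * (cos \<theta> - 1) - ip A w b * sin \<theta>) *\<^sub>R a
      + (ip A w a * sin \<theta> + ip A w b * (cos \<theta> - 1)) *\<^sub>R b"

lemma rotation_diff: "rotation A a b \<theta> (w - w') = rotation A a b \<theta> w - rotation A a b \<theta> w'"
  by (simp add: rotation_def ip_diff_left algebra_simps)

lemma rotation_isometric:
  assumes "ip A a a = 1" "ip A b b = 1" "ip A a b = 0"
  shows "ip A (rotation A a b \<theta> w) (rotation A a b \<theta> w) = ip A w w"
proof -
  define P Q g s where "P = ip A w a" "Q = ip A w b" "g = cos \<theta> - 1" "s = sin \<theta>"
  note defs = this
  have "g\<^sup>2 + s\<^sup>2 = - 2 * g"
    using sin_cos_squared_add[of \<theta>] by (simp add: defs power2_diff)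
  then have gs: "(P\<^sup>2 + Q\<^sup>2) * (g\<^sup>2 + s\<^sup>2) = (P\<^sup>2 + Q\<^sup>2) * (- 2 * g)" by simp
  have "ip A (rotation A a b \<theta> w) (rotation A a b \<theta> w) =
      ip A w w + 2 * (P * g - Q * s) * P + 2 * (P * s + Q * g) * Q + (P * g - Q * s)\<^sup>2 + (P * s + Q * g)\<^sup>2"
    using assms unfolding rotation_def defs[symmetric]
    by (simp add: ip_add_left ip_add_right ip_scale_left ip_scale_right ip_commute[of A b a]
        ip_commute[of A a w] ip_commute[of A b w] defs[symmetric] power2_eq_square) (simp add: algebra_simps)
  also have "\<dots> = ip A w w + 2 * g * (P\<^sup>2 + Q\<^sup>2) + (P\<^sup>2 + Q\<^sup>2) * (g\<^sup>2 + s\<^sup>2)"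
    by (simp add: power2_eq_square algebra_simps)
  finally show ?thesis by (simp add: gs)
qed

text \<open>The overlap of the cliques spans an affine subspace of codimension two, about which the second
  clique can be rotated.\<close>
lemma two_cliques_flexible_space:
  assumes gen: "generic n d p" and d: "2 \<le> d" and c: "0 < c" "s = c + (d - 1)" "s < n"
  shows "\<not> rigid_framework n d (two_cliques n c s) p"
proof -
  define A where "A = {..<d}"
  have fA: "finite A" by (simp add: A_def)
  define L where "L x = lift d (p x) - lift d (p c)" for x
  have L_sup: "L x \<in> supp_in A" for x by (auto simp: L_def A_def lift_def supp_in_def)
  have Li: "L x i = p x i - p c i" if "i < d" for x i using that by (simp add: L_def lift_def)
  define T where "T = L ` {c..<s}"
  have fT: "finite T" by (simp add: T_def)
  have T_sup: "T \<subseteq> supp_in A" unfolding T_def by (intro image_subsetI L_sup)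
  have indep: "L v \<notin> span (L ` S)" if S: "S \<subseteq> {0..<n}" "card S \<le> d" "v < n" "v \<notin> S" "c \<in> S" for S v
  proof
    let ?U = "span ((\<lambda>x. lift d (p x)) ` S)"
    have mem: "lift d (p x) \<in> ?U" if "x \<in> S" for x by (rule span_base) (rule imageI, rule that)
    have "L ` S \<subseteq> ?U" unfolding L_def by (intro image_subsetI span_diff mem S(5))
    then have "span (L ` S) \<subseteq> ?U" by (rule span_minimal[OF _ subspace_span])
    moreover assume "L v \<in> span (L ` S)"
    ultimately have "L v \<in> ?U" by (rule subsetD)
    then have "L v + lift d (p c) \<in> ?U" by (intro span_add mem S(5))
    then show False using generic_lift_notin_span[OF gen S(1-4)] by (simp add: L_def)
  qed
  \<comment> \<open>The overlap has \<open>d - 1\<close> vertices, including the base point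
    \<open>c\<close>. Adding vertex 0 gives \<open>d\<close> points, the largest number for which
    general position still keeps vertex \<open>s\<close> out of the affine hull.\<close>
  have u: "L 0 \<notin> span T" unfolding T_def using c d by (intro indep) auto
  have ins: "insert (L 0) T = L ` insert 0 {c..<s}" by (simp add: T_def)
  have v: "L s \<notin> span (insert (L 0) T)" unfolding ins using c d by (intro indep) auto
  obtain a where a: "a \<in> span (insert (L 0) T)" "ip A a a = 1" "\<And>t. t \<in> T \<Longrightarrow> ip A t a = 0" "ip A (L 0) a \<noteq> 0"
    by (rule unit_orthogonal[OF fA fT L_sup T_sup u]) blast
  obtain b where b: "ip A b b = 1" "\<And>t. t \<in> insert (L 0) T \<Longrightarrow> ip A t b = 0" "ip A (L s) b \<noteq> 0"
    by (rule unit_orthogonal[OF fA finite.insertI[OF fT] L_sup _ v]) (use L_sup T_sup in auto)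
  have ab: "ip A a b = 0" by (rule ip_zero_span_left[OF b(2) a(1)])
  define rot where "rot = rotation A a b"
  define W where "W t x = (if x < c then L x else rot (pi * t) (L x))" for t x
  define m where "m t x i = p c i + W t x i" for t x i
  have rot_fix: "rot \<theta> (L x) = L x" if "c \<le> x" "x < s" for \<theta> x
  proof -
    have "L x \<in> T" unfolding T_def by (rule imageI) (use that in simp)
    then show ?thesis using a(3) b(2) by (simp add: rot_def rotation_def)
  qed
  have dm: "dist2 d (m t x) (m t y) = ip A (W t x - W t y) (W t x - W t y)" for t x y
    by (simp add: dist2_def m_def ip_def A_def power2_eq_square)
  have dp: "dist2 d (p x) (p y) = ip A (L x - L y) (L x - L y)" for x y
    by (simp add: dist2_def ip_def A_def Li power2_eq_square)
  have cross: "ip A (L 0) (rot \<theta> (L s)) = ip A (L 0) (L s)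
      + (ip A (L s) a * (cos \<theta> - 1) - ip A (L s) b * sin \<theta>) * ip A (L 0) a" for \<theta>
    using b(2) by (simp add: rot_def rotation_def ip_add_right ip_scale_right)
  have iso: "ip A (rot \<theta> w) (rot \<theta> w) = ip A w w" for \<theta> w
    unfolding rot_def by (rule rotation_isometric[OF a(2) b(1) ab])
  have change: "dist2 d (m t 0) (m t s) = dist2 d (p 0) (p s)
      - 2 * ((ip A (L s) a * (cos (pi * t) - 1) - ip A (L s) b * sin (pi * t)) * ip A (L 0) a)" for t
  proof -
    have "W t 0 = L 0" "W t s = rot (pi * t) (L s)" using c by (simp_all add: W_def)
    moreover have "ip A (L 0 - w) (L 0 - w) = ip A (L 0) (L 0) + ip A w w - 2 * ip A (L 0) w" for w
      by (simp add: ip_diff_left ip_diff_right ip_commute[of A w "L 0"])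
    ultimately show ?thesis unfolding dm dp by (simp add: iso cross)
  qed
  \<comment> \<open>At \<open>t = 1\<close> the sine vanishes, so constancy would make the component
    of \<open>L s\<close> along \<open>a\<close> zero; at \<open>t = 1/2\<close> the sine is 1, and
    the nonzero component along \<open>b\<close> is left.\<close>
  have "\<exists>t\<in>{0..1}. dist2 d (m t 0) (m t s) \<noteq> dist2 d (p 0) (p s)"
  proof (rule ccontr)
    assume "\<not> ?thesis"
    then have z: "ip A (L s) a * (cos (pi * t) - 1) - ip A (L s) b * sin (pi * t) = 0" if "t \<in> {0..1}" for t
      using that change[of t] a(4) by auto
    have "ip A (L s) a = 0" using z[of 1] by simp
    moreover have "cos (pi / 2) = (0::real)" "sin (pi / 2) = (1::real)" by simp_all
    ultimately show False using z[of "1/2"] b(3) by simp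
  qed
  then obtain t where t: "t \<in> {0..1}" "dist2 d (m t 0) (m t s) \<noteq> dist2 d (p 0) (p s)" by blast
  show ?thesis
  proof (rule flexible_imp_not_rigid[where m = m and t = t and u = 0 and v = s])
    show "continuous_on {0..1} (\<lambda>t. m t x i)" for x i
      unfolding m_def W_def rot_def rotation_def
      by (cases "x < c") (auto intro!: continuous_intros)
    show "m 0 x i = p x i" if "i < d" for x i
      by (simp add: m_def W_def rot_def rotation_def Li[OF that])
    show "dist2 d (m t x) (m t y) = dist2 d (p x) (p y)" if "{x, y} \<in> two_cliques n c s" for t x y
    proof (cases "x < s \<and> y < s")
      case True
      then have "W t x = L x" "W t y = L y" by (auto simp: W_def rot_fix)
      then show ?thesis by (simp add: dm dp)
    next
      case False
      then have "c \<le> x" "c \<le> y" using that by (auto simp: two_cliques_edge)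
      then have "W t x - W t y = rot (pi * t) (L x - L y)" by (simp add: W_def rot_def rotation_diff)
      then show ?thesis by (simp add: dm dp iso)
    qed
  qed (use c t in auto)
qed

lemma two_cliques_not_d_rigid:
  assumes "1 \<le> d" "0 < c" "s = c + (d - 1)" "s < n"
  shows "\<not> d_rigid n d (two_cliques n c s)"
proof (cases "d = 1")
  case True
  then show ?thesis using assms two_cliques_flexible_line[of c n] by (auto simp: d_rigid_def)
next
  case False
  then have "2 \<le> d" using assms by simp
  then show ?thesis using two_cliques_flexible_space[OF _ _ assms(2-4)] by (auto simp: d_rigid_def)
qed

theorem theorem1p2:
  fixes n d :: nat
  assumes "0 < n" and "0 < d" and "n \<ge> 29 * d"
  shows "int (f n d) = \<lceil>(real n + real d - 2) / 2\<rceil>"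
proof -
  \<comment> \<open>The ceiling of \<open>(n + d - 2) / 2\<close>, written with natural-number
    division.\<close>
  define K where "K = (n + d - 1) div 2"
  have rigid: "d_rigid n d E" if E: "is_graph n E" "min_degree_ge n E K" for E
  proof -
    obtain p where gen: "generic n d p" using generic_exists by blast
    have deg: "n + d \<le> 2 * Defs.degree n E v + 2" if "v < n" for v
    proof -
      have "K \<le> Defs.degree n E v" using E(2) that by (simp add: min_degree_ge_def)
      then show ?thesis using assms unfolding K_def by linarith
    qed
    have "rigid_framework n d E p"
      by (rule infinitesimally_rigid_imp_rigid[OF gen])
        (use assms generic_infinitesimally_rigid[OF gen _ assms(3) E(1) deg] in auto)
    then show ?thesis using gen by (auto simp: d_rigid_def)
  qed
  have "f n d = K"
    unfolding f_def
  proof (rule Least_equality)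
    show "\<forall>E. is_graph n E \<and> min_degree_ge n E K \<longrightarrow> d_rigid n d E" using rigid by blast
    fix k assume k: "\<forall>E. is_graph n E \<and> min_degree_ge n E k \<longrightarrow> d_rigid n d E"
    show "K \<le> k"
    proof (rule ccontr)
      assume "\<not> K \<le> k"
      then have "k < K" by simp
      \<comment> \<open>The overlap must consist of \<open>d - 1\<close> vertices. The first clique
        then has \<open>K\<close> vertices, hence degrees \<open>K - 1 \<ge> k\<close>, and the
        second has \<open>n - c\<close>, which is at least \<open>K\<close> because
        \<open>2 * K + 1 \<le> n + d\<close>.\<close>
      define c where "c = K - (d - 1)"
      have K: "d \<le> K" "2 * K + 1 \<le> n + d" "K < n" using assms by (auto simp: K_def)
      have "min_degree_ge n (two_cliques n c K) k"
        using K assms \<open>k < K\<close> by (intro two_cliques_degree) (auto simp: c_def)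
      moreover have "\<not> d_rigid n d (two_cliques n c K)"
        using K assms by (intro two_cliques_not_d_rigid) (auto simp: c_def)
      ultimately show False using k two_cliques_graph by blast
    qed
  qed
  moreover have "\<lceil>(real n + real d - 2) / 2\<rceil> = int K"
  proof (rule ceiling_unique)
    have "2 * K + 2 \<ge> n + d" "2 * K + 1 \<le> n + d" using assms by (auto simp: K_def)
    then have "2 * real K + 2 \<ge> real n + real d" "2 * real K + 1 \<le> real n + real d" by linarith+
    then show "real_of_int (int K) - 1 < (real n + real d - 2) / 2" "(real n + real d - 2) / 2 \<le> real_of_int (int K)"
      by simp_all
  qed
  ultimately show ?thesis by simp
qed

end
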